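(* Let $m\ge 2$ be an integer. The function $[a,b]\mapsto s([a,b])$ is a surjection from the set of reduced positive roots of the rank $2$ Kac--Moody algebra $\mathcal H(m)$ onto the set of rigid reflections of the Coxeter group $W(m)$.
   Context: Fix an integer $m\ge 2$. **Coxeter group.** $W(m)=\langle s_1,s_2,s_3 : s_1^2=s_2^2=s_3^2=(s_1s_2)^m=(s_2s_3)^m=e\rangle$ (so $m_{13}=\infty$). **Kac--Moody algebra.** $\mathcal H(m)$ is the rank $2$ Kac--Moody algebra with Cartan matrix $\begin{pmatrix}2&-m\\-m&2\end{pmatrix}$. Elements of its root lattice are written $[a,b]$, $a,b\in\mathbb Z$, with $[1,0]$ and $[0,1]$ the positive simple roots. (Recall that a nonzero $[a,b]$ is a root of $\mathcal H(m)$ if and only if $a^2+b^2-mab\le 1$.) A root $[a,b]$ is called reduced if $\gcd(a,b)=1$ and $ab\ne0$. **Labeled surface.** Let $\Sigma$ be the torus $\mathbb R^2/\mathbb Z^2$, obtained by gluing the triangle $G_1$ with vertices $(0,0),(1,0),(0,1)$ and the triangle $G_2$ with vertices $(1,0),(1,1),(0,1)$. Let $T_1$ be the image of the horizontal lines $y\in\mathbb Z$, $T_2$ the image of the diagonal lines $x+y\in\mathbb Z$, and $T_3$ the image of the vertical lines $x\in\mathbb Z$. These are three loops through the single vertex $V$, the image of $\mathbb Z^2$. Put $\mathcal T=T_1\cup T_2\cup T_3$. Let $L_1$ be the segment from the center of $G_1$ to its vertex $(0,0)$, and $L_2$ the segment from the center of $G_2$ to its vertex $(1,1)$ (in each triangle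 this is the common endpoint of $T_3$ and $T_1$). **Admissible curves.** An admissible curve is a continuous $\eta:[0,1]\to\Sigma$ such that (1) $\eta(x)\in V$ iff $x\in\{0,1\}$; (2) there is $\epsilon>0$ with $\eta([0,\epsilon])\subset L_1$ and $\eta([1-\epsilon,1])\subset L_2$; (3) if $\eta(x)\in\mathcal T\setminus V$ then $\eta([x-\epsilon,x+\epsilon])$ meets $\mathcal T$ transversally for sufficiently small $\epsilon>0$. If $\{x\in(0,1):\eta(x)\in\mathcal T\}=\{x_1<\cdots<x_k\}$ with $\eta(x_\ell)\in T_{i_\ell}$, put $\upsilon(\eta)=i_1\cdots i_k$ (a word in $\{1,2,3\}$) and $s(\eta)=s_{i_1}\cdots s_{i_k}\in W(m)$. The curve is non-self-crossing if it has no self-intersections other than the coincidence of its two endpoints at $V$. **Rigid reflections.** Let $\mathfrak R$ be the set of words $i_1\cdots i_k$ in $\{1,2,3\}$ with $k$ odd and $i_j=i_{k+1-j}$ for all $j$. An element $s_{i_1}\cdots s_{i_k}\in W(m)$ is a rigid reflection if there is a non-self-crossing admissible curve $\eta$ with $\upsilon(\eta)=i_1\cdots i_k\in\mathfrak R$. **The map.** Let $\mathcal P^+=\{[a,b]:a,b\in\mathbb Z_{>0},\gcd(a,b)=1\}$; every reduced positive root lies in $\mathcal P^+$. For $[a,b]\in\mathcal P^+$ let $\eta([a,b])$ be the straight line segment from $(0,0)$ to $(a,b)$ in the universal cover $\mathbb R^2$ (regarded as an admissible curve on $\Sigma$ after adjusting it inside the corners at its ends), and let $s([a,b]):=s(\eta([a,b]))\in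 W(m)$ be the product, in order along the open segment, of $s_1,s_2,s_3$ for each crossing of a horizontal line $y\in\mathbb Z$, a diagonal line $x+y\in\mathbb Z$, a vertical line $x\in\mathbb Z$, respectively. For example $s([1,1])=s_2$ and $s([2,1])=s_2s_3s_2$. *)

theory Defs
  imports "HOL-Analysis.Analysis" "HOL-Algebra.Group"
begin

section \<open>The Coxeter group $W(m)$\<close>

text \<open>
  Group presentations.  The letter \<open>(g, True)\<close> stands for the generator \<open>g\<close> and
  \<open>(g, False)\<close> for its formal inverse; all elements of the type \<open>'a\<close> are generators.
  A relator \<open>r\<close> is imposed as the relation \<open>r = 1\<close>.
\<close>

inductive pres_eq :: "('a \<times> bool) list set \<Rightarrow> ('a \<times> bool) list \<Rightarrow> ('a \<times> bool) list \<Rightarrow> bool"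
  for R where
  refl: "pres_eq R u u"
| sym: "pres_eq R u v \<Longrightarrow> pres_eq R v u"
| trans: "pres_eq R u v \<Longrightarrow> pres_eq R v w \<Longrightarrow> pres_eq R u w"
| cancel: "pres_eq R (u @ [(g, b), (g, \<not> b)] @ v) (u @ v)"
| relator: "r \<in> R \<Longrightarrow> pres_eq R (u @ r @ v) (u @ v)"

definition pres_class :: "('a \<times> bool) list set \<Rightarrow> ('a \<times> bool) list \<Rightarrow> ('a \<times> bool) list set" where
  "pres_class R u = {v. pres_eq R u v}"

definition presented_group :: "('a \<times> bool) list set \<Rightarrow> ('a \<times> bool) list set monoid" where
  "presented_group R =
    \<lparr>carrier = range (pres_class R),
     mult = (\<lambda>X Y. \<Union>x\<in>X. \<Union>y\<in>Y. pres_class R (x @ y)),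
     one = pres_class R []\<rparr>"

datatype index = I1 | I2 | I3

definition relators :: "nat \<Rightarrow> (index \<times> bool) list set" where
  "relators m = map (\<lambda>i. (i, True)) `
     {[I1, I1], [I2, I2], [I3, I3],
      concat (replicate m [I1, I2]), concat (replicate m [I2, I3])}"

definition W :: "nat \<Rightarrow> (index \<times> bool) list set monoid" where
  "W m = presented_group (relators m)"

definition refl_gen :: "nat \<Rightarrow> index \<Rightarrow> (index \<times> bool) list set" where
  "refl_gen m i = pres_class (relators m) [(i, True)]"

definition word_elt :: "nat \<Rightarrow> index list \<Rightarrow> (index \<times> bool) list set" where
  "word_elt m w = foldr (\<lambda>i g. refl_gen m i \<otimes>\<^bsub>W m\<^esub> g) w \<one>\<^bsub>W m\<^esub>"


section \<open>Kac--Moody algebras and the rank 2 algebra $\mathcal H(m)$\<close>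

text \<open>
  The Kac--Moody algebra of a complex square matrix \<open>A\<close> is characterised, uniquely up to
  isomorphism, as in Kac, \<^emph>\<open>Infinite dimensional Lie algebras\<close>, Proposition 1.4: a Lie algebra
  with a minimal realization of \<open>A\<close> on a commutative subalgebra \<open>cartan\<close> and Chevalley
  generators subject to the usual relations, without nonzero ideals that meet \<open>cartan\<close>
  trivially.  The algebra is the whole type \<open>'g\<close>; only the values of \<open>simple_root i\<close> on
  \<open>cartan\<close> matter.
\<close>

record ('i, 'g) kac_moody_data =
  lscale :: "complex \<Rightarrow> 'g \<Rightarrow> 'g"
  bracket :: "'g \<Rightarrow> 'g \<Rightarrow> 'g"
  cartan :: "'g set"
  chev_e :: "'i \<Rightarrow> 'g"
  chev_f :: "'i \<Rightarrow> 'g"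
  coroot :: "'i \<Rightarrow> 'g"
  simple_root :: "'i \<Rightarrow> 'g \<Rightarrow> complex"

locale lie_algebra = vector_space "lscale L"
  for L :: "('i, 'g::ab_group_add, 'z) kac_moody_data_scheme" +
  assumes bracket_add_left: "bracket L (x + y) z = bracket L x z + bracket L y z"
    and bracket_add_right: "bracket L x (y + z) = bracket L x y + bracket L x z"
    and bracket_scale_left: "bracket L (lscale L c x) y = lscale L c (bracket L x y)"
    and bracket_scale_right: "bracket L x (lscale L c y) = lscale L c (bracket L x y)"
    and bracket_self: "bracket L x x = 0"
    and jacobi: "bracket L x (bracket L y z) + bracket L y (bracket L z x)
                   + bracket L z (bracket L x y) = 0"

locale kac_moody_algebra = lie_algebra L
  for A :: "complex^'i::finite^'i" and L :: "('i, 'g::ab_group_add, 'z) kac_moody_data_scheme" +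
  assumes cartan_subspace: "subspace (cartan L)"
    and cartan_finite_dim: "\<exists>B. finite B \<and> span B = cartan L"
    and cartan_dim: "dim (cartan L) = 2 * CARD('i) - rank A"
    and coroot_cartan: "coroot L i \<in> cartan L"
    and coroot_independent: "inj (coroot L)" "independent (range (coroot L))"
    and simple_root_add: "\<lbrakk>h \<in> cartan L; k \<in> cartan L\<rbrakk>
          \<Longrightarrow> simple_root L i (h + k) = simple_root L i h + simple_root L i k"
    and simple_root_scale: "h \<in> cartan L
          \<Longrightarrow> simple_root L i (lscale L c h) = c * simple_root L i h"
    and simple_root_independent: "(\<forall>h\<in>cartan L. (\<Sum>i\<in>UNIV. d i * simple_root L i h) = 0)
          \<Longrightarrow> d i = 0"
    and realization: "simple_root L j (coroot L i) = A $ i $ j"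
    and cartan_commute: "\<lbrakk>h \<in> cartan L; k \<in> cartan L\<rbrakk> \<Longrightarrow> bracket L h k = 0"
    and e_weight: "h \<in> cartan L
          \<Longrightarrow> bracket L h (chev_e L i) = lscale L (simple_root L i h) (chev_e L i)"
    and f_weight: "h \<in> cartan L
          \<Longrightarrow> bracket L h (chev_f L i) = lscale L (- simple_root L i h) (chev_f L i)"
    and e_f: "bracket L (chev_e L i) (chev_f L j) = (if i = j then coroot L i else 0)"
    and generated: "\<lbrakk>subspace S; \<forall>x\<in>S. \<forall>y\<in>S. bracket L x y \<in> S;
          cartan L \<subseteq> S; range (chev_e L) \<subseteq> S; range (chev_f L) \<subseteq> S\<rbrakk> \<Longrightarrow> S = UNIV"
    and no_ideal: "\<lbrakk>subspace J; \<forall>x. \<forall>y\<in>J. bracket L x y \<in> J; J \<inter> cartan L = {0}\<rbrakk>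
          \<Longrightarrow> J = {0}"

text \<open>An integer vector \<open>c\<close> stands for the element \<open>\<Sum>i. c $ i * \<alpha>\<^sub>i\<close> of the root lattice.\<close>

definition lattice_weight ::
  "('i::finite, 'g, 'z) kac_moody_data_scheme \<Rightarrow> int^'i \<Rightarrow> 'g \<Rightarrow> complex" where
  "lattice_weight L c h = (\<Sum>i\<in>UNIV. of_int (c $ i) * simple_root L i h)"

definition root_space ::
  "('i::finite, 'g, 'z) kac_moody_data_scheme \<Rightarrow> int^'i \<Rightarrow> 'g set" where
  "root_space L c = {x. \<forall>h\<in>cartan L. bracket L h x = lscale L (lattice_weight L c h) x}"

definition is_root :: "('i::finite, 'g::zero, 'z) kac_moody_data_scheme \<Rightarrow> int^'i \<Rightarrow> bool" where
  "is_root L c \<longleftrightarrow> c \<noteq> 0 \<and> root_space L c \<noteq> {0}"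

definition cartan_matrix :: "nat \<Rightarrow> complex^2^2" where
  "cartan_matrix m = vector [vector [2, - of_nat m], vector [- of_nat m, 2]]"

text \<open>The pair \<open>(a, b)\<close> is the root lattice element $[a,b]$.\<close>

definition reduced_positive_roots ::
  "(2, 'g::zero, 'z) kac_moody_data_scheme \<Rightarrow> (int \<times> int) set" where
  "reduced_positive_roots L =
    {(a, b). is_root L (vector [a, b]) \<and> a \<ge> 0 \<and> b \<ge> 0 \<and> gcd a b = 1 \<and> a * b \<noteq> 0}"


section \<open>The labeled torus\<close>

definition lattice_equiv :: "real \<times> real \<Rightarrow> real \<times> real \<Rightarrow> bool" where
  "lattice_equiv p q \<longleftrightarrow> fst p - fst q \<in> \<int> \<and> snd p - snd q \<in> \<int>"

lemma equivp_lattice_equiv: "equivp lattice_equiv"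
proof (rule equivpI)
  show "reflp lattice_equiv"
    by (simp add: reflp_def lattice_equiv_def)
  show "symp lattice_equiv"
    unfolding symp_def lattice_equiv_def by (metis Ints_minus minus_diff_eq)
  show "transp lattice_equiv"
    unfolding transp_def lattice_equiv_def
    by (metis (no_types, opaque_lifting) Ints_add diff_add_cancel add_diff_eq)
qed

quotient_type torus = "real \<times> real" / lattice_equiv
  by (rule equivp_lattice_equiv)

abbreviation torus_proj :: "real \<times> real \<Rightarrow> torus" where
  "torus_proj \<equiv> abs_torus"

text \<open>The quotient topology.\<close>

instantiation torus :: topological_space
begin

definition open_torus :: "torus set \<Rightarrow> bool" where
  "open_torus U \<longleftrightarrow> open (torus_proj -` U)"

instance
  by standard (auto simp: open_torus_def vimage_Union)

end

text \<open>The preimage of \<open>edge i\<close> (the loop $T_i$) in the plane is \<open>{p. level i p \<in> \<int>}\<close>.\<close>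

fun level :: "index \<Rightarrow> real \<times> real \<Rightarrow> real" where
  "level I1 (x, y) = y"
| "level I2 (x, y) = x + y"
| "level I3 (x, y) = x"

definition edge :: "index \<Rightarrow> torus set" where
  "edge i = torus_proj ` {p. level i p \<in> \<int>}"

definition edges :: "torus set" where
  "edges = (\<Union>i. edge i)"

definition vertex :: torus where
  "vertex = torus_proj (0, 0)"

text \<open>
  Segments from the centroids of the triangles $(0,0),(1,0),(0,1)$ and $(1,0),(1,1),(0,1)$.
\<close>

definition start_segment :: "torus set" where
  "start_segment = torus_proj ` closed_segment (1/3, 1/3) (0, 0)"

definition end_segment :: "torus set" where
  "end_segment = torus_proj ` closed_segment (2/3, 2/3) (1, 1)"


section \<open>Admissible curves, rigid reflections\<close>

text \<open>
  Curves are merely continuous, so transversality is understood topologically: near the time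
  \<open>x\<close> a local lift of the curve to the plane passes strictly from one side of a line
  \<open>level i = n\<close>, \<open>n \<in> \<int>\<close>, to the other, and is on that line only at time \<open>x\<close>.
\<close>

definition crosses_transversally :: "(real \<Rightarrow> torus) \<Rightarrow> real \<Rightarrow> bool" where
  "crosses_transversally \<eta> x \<longleftrightarrow>
    (\<exists>i \<epsilon> \<gamma>. \<epsilon> > 0 \<and> {x-\<epsilon>..x+\<epsilon>} \<subseteq> {0..1} \<and> continuous_on {x-\<epsilon>..x+\<epsilon>} \<gamma> \<and>
       (\<forall>t\<in>{x-\<epsilon>..x+\<epsilon>}. torus_proj (\<gamma> t) = \<eta> t) \<and>
       level i (\<gamma> x) \<in> \<int> \<and>
       ((\<forall>t\<in>{x-\<epsilon>..<x}. level i (\<gamma> t) < level i (\<gamma> x)) \<and>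
        (\<forall>t\<in>{x<..x+\<epsilon>}. level i (\<gamma> t) > level i (\<gamma> x)) \<or>
        (\<forall>t\<in>{x-\<epsilon>..<x}. level i (\<gamma> t) > level i (\<gamma> x)) \<and>
        (\<forall>t\<in>{x<..x+\<epsilon>}. level i (\<gamma> t) < level i (\<gamma> x))))"

definition admissible :: "(real \<Rightarrow> torus) \<Rightarrow> bool" where
  "admissible \<eta> \<longleftrightarrow>
     path \<eta> \<and>
     (\<forall>x\<in>{0..1}. \<eta> x = vertex \<longleftrightarrow> x \<in> {0, 1}) \<and>
     (\<exists>\<epsilon>>0. \<epsilon> \<le> 1 \<and> \<eta> ` {0..\<epsilon>} \<subseteq> start_segment \<and> \<eta> ` {1-\<epsilon>..1} \<subseteq> end_segment) \<and>
     (\<forall>x\<in>{0..1}. \<eta> x \<in> edges - {vertex} \<longrightarrow> crosses_transversally \<eta> x)"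

text \<open>
  For an admissible curve the set of crossing times is finite, and distinct edges meet only at
  \<open>vertex\<close>, so the following is the word read off along the curve.
\<close>

definition curve_word :: "(real \<Rightarrow> torus) \<Rightarrow> index list" where
  "curve_word \<eta> = map (\<lambda>x. THE i. \<eta> x \<in> edge i)
                      (sorted_list_of_set {x \<in> {0<..<1}. \<eta> x \<in> edges})"

definition curve_elt :: "nat \<Rightarrow> (real \<Rightarrow> torus) \<Rightarrow> (index \<times> bool) list set" where
  "curve_elt m \<eta> = word_elt m (curve_word \<eta>)"

definition odd_palindromes :: "index list set" where
  "odd_palindromes = {w. odd (length w) \<and> rev w = w}"

definition rigid_reflections :: "nat \<Rightarrow> (index \<times> bool) list set set" where
  "rigid_reflections m =
    {curve_elt m \<eta> | \<eta>. admissible \<eta> \<and> loop_free \<eta> \<and> curve_word \<eta> \<in> odd_palindromes}"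

text \<open>
  The straight segment satisfies the condition on its ends only after a small deformation inside
  the corners of the triangles at its ends; this does not change its crossings, so the word is
  read off from the segment itself.
\<close>

definition straight_curve :: "int \<times> int \<Rightarrow> real \<Rightarrow> torus" where
  "straight_curve = (\<lambda>(a, b) t. torus_proj (t * of_int a, t * of_int b))"

definition root_reflection :: "nat \<Rightarrow> int \<times> int \<Rightarrow> (index \<times> bool) list set" where
  "root_reflection m ab = curve_elt m (straight_curve ab)"

end

theory Submission
  imports Defs
begin

text \<open>
  A non-self-crossing curve is cut at its crossings into chords of the two triangles.  By the
  Fashoda meet theorem the chords in each triangle do not cross, so the curve is encoded by two
  noncrossing matchings of its crossings and the vertex.  After cancelling backtracks, either the
  curve meets \<open>T\<^sub>2\<close> first and last, and then comparing ranks along the edges shows that it reads the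
  same word as a straight segment; or it turns around the vertex, and moving the vertex to the next
  corner removes the first and last crossings at the price of a braid move applied to the triple
  \<open>(s\<^sub>1, s\<^sub>2, s\<^sub>3)\<close>.  The word of a straight segment obeys the Euclidean algorithm, each step being a
  braid move of the triple.  The relations \<open>(s\<^sub>1 s\<^sub>2)\<^sup>m = (s\<^sub>2 s\<^sub>3)\<^sup>m = 1\<close> make the resulting element
  invariant under the shears by \<open>m\<close>, which carry every direction to one with
  \<open>a\<^sup>2 + b\<^sup>2 - m a b \<le> 1\<close>.  Such a vector is a root because the strings through lowest weight
  vectors of the two copies of \<open>sl\<^sub>2\<close> reach it from a simple root.
\<close>

section \<open>Braid moves on triples of involutions\<close>

text \<open>The group theory concerns directions rather than curves. Three involutions are the
  values in the directions (1,0), (1,1), (0,1), a triangle of the Farey tessellation; a braid move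
  passes to an adjacent triangle, so the triple determines a value for every direction of the first
  quadrant. The obstacle is that half a turn around the vertex returns a conjugate of the value, not
  the value itself. A curve that winds around the vertex has to be measured against transformed
  triples, so one set \<open>R\<close>, the values of the original triple at roots, is kept fixed
  while the triple varies. The relations enter as follows: \<open>m\<close> shears along an axis
  multiply two members of the triple by a trivial \<open>m\<close>-th power, so the values are
  periodic in the direction, and this periodicity also absorbs the turn.

  On the geometric side only the order of the crossings along the three edges is retained. A
  straight segment, bent near its ends, is itself such a curve, so its word comes from the same
  ranking argument as that of any reduced curve.\<close>

context group begin

definition involutions :: "'a set" where
  "involutions = {x \<in> carrier G. x \<otimes> x = \<one>}"

lemma involutions_carrier [simp]: "x \<in> involutions \<Longrightarrow> x \<in> carrier G"
  by (simp add: involutions_def)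

lemma involution_square [simp]: "x \<in> involutions \<Longrightarrow> x \<otimes> x = \<one>"
  unfolding involutions_def by blast

lemma involution_cancel [simp]: "x \<in> involutions \<Longrightarrow> w \<in> carrier G \<Longrightarrow> x \<otimes> (x \<otimes> w) = w"
  by (simp flip: m_assoc)

lemma involution_conj [simp]:
  "x \<in> involutions \<Longrightarrow> y \<in> involutions \<Longrightarrow> x \<otimes> (y \<otimes> x) \<in> involutions"
proof -
  assume x: "x \<in> involutions" and y: "y \<in> involutions"
  then have "x \<otimes> (y \<otimes> x) \<otimes> (x \<otimes> (y \<otimes> x)) = \<one>" by (simp add: m_assoc)
  moreover have "x \<otimes> (y \<otimes> x) \<in> carrier G" using x y by simp
  ultimately show ?thesis unfolding involutions_def by blast
qed

lemma involution_conj_pow: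
  assumes "z \<in> involutions" "g \<in> carrier G"
  shows "(z \<otimes> (g \<otimes> z)) [^] (n::nat) = z \<otimes> (g [^] n \<otimes> z)"
  using assms by (induction n) (simp_all add: m_assoc)

text \<open>Euclid's algorithm on the direction \<open>(a, b)\<close>, where \<open>x\<close>,
  \<open>y\<close>, \<open>z\<close> are the values at (1,0), (1,1), (0,1). A shear makes the half
  of the quadrant that contains \<open>(a, b)\<close> the new quadrant; for \<open>b \<le> a\<close>
  the old (2,1), with value \<open>y z y\<close>, becomes the new diagonal and the old (1,1) the new
  vertical axis. The zero direction gets the default \<open>z\<close>, hence the conditions
  \<open>a > 0 \<or> b > 0\<close> later on.\<close>

function slope_elt :: "'a \<Rightarrow> 'a \<Rightarrow> 'a \<Rightarrow> nat \<Rightarrow> nat \<Rightarrow> 'a" where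
  "slope_elt x y z a b =
     (if a = 0 then z else if b = 0 then x
      else if b \<le> a then slope_elt x (y \<otimes> (z \<otimes> y)) y (a - b) b
      else slope_elt y (y \<otimes> (x \<otimes> y)) z a (b - a))"
  by auto
termination by (relation "Wellfounded.measure (\<lambda>(x, y, z, a, b). a + b)") auto

declare slope_elt.simps [simp del]

lemma slope_elt_0 [simp]:
  "slope_elt x y z 0 b = z" "a > 0 \<Longrightarrow> slope_elt x y z a 0 = x"
  by (simp_all add: slope_elt.simps)

lemma slope_elt_add_left:
  "b > 0 \<Longrightarrow> slope_elt x y z (a + b) b = slope_elt x (y \<otimes> (z \<otimes> y)) y a b"
  by (subst slope_elt.simps) simp

lemma slope_elt_add_right:
  assumes "a > 0"
  shows "slope_elt x y z a (a + b) = slope_elt y (y \<otimes> (x \<otimes> y)) z a b"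
  using assms slope_elt_add_left[of a x y z 0]
  by (cases "b = 0") (simp_all add: slope_elt.simps[of x y z a "a + b"])

lemma slope_elt_mirror:
  "a > 0 \<or> b > 0 \<Longrightarrow> slope_elt z y x b a = slope_elt x y z a b"
proof (induction "a + b" arbitrary: a b x y z rule: less_induct)
  case less
  consider "a = 0" | "b = 0" | "a > 0" "b > 0" "b \<le> a" | "a > 0" "b > 0" "a < b" by linarith
  then show ?case
  proof cases
    case 3
    then obtain c where c: "a = c + b" by (metis le_add_diff_inverse2)
    show ?thesis
      using 3 less.hyps[of c b y "y \<otimes> (z \<otimes> y)" x] c
        slope_elt_add_left[of b x y z c] slope_elt_add_right[of b z y x c]
      by (simp add: add.commute)
  next
    case 4
    then obtain c where c: "b = c + a" by (metis less_imp_le le_add_diff_inverse2)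
    show ?thesis
      using 4 less.hyps[of a c z "y \<otimes> (x \<otimes> y)" y] c
        slope_elt_add_left[of a z y x c] slope_elt_add_right[of a x y z c]
      by (simp add: add.commute)
  qed (use less.prems in auto)
qed

lemma slope_elt_mult:
  "d > 0 \<Longrightarrow> slope_elt x y z (d * a) (d * b) = slope_elt x y z a b"
proof (induction x y z a b rule: slope_elt.induct)
  case (1 x y z a b)
  then show ?case
    by (simp add: slope_elt.simps[of x y z a b] slope_elt.simps[of x y z "d * a"] diff_mult_distrib2)
qed

text \<open>The map \<open>(a, b) \<mapsto> (b, b - a)\<close> has order six and sends (1,1), (0,1),
  (-1,0) to (1,0), (1,1), (0,1). The third argument is thus the value at (-1,0): after half a turn
  \<open>x\<close> appears conjugated by \<open>z y\<close>.\<close>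

lemma slope_elt_half_turn:
  assumes "x \<in> involutions" "y \<in> involutions" "z \<in> involutions" "a \<le> b" "b > 0"
  shows "slope_elt x y z a b = slope_elt y z (z \<otimes> (y \<otimes> (x \<otimes> (y \<otimes> z)))) b (b - a)"
proof -
  obtain c where c: "b = a + c" using assms(4) le_Suc_ex by blast
  consider "a = 0" | "c = 0" | "a > 0" "c > 0" by blast
  then show ?thesis
  proof cases
    case 1
    then show ?thesis
      using assms slope_elt_add_right[of b y z "z \<otimes> (y \<otimes> (x \<otimes> (y \<otimes> z)))" 0] by simp
  next
    case 2
    then show ?thesis using assms slope_elt_add_right[of b x y z 0] c by simp
  next
    case 3
    then show ?thesis
      using assms slope_elt_add_right[of a x y z c]
        slope_elt_add_left[of c y z "z \<otimes> (y \<otimes> (x \<otimes> (y \<otimes> z)))" a] c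
      by (simp add: m_assoc add.commute)
  qed
qed

text \<open>The direction \<open>(a, b)\<close> may lie anywhere in the upper half plane; the second quadrant
  is the first one turned by a right angle.\<close>

definition upper_elt :: "'a \<Rightarrow> 'a \<Rightarrow> 'a \<Rightarrow> int \<Rightarrow> nat \<Rightarrow> 'a" where
  "upper_elt x y z a b =
     (if a \<ge> 0 then slope_elt x y z (nat a) b
      else slope_elt z (z \<otimes> (y \<otimes> z)) (z \<otimes> (y \<otimes> (x \<otimes> (y \<otimes> z)))) b (nat (- a)))"

text \<open>A direction with \<open>0 \<le> a < b\<close> changes quadrant and needs
  \<open>slope_elt_half_turn\<close>; any other stays in its quadrant, where the shear is one
  Euclidean step.\<close>

lemma upper_elt_shear:
  assumes "x \<in> involutions" "y \<in> involutions" "z \<in> involutions" "b > 0"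
  shows "upper_elt x y z a b = upper_elt x (y \<otimes> (z \<otimes> y)) y (a - int b) b"
proof -
  consider "a \<ge> int b" | "0 \<le> a" "a < int b" | "a < 0" by linarith
  then show ?thesis
  proof cases
    case 1
    then show ?thesis
      using assms slope_elt_add_left[of b x y z "nat (a - int b)"]
      by (simp add: upper_elt_def nat_diff_distrib)
  next
    case 2
    have "nat (int b - a) = b - nat a" using 2 by linarith
    then show ?thesis
      using assms 2 slope_elt_half_turn[of x y z "nat a" b] by (simp add: upper_elt_def m_assoc)
  next
    case 3
    have "nat (int b - a) = b + nat (- a)" using 3 by linarith
    then show ?thesis
      using assms 3 slope_elt_add_right[of b y z "z \<otimes> (y \<otimes> (x \<otimes> (y \<otimes> z)))" "nat (- a)"]
      by (simp add: upper_elt_def m_assoc)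
  qed
qed

text \<open>The shear replaces \<open>(y, z)\<close> by \<open>(y z y, y)\<close>, whose product is
  again \<open>y z\<close>. Iterating it therefore only collects powers of \<open>y z\<close> on the
  left, which vanish for \<open>n = m\<close> in a Coxeter triple.\<close>

lemma upper_elt_shear_pow:
  assumes "x \<in> involutions" "y \<in> involutions" "z \<in> involutions" "b > 0"
  shows "upper_elt x y z a b =
    upper_elt x ((y \<otimes> z) [^] n \<otimes> y) ((y \<otimes> z) [^] n \<otimes> z) (a - int n * int b) b"
  using assms
proof (induction n arbitrary: y z a)
  case (Suc n)
  have 1: "y \<otimes> (z \<otimes> y) \<otimes> y = y \<otimes> z" using Suc.prems by (simp add: m_assoc)
  have "upper_elt x y z a b = upper_elt x (y \<otimes> (z \<otimes> y)) y (a - int b) b"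
    using Suc.prems by (intro upper_elt_shear) auto
  also have "\<dots> = upper_elt x ((y \<otimes> z) [^] n \<otimes> (y \<otimes> (z \<otimes> y))) ((y \<otimes> z) [^] n \<otimes> y)
       (a - int b - int n * int b) b"
    using Suc.IH[of "y \<otimes> (z \<otimes> y)" y "a - int b"] Suc.prems unfolding 1 by auto
  also have "\<dots> = upper_elt x ((y \<otimes> z) [^] Suc n \<otimes> y) ((y \<otimes> z) [^] Suc n \<otimes> z)
       (a - int (Suc n) * int b) b"
    using Suc.prems by (simp add: m_assoc algebra_simps)
  finally show ?case .
qed simp

end

section \<open>Periodicity modulo m and reduction of directions to roots\<close>

locale coxeter_triples = group G for G (structure) +
  fixes m :: nat
  assumes two_le_m: "2 \<le> m"
begin

definition coxeter_triple :: "'a \<Rightarrow> 'a \<Rightarrow> 'a \<Rightarrow> bool" where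
  "coxeter_triple x y z \<longleftrightarrow> x \<in> involutions \<and> y \<in> involutions \<and> z \<in> involutions \<and>
     (x \<otimes> y) [^] m = \<one> \<and> (y \<otimes> z) [^] m = \<one>"

lemma coxeter_triple_mirror: "coxeter_triple x y z \<Longrightarrow> coxeter_triple z y x"
proof -
  assume t: "coxeter_triple x y z"
  have "z \<otimes> y = z \<otimes> (y \<otimes> z \<otimes> z)" "y \<otimes> x = y \<otimes> (x \<otimes> y \<otimes> y)"
    using t by (simp_all add: coxeter_triple_def m_assoc)
  then have "(z \<otimes> y) [^] m = z \<otimes> ((y \<otimes> z) [^] m \<otimes> z)" "(y \<otimes> x) [^] m = y \<otimes> ((x \<otimes> y) [^] m \<otimes> y)"
    using t involution_conj_pow[of z "y \<otimes> z" m] involution_conj_pow[of y "x \<otimes> y" m]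
    by (simp_all add: coxeter_triple_def)
  then show ?thesis using t by (simp add: coxeter_triple_def)
qed

text \<open>These are the values at (0,1), (-1,1), (-1,0), the second quadrant. The products of
  neighbours are \<open>y z\<close> and the conjugate of \<open>x y\<close> by \<open>z\<close>, so
  both relations survive.\<close>

lemma coxeter_triple_turn:
  "coxeter_triple x y z \<Longrightarrow>
   coxeter_triple z (z \<otimes> (y \<otimes> z)) (z \<otimes> (y \<otimes> (x \<otimes> (y \<otimes> z))))"
proof -
  assume t: "coxeter_triple x y z"
  have xyz: "x \<in> involutions" "y \<in> involutions" "z \<in> involutions"
    using t by (auto simp: coxeter_triple_def)
  have "z \<otimes> (y \<otimes> z) \<otimes> (z \<otimes> (y \<otimes> (x \<otimes> (y \<otimes> z)))) = z \<otimes> (x \<otimes> y \<otimes> z)"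
    "z \<otimes> (z \<otimes> (y \<otimes> z)) = y \<otimes> z"
    "z \<otimes> (y \<otimes> (x \<otimes> (y \<otimes> z))) = z \<otimes> ((y \<otimes> (x \<otimes> y)) \<otimes> z)"
    using xyz by (simp_all add: m_assoc)
  moreover have "z \<otimes> ((y \<otimes> (x \<otimes> y)) \<otimes> z) \<in> involutions" using xyz by auto
  ultimately show ?thesis
    using t involution_conj_pow[of z "x \<otimes> y" m] xyz by (simp add: coxeter_triple_def)
qed

lemma coxeter_triple_turn_back:
  "coxeter_triple x y z \<Longrightarrow>
   coxeter_triple (x \<otimes> (y \<otimes> (z \<otimes> (y \<otimes> x)))) (x \<otimes> (y \<otimes> x)) x"
  using coxeter_triple_mirror coxeter_triple_turn by blast

lemma upper_elt_periodic:
  assumes "coxeter_triple x y z" "b > 0"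
  shows "upper_elt x y z a b = upper_elt x y z (a - int m * int b) b"
  using assms upper_elt_shear_pow[of x y z b a m] by (simp add: coxeter_triple_def)

lemma slope_elt_periodic_left:
  assumes "coxeter_triple x y z" "b > 0"
  shows "slope_elt x y z (a + m * b) b = slope_elt x y z a b"
proof -
  have "upper_elt x y z (int (a + m * b)) b = upper_elt x y z (int a) b"
    using upper_elt_periodic[OF assms, of "int (a + m * b)"] by simp
  then show ?thesis unfolding upper_elt_def nat_int by simp
qed

lemma slope_elt_periodic_right:
  assumes "coxeter_triple x y z" "a > 0"
  shows "slope_elt x y z a (b + m * a) = slope_elt x y z a b"
  using slope_elt_periodic_left[OF coxeter_triple_mirror[OF assms(1)] assms(2), of b] assms(2)
  by (simp add: slope_elt_mirror)

text \<open>\<open>m\<close> shears move \<open>(m b - p, b)\<close> to \<open>(-p, b)\<close>,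
  which \<open>upper_elt\<close> reads in the second quadrant.\<close>

lemma slope_elt_turn:
  assumes "coxeter_triple x y z" "b > 0" "p \<le> m * b"
  shows "slope_elt x y z (m * b - p) b =
         slope_elt z (z \<otimes> (y \<otimes> z)) (z \<otimes> (y \<otimes> (x \<otimes> (y \<otimes> z)))) b p"
proof -
  have "nat (int m * int b - int p) = m * b - p"
    by (metis nat_int nat_minus_as_int of_nat_mult)
  then show ?thesis
    using upper_elt_periodic[OF assms(1,2), of "int (m * b) - int p"] assms
    by (cases "p = 0") (auto simp: upper_elt_def simp flip: of_nat_mult of_nat_diff)
qed

lemma slope_elt_turn_back:
  assumes "coxeter_triple x y z" "a > 0" "p \<le> m * a"
  shows "slope_elt x y z a (m * a - p) =
         slope_elt (x \<otimes> (y \<otimes> (z \<otimes> (y \<otimes> x)))) (x \<otimes> (y \<otimes> x)) x p a"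
  using slope_elt_turn[OF coxeter_triple_mirror[OF assms(1)] assms(2,3)] assms(2)
  by (simp add: slope_elt_mirror)

text \<open>The numerical root criterion, with \<open>m a b\<close> moved to the right so that it
  can be stated in \<open>nat\<close>.\<close>

definition root_pair :: "nat \<Rightarrow> nat \<Rightarrow> bool" where
  "root_pair a b \<longleftrightarrow> a > 0 \<and> b > 0 \<and> coprime a b \<and> a * a + b * b \<le> m * a * b + 1"

lemma root_pair_commute: "root_pair a b \<longleftrightarrow> root_pair b a"
  by (auto simp: root_pair_def coprime_commute ac_simps)

lemma root_pair_le: "root_pair a b \<Longrightarrow> b \<le> m * a"
proof (rule ccontr)
  assume r: "root_pair a b" and "\<not> b \<le> m * a"
  then have "(m * a + 1) * b \<le> b * b" by (intro mult_right_mono) auto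
  then have "m * a * b + b \<le> b * b" by (simp add: algebra_simps)
  moreover have "a * a > 0" "b > 0" "a * a + b * b \<le> m * a * b + 1"
    using r by (auto simp: root_pair_def)
  ultimately show False by linarith
qed

text \<open>The simple reflection \<open>(a, b) \<mapsto> (a, m a - b)\<close> preserves the
  quadratic form: with \<open>m a = b + c\<close> the inequality reads
  \<open>a a \<le> b c + 1\<close>, symmetric in \<open>b\<close> and \<open>c\<close>. The
  exceptional root \<open>(1, m)\<close> goes to the simple root (1,0).\<close>

lemma root_pair_reflect:
  assumes "root_pair a b"
  shows "b = m * a \<and> a = 1 \<or> root_pair (m * a - b) a"
proof -
  have le: "b \<le> m * a" using root_pair_le assms by blast
  define c where "c = m * a - b"
  have b: "b = m * a - c" and cle: "c \<le> m * a" and ma: "m * a = b + c" using le by (auto simp: c_def)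
  have cop: "coprime a b" and pos: "a > 0" "b > 0" and Q: "a * a + b * b \<le> m * a * b + 1"
    using assms by (auto simp: root_pair_def)
  have "b * b + b * c = m * a * b" using ma by (metis distrib_left mult.commute)
  then have Q': "a * a \<le> b * c + 1" using Q by linarith
  have "c * c + b * c = m * a * c" using ma by (metis add.commute distrib_right mult.commute)
  then have Q2: "c * c + a * a \<le> m * c * a + 1" using Q' by (simp add: ac_simps)
  have "gcd a c = 1"
  proof -
    have "gcd a c dvd b" using ma
      by (metis dvd_add_left_iff dvd_mult gcd_dvd1 gcd_dvd2)
    then show ?thesis using cop by (metis coprime_def gcd_dvd1 nat_dvd_1_iff_1)
  qed
  then have cop': "coprime c a" by (simp add: coprime_iff_gcd_eq_1 gcd.commute)
  show ?thesis
  proof (cases "c = 0")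
    case True
    then have "a = 1" using cop' by simp
    then show ?thesis using b True by simp
  next
    case False
    then show ?thesis using cop' Q2 pos by (auto simp: root_pair_def c_def)
  qed
qed

lemma root_pair_1: "root_pair 1 m" "root_pair m 1"
  using two_le_m by (auto simp: root_pair_def)

lemma slope_elt_axis:
  assumes "coxeter_triple x y z"
  shows "slope_elt x y z 1 0 = slope_elt x y z 1 m" "slope_elt x y z 0 1 = slope_elt x y z m 1"
  using slope_elt_periodic_right[OF assms, of 1 0] slope_elt_periodic_left[OF assms, of 1 0] by simp_all

text \<open>Outside the cone \<open>a \<le> m b\<close>, \<open>b \<le> m a\<close> a direction is
  shortened by \<open>m\<close> shears. Inside it, off the roots, the turn shortens it at the price
  of another triple; hence the induction over all triples. The root found for the turned triple is
  then reflected back.\<close>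

lemma slope_elt_root:
  assumes "coxeter_triple x y z" "coprime a b"
  shows "\<exists>a' b'. root_pair a' b' \<and> slope_elt x y z a b = slope_elt x y z a' b'"
  using assms
proof (induction "a + b" arbitrary: a b x y z rule: less_induct)
  case less
  note t = \<open>coxeter_triple x y z\<close>
  let ?thesis = "\<exists>a' b'. root_pair a' b' \<and> slope_elt x y z a b = slope_elt x y z a' b'"
  consider "a = 0" | "b = 0" | "root_pair a b" | "a > 0" "b > 0" "a > m * b" | "a > 0" "b > 0" "b > m * a"
    | "a > 0" "b > 0" "a \<le> m * b" "b \<le> m * a" "\<not> root_pair a b" by linarith
  then show ?thesis
  proof cases
    case 1
    then have "b = 1" using less.prems by simp
    then show ?thesis using 1 slope_elt_axis[OF t] root_pair_1 by metis
  next
    case 2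
    then have "a = 1" using less.prems by simp
    then show ?thesis using 2 slope_elt_axis[OF t] root_pair_1 by metis
  next
    case 3
    then show ?thesis by blast
  next
    case 4
    define c where "c = a - m * b"
    have a: "a = c + m * b" using 4 by (simp add: c_def)
    have "coprime c b" using less.prems(2) unfolding a
      by (metis coprime_iff_gcd_eq_1 gcd_add_mult gcd.commute mult.commute add.commute)
    then show ?thesis
      using less.hyps[of c b x y z] t 4 two_le_m slope_elt_periodic_left[OF t, of b c] a by auto
  next
    case 5
    define c where "c = b - m * a"
    have b: "b = c + m * a" using 5 by (simp add: c_def)
    have "coprime a c" using less.prems(2) unfolding b
      by (metis coprime_iff_gcd_eq_1 gcd_add_mult gcd.commute mult.commute add.commute)
    then show ?thesis
      using less.hyps[of a c x y z] t 5 two_le_m slope_elt_periodic_right[OF t, of a c] b by auto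
  next
    case 6
    have nr: "a * a + b * b > m * a * b + 1" using 6 less.prems by (auto simp: root_pair_def)
    have "a \<noteq> b"
    proof
      assume "a = b"
      then have "a = 1" using less.prems by simp
      then show False using nr \<open>a = b\<close> two_le_m by simp
    qed
    then consider "b < a" | "a < b" by linarith
    then show ?thesis
    proof cases
      case 1
      define p where "p = m * b - a"
      have ma: "m * b = a + p" using 6 by (simp add: p_def)
      \<comment> \<open>\<open>a p = m a b - a a < b b - 1\<close> because the root inequality
        fails, while \<open>a > b\<close>.\<close>
      have "p < b"
      proof (rule ccontr)
        assume "\<not> p < b"
        then have "b * b \<le> p * a" using 1 by (intro mult_mono) auto
        moreover have "m * a * b = a * a + p * a" using ma by (metis distrib_right mult.assoc mult.commute)
        ultimately show False using nr by linarith
      qed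
      have "gcd b p = 1"
      proof -
        have "gcd b p dvd a" using ma by (metis dvd_add_left_iff dvd_mult gcd_dvd1 gcd_dvd2)
        then show ?thesis using less.prems(2) by (metis coprime_def gcd_dvd1 nat_dvd_1_iff_1)
      qed
      then have cop: "coprime b p" by (simp add: coprime_iff_gcd_eq_1)
      have a: "a = m * b - p" "p \<le> m * b" using ma by auto
      obtain b' p' where r: "root_pair b' p'" and
        e: "slope_elt z (z \<otimes> (y \<otimes> z)) (z \<otimes> (y \<otimes> (x \<otimes> (y \<otimes> z)))) b p =
            slope_elt z (z \<otimes> (y \<otimes> z)) (z \<otimes> (y \<otimes> (x \<otimes> (y \<otimes> z)))) b' p'"
        using less.hyps[of b p, OF _ coxeter_triple_turn[OF t] cop] \<open>p < b\<close> 1 by auto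
      have "slope_elt x y z a b = slope_elt x y z (m * b' - p') b'"
        using slope_elt_turn[OF t, of b p] slope_elt_turn[OF t, of b' p'] e a r root_pair_le[OF r] 6
        by (simp add: root_pair_def)
      moreover have "p' = m * b' \<and> b' = 1 \<or> root_pair (m * b' - p') b'"
        using root_pair_reflect[OF r] .
      \<comment> \<open>The degenerate reflection is the axis direction (0,1), whose value is also
        that of the root \<open>(m, 1)\<close>.\<close>
      ultimately show ?thesis using slope_elt_axis(2)[OF t] root_pair_1(2)
        by (metis diff_self_eq_0)
    next
      case 2
      define p where "p = m * a - b"
      have ma: "m * a = b + p" using 6 by (simp add: p_def)
      have "p < a"
      proof (rule ccontr)
        assume "\<not> p < a"
        then have "a * a \<le> p * b" using 2 by (intro mult_mono) auto
        moreover have "m * a * b = b * b + p * b" using ma by (metis distrib_right)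
        ultimately show False using nr by linarith
      qed
      have "gcd a p = 1"
      proof -
        have "gcd a p dvd b" using ma by (metis dvd_add_left_iff dvd_mult gcd_dvd1 gcd_dvd2)
        then show ?thesis using less.prems(2) by (metis coprime_def gcd_dvd1 nat_dvd_1_iff_1)
      qed
      then have cop: "coprime p a" by (simp add: coprime_iff_gcd_eq_1 gcd.commute)
      have b: "b = m * a - p" "p \<le> m * a" using ma by auto
      obtain p' a' where r: "root_pair p' a'" and
        e: "slope_elt (x \<otimes> (y \<otimes> (z \<otimes> (y \<otimes> x)))) (x \<otimes> (y \<otimes> x)) x p a =
            slope_elt (x \<otimes> (y \<otimes> (z \<otimes> (y \<otimes> x)))) (x \<otimes> (y \<otimes> x)) x p' a'"
        using less.hyps[of p a, OF _ coxeter_triple_turn_back[OF t] cop] \<open>p < a\<close> 2 by auto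
      have r': "root_pair a' p'" using r root_pair_commute by blast
      have "slope_elt x y z a b = slope_elt x y z a' (m * a' - p')"
        using slope_elt_turn_back[OF t, of a p] slope_elt_turn_back[OF t, of a' p'] e b r root_pair_le[OF r'] 6
        by (simp add: root_pair_def)
      moreover have "p' = m * a' \<and> a' = 1 \<or> root_pair (m * a' - p') a'"
        using root_pair_reflect[OF r'] .
      ultimately show ?thesis using slope_elt_axis(1)[OF t] root_pair_1(1) root_pair_commute
        by (metis diff_self_eq_0)
    qed
  qed
qed

text \<open>\<open>R\<close> does not depend on the triple, so that a triple and its turned copies
  can be compared with one and the same set of elements.\<close>

definition good_triple :: "'a set \<Rightarrow> 'a \<Rightarrow> 'a \<Rightarrow> 'a \<Rightarrow> bool" where
  "good_triple R x y z \<longleftrightarrow> coxeter_triple x y z \<and> (\<forall>a b. root_pair a b \<longrightarrow> slope_elt x y z a b \<in> R)"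

lemma good_triple_slope_elt:
  assumes "good_triple R x y z" "a > 0 \<or> b > 0"
  shows "slope_elt x y z a b \<in> R"
proof -
  define d where "d = gcd a b"
  have d: "d > 0" using assms(2) by (auto simp: d_def)
  obtain a' b' where ab: "a = d * a'" "b = d * b'" "coprime a' b'"
    using gcd_coprime_exists[of a b] d unfolding d_def by (auto simp: mult.commute)
  then obtain a'' b'' where "root_pair a'' b''" "slope_elt x y z a' b' = slope_elt x y z a'' b''"
    using slope_elt_root assms(1) unfolding good_triple_def by blast
  then show ?thesis using ab slope_elt_mult[OF d] assms(1) by (simp add: good_triple_def)
qed

lemma good_triple_mirror: "good_triple R x y z \<Longrightarrow> good_triple R z y x"
  using coxeter_triple_mirror[of x y z] root_pair_commute
  by (auto simp: good_triple_def root_pair_def slope_elt_mirror)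

text \<open>A value of the turned triple at \<open>(b, p)\<close> is a value of the original one at
  \<open>(m b - p, b)\<close>, and \<open>good_triple_slope_elt\<close> puts all of these into
  \<open>R\<close>.\<close>

lemma good_triple_turn:
  assumes "good_triple R x y z"
  shows "good_triple R z (z \<otimes> (y \<otimes> z)) (z \<otimes> (y \<otimes> (x \<otimes> (y \<otimes> z))))"
  unfolding good_triple_def
proof (intro conjI allI impI)
  have t: "coxeter_triple x y z" using assms by (simp add: good_triple_def)
  then show "coxeter_triple z (z \<otimes> (y \<otimes> z)) (z \<otimes> (y \<otimes> (x \<otimes> (y \<otimes> z))))"
    by (rule coxeter_triple_turn)
  fix b p assume r: "root_pair b p"
  then have "slope_elt z (z \<otimes> (y \<otimes> z)) (z \<otimes> (y \<otimes> (x \<otimes> (y \<otimes> z)))) b p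
    = slope_elt x y z (m * b - p) b"
    using slope_elt_turn[OF t] root_pair_le by (simp add: root_pair_def)
  also have "\<dots> \<in> R" using r by (intro good_triple_slope_elt[OF assms]) (simp add: root_pair_def)
  finally show "slope_elt z (z \<otimes> (y \<otimes> z)) (z \<otimes> (y \<otimes> (x \<otimes> (y \<otimes> z)))) b p \<in> R" .
qed

text \<open>The triples attached to the six corners at the vertex: half of them are turned copies of a
  Coxeter triple, the others arise from these by one braid move.\<close>

definition sector_triple :: "'a set \<Rightarrow> 'a \<Rightarrow> 'a \<Rightarrow> 'a \<Rightarrow> bool" where
  "sector_triple R x y z \<longleftrightarrow> x \<in> involutions \<and> y \<in> involutions \<and> z \<in> involutions \<and>
     (good_triple R x y z \<or> good_triple R x z (z \<otimes> (y \<otimes> z)) \<or> good_triple R (x \<otimes> (y \<otimes> x)) x z)"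

lemma sector_triple_mirror: "sector_triple R x y z \<Longrightarrow> sector_triple R z y x"
  unfolding sector_triple_def using good_triple_mirror by blast

text \<open>The step to the next corner permutes the three alternatives cyclically: the first
  becomes the third and the second the first, both by turning a good triple between two mirrorings;
  the third becomes the second by mere cancellation.\<close>

lemma sector_triple_turn:
  assumes "sector_triple R x y z"
  shows "sector_triple R (x \<otimes> (y \<otimes> x)) (x \<otimes> (z \<otimes> x)) x"
proof -
  have inv: "x \<in> involutions" "y \<in> involutions" "z \<in> involutions"
    using assms by (auto simp: sector_triple_def)
  consider "good_triple R x y z" | "good_triple R x z (z \<otimes> (y \<otimes> z))"
    | "good_triple R (x \<otimes> (y \<otimes> x)) x z"
    using assms by (auto simp: sector_triple_def)
  then show ?thesis
  proof cases
    case 1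
    from good_triple_mirror[OF good_triple_turn[OF good_triple_mirror[OF this]]]
    show ?thesis using inv by (simp add: sector_triple_def m_assoc)
  next
    case 2
    from good_triple_mirror[OF good_triple_turn[OF good_triple_mirror[OF this]]]
    show ?thesis using inv by (simp add: sector_triple_def m_assoc)
  next
    case 3
    then show ?thesis using inv by (simp add: sector_triple_def m_assoc)
  qed
qed

text \<open>In the last two cases the triple is one Euclidean step away from a good one, where the
  direction reads \<open>(a + b, b)\<close> or \<open>(a, a + b)\<close>.\<close>

lemma sector_triple_slope_elt:
  assumes "sector_triple R x y z" "a > 0 \<or> b > 0"
  shows "slope_elt x y z a b \<in> R"
proof -
  have inv: "x \<in> involutions" "y \<in> involutions" "z \<in> involutions"
    using assms by (auto simp: sector_triple_def)
  consider "good_triple R x y z" | "good_triple R x z (z \<otimes> (y \<otimes> z))"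
    | "good_triple R (x \<otimes> (y \<otimes> x)) x z"
    using assms by (auto simp: sector_triple_def)
  then show ?thesis
  proof cases
    case 1
    then show ?thesis using assms(2) by (rule good_triple_slope_elt)
  next
    case 2
    have "slope_elt x y z a b = slope_elt x z (z \<otimes> (y \<otimes> z)) (a + b) b"
      using assms(2) inv by (cases "b = 0") (simp_all add: slope_elt_add_left m_assoc)
    then show ?thesis using good_triple_slope_elt[OF 2, of "a + b" b] assms(2) by simp
  next
    case 3
    have "slope_elt x y z a b = slope_elt (x \<otimes> (y \<otimes> x)) x z a (a + b)"
      using assms(2) inv by (cases "a = 0") (simp_all add: slope_elt_add_right m_assoc)
    then show ?thesis using good_triple_slope_elt[OF 3, of a "a + b"] assms(2) by simp
  qed
qed

end

section \<open>Words read along straight lines\<close>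

fun letter :: "'a \<Rightarrow> 'a \<Rightarrow> 'a \<Rightarrow> index \<Rightarrow> 'a" where
  "letter x y z I1 = x" | "letter x y z I2 = y" | "letter x y z I3 = z"

fun swap13 :: "index \<Rightarrow> index" where
  "swap13 I1 = I3" | "swap13 I2 = I2" | "swap13 I3 = I1"

lemma letter_swap13 [simp]: "letter x y z (swap13 i) = letter z y x i"
  by (cases i) auto

text \<open>The line of slope \<open>b / a\<close> crosses \<open>T\<^sub>2\<close> at the multiples of \<open>b / (a + b)\<close> modulo 1;
  \<open>run a b r w\<close> says that \<open>w\<close> is read off after the crossing at \<open>r / (a + b)\<close>.\<close>

inductive run :: "nat \<Rightarrow> nat \<Rightarrow> nat \<Rightarrow> index list \<Rightarrow> bool" for a b where
  stop: "run a b a []"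
| low: "r < a \<Longrightarrow> run a b (r + b) w \<Longrightarrow> run a b r (I3 # I2 # w)"
| high: "r > a \<Longrightarrow> run a b (r - a) w \<Longrightarrow> run a b r (I1 # I2 # w)"

lemma run_unique: "run a b r w \<Longrightarrow> run a b r w' \<Longrightarrow> w = w'"
proof (induction arbitrary: w' rule: run.induct)
  case stop
  then show ?case by (cases rule: run.cases) auto
next
  case (low r w)
  from low.prems show ?case
    using low.hyps(1) by (cases rule: run.cases) (auto intro: low.IH)
next
  case (high r w)
  from high.prems show ?case
    using high.hyps(1) by (cases rule: run.cases) (auto intro: high.IH)
qed

lemma run_mirror:
  "run a b r w \<Longrightarrow> 0 < r \<Longrightarrow> r < a + b \<Longrightarrow> run b a (a + b - r) (map swap13 w)"
proof (induction rule: run.induct)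
  case stop
  then show ?case using run.stop[of b a] by simp
next
  case (low r w)
  then show ?case using run.high[of b "a + b - r" a "map swap13 w"]
    by (simp add: diff_diff_left)
next
  case (high r w)
  have "a + b - r + a = a + b - (r - a)" using high by simp
  then show ?case using high run.low[of "a + b - r" b a "map swap13 w"] by simp
qed

context group begin

definition word_prod :: "'a \<Rightarrow> 'a \<Rightarrow> 'a \<Rightarrow> index list \<Rightarrow> 'a" where
  "word_prod x y z w = foldr (\<lambda>i. (\<otimes>) (letter x y z i)) w \<one>"

lemma word_prod_simps [simp]:
  "word_prod x y z [] = \<one>" "word_prod x y z (i # w) = letter x y z i \<otimes> word_prod x y z w"
  by (simp_all add: word_prod_def)

lemma letter_involutions [simp]:
  "x \<in> involutions \<Longrightarrow> y \<in> involutions \<Longrightarrow> z \<in> involutions \<Longrightarrow> letter x y z i \<in> involutions"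
  by (cases i) auto

lemma word_prod_closed [simp]:
  "x \<in> involutions \<Longrightarrow> y \<in> involutions \<Longrightarrow> z \<in> involutions \<Longrightarrow> word_prod x y z w \<in> carrier G"
  by (induction w) auto

lemma word_prod_append:
  "x \<in> involutions \<Longrightarrow> y \<in> involutions \<Longrightarrow> z \<in> involutions \<Longrightarrow>
   word_prod x y z (u @ v) = word_prod x y z u \<otimes> word_prod x y z v"
  by (induction u) (simp_all add: m_assoc)

lemma word_prod_swap13: "word_prod x y z (map swap13 w) = word_prod z y x w"
  by (induction w) auto

text \<open>In the sheared triple the block \<open>I3\<close>, \<open>I2\<close> multiplies to
  \<open>y (y z y) = z y\<close>, unchanged, and \<open>I1\<close>, \<open>I2\<close> to
  \<open>x y z y\<close>, which inserts a low step. Correspondingly, with \<open>a + b\<close> in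
  place of \<open>a\<close>, a high step from \<open>r + b\<close> lands at \<open>r - a\<close>,
  below \<open>a + b\<close>.\<close>

lemma run_shear:
  assumes "x \<in> involutions" "y \<in> involutions" "z \<in> involutions"
  shows "run a b r w \<Longrightarrow> r < a + b \<Longrightarrow>
    \<exists>w'. run (a + b) b (r + b) w' \<and> word_prod x y z w' = word_prod x (y \<otimes> (z \<otimes> y)) y w"
proof (induction rule: run.induct)
  case stop
  show ?case using run.stop by fastforce
next
  case (low r w)
  then obtain w' where w': "run (a + b) b (r + b + b) w'"
    "word_prod x y z w' = word_prod x (y \<otimes> (z \<otimes> y)) y w" by auto
  have "run (a + b) b (r + b) (I3 # I2 # w')" using w' low.hyps by (intro run.low) auto
  moreover have "word_prod x y z (I3 # I2 # w') = word_prod x (y \<otimes> (z \<otimes> y)) y (I3 # I2 # w)"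
    using assms w'(2)[symmetric] by (simp add: m_assoc)
  ultimately show ?case by blast
next
  case (high r w)
  then have "r - a < a + b" by simp
  from high.IH[OF this] obtain w' where w': "run (a + b) b (r - a + b) w'"
    "word_prod x y z w' = word_prod x (y \<otimes> (z \<otimes> y)) y w" by blast
  have "run (a + b) b (r - a) (I3 # I2 # w')" using w' high by (intro run.low) auto
  then have "run (a + b) b (r + b) (I1 # I2 # I3 # I2 # w')" using high by (intro run.high) auto
  moreover have "word_prod x y z (I1 # I2 # I3 # I2 # w') =
      word_prod x (y \<otimes> (z \<otimes> y)) y (I1 # I2 # w)"
    using assms w'(2)[symmetric] by (simp add: m_assoc)
  ultimately show ?case by blast
qed

text \<open>The letter \<open>I2\<close> in front is the crossing at \<open>b / (a + b)\<close>,
  from which the run starts. The case \<open>b < a\<close> is \<open>run_shear\<close>, and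
  \<open>a < b\<close> is its mirror image.\<close>

lemma run_slope_elt_exists:
  assumes "x \<in> involutions" "y \<in> involutions" "z \<in> involutions" "a > 0" "b > 0"
  shows "\<exists>w. run a b b w \<and> word_prod x y z (I2 # w) = slope_elt x y z a b"
  using assms
proof (induction "a + b" arbitrary: a b x y z rule: less_induct)
  case less
  have step: "\<exists>w. run (c + d) d d w \<and> word_prod x y z (I2 # w) = slope_elt x y z (c + d) d"
    if cd: "x \<in> involutions" "y \<in> involutions" "z \<in> involutions" "c > 0" "d > 0" "c + d + d = a + b"
    for c d x y z
  proof -
    have yzy: "y \<otimes> (z \<otimes> y) \<in> involutions" using cd by simp
    obtain w where w: "run c d d w"
      "word_prod x (y \<otimes> (z \<otimes> y)) y (I2 # w) = slope_elt x (y \<otimes> (z \<otimes> y)) y c d"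
      using less.hyps[OF _ cd(1) yzy cd(2,4,5)] cd(5,6) by force
    obtain w' where w': "run (c + d) d (d + d) w'"
      "word_prod x y z w' = word_prod x (y \<otimes> (z \<otimes> y)) y w"
      using run_shear[of x y z c d d w] w(1) cd by auto
    have "run (c + d) d d (I3 # I2 # w')" using w' cd by (intro run.low) auto
    moreover have "word_prod x y z (I2 # I3 # I2 # w') = slope_elt x y z (c + d) d"
      using w w'(2) cd by (simp add: slope_elt_add_left m_assoc)
    ultimately show ?thesis by blast
  qed
  consider "a = b" | "b < a" | "a < b" by linarith
  then show ?case
  proof cases
    case 1
    then show ?thesis using less.prems run.stop[of b b] slope_elt_add_left[of b x y z 0]
      by (intro exI[of _ "[]"]) auto
  next
    case 2
    then show ?thesis using step[of x y z "a - b" b] less.prems by simp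
  next
    case 3
    then obtain w where "run b a a w" "word_prod z y x (I2 # w) = slope_elt z y x b a"
      using step[of z y x "b - a" a] less.prems by auto
    moreover from this(1) have "run a b b (map swap13 w)"
      using run_mirror[of b a a w] less.prems by simp
    ultimately show ?thesis
      using less.prems slope_elt_mirror[of a b z y x] word_prod_swap13[of x y z w]
      by (intro exI[of _ "map swap13 w"]) simp
  qed
qed

lemma run_slope_elt:
  assumes "x \<in> involutions" "y \<in> involutions" "z \<in> involutions" "a > 0" "b > 0" "run a b b w"
  shows "word_prod x y z (I2 # w) = slope_elt x y z a b"
  using run_slope_elt_exists[OF assms(1-5)] run_unique[OF assms(6)] by blast

end

section \<open>The presented group and its Coxeter triple\<close>

lemma pres_eq_append: "pres_eq R u v \<Longrightarrow> pres_eq R (a @ u @ b) (a @ v @ b)"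
proof (induction rule: pres_eq.induct)
  case (cancel u g c v)
  show ?case using pres_eq.cancel[of R "a @ u" g c "v @ b"] by simp
next
  case (relator r u v)
  then show ?case using pres_eq.relator[of r R "a @ u" "v @ b"] by simp
qed (auto intro: pres_eq.intros)

lemma pres_class_eq_iff: "pres_class R u = pres_class R v \<longleftrightarrow> pres_eq R u v"
  unfolding pres_class_def by (blast intro: pres_eq.intros)

lemma mult_pres_class:
  "pres_class R u \<otimes>\<^bsub>presented_group R\<^esub> pres_class R v = pres_class R (u @ v)"
proof -
  have "pres_class R (x @ y) = pres_class R (u @ v)" if "pres_eq R u x" "pres_eq R v y" for x y
    using that pres_eq_append[of R u x "[]" v] pres_eq_append[of R v y x "[]"]
    by (metis append_Nil append_Nil2 pres_class_eq_iff pres_eq.sym)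
  then have eq: "\<forall>x\<in>pres_class R u. \<forall>y\<in>pres_class R v. pres_class R (x @ y) = pres_class R (u @ v)"
    by (simp add: pres_class_def)
  have "u \<in> pres_class R u" "v \<in> pres_class R v"
    by (auto simp: pres_class_def intro: pres_eq.refl)
  with eq have "(\<Union>x\<in>pres_class R u. \<Union>y\<in>pres_class R v. pres_class R (x @ y)) = pres_class R (u @ v)"
    by blast
  then show ?thesis by (simp add: presented_group_def)
qed

lemma one_presented_group: "\<one>\<^bsub>presented_group R\<^esub> = pres_class R []"
  by (simp add: presented_group_def)

lemma carrier_presented_group: "carrier (presented_group R) = range (pres_class R)"
  by (simp add: presented_group_def)

lemma pres_eq_inverse: "pres_eq R (rev (map (\<lambda>(g, b). (g, \<not> b)) u) @ u) []"
proof (induction u)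
  case (Cons gb u)
  obtain g b where gb: "gb = (g, b)" by fastforce
  have "pres_eq R (rev (map (\<lambda>(g, b). (g, \<not> b)) u) @ [(g, \<not> b), (g, \<not> \<not> b)] @ u)
      (rev (map (\<lambda>(g, b). (g, \<not> b)) u) @ u)"
    by (rule pres_eq.cancel)
  then show ?case using Cons gb by (auto intro: pres_eq.trans)
qed (simp add: pres_eq.refl)

lemma group_presented_group: "group (presented_group R)"
proof (rule groupI)
  fix x assume "x \<in> carrier (presented_group R)"
  then obtain u where "x = pres_class R u" by (auto simp: carrier_presented_group)
  then show "\<exists>y\<in>carrier (presented_group R). y \<otimes>\<^bsub>presented_group R\<^esub> x = \<one>\<^bsub>presented_group R\<^esub>"
    using pres_eq_inverse[of R u]
    by (auto simp: carrier_presented_group mult_pres_class one_presented_group pres_class_eq_iff)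
qed (auto simp: carrier_presented_group mult_pres_class one_presented_group)

lemma group_W: "group (W m)"
  unfolding W_def by (rule group_presented_group)

lemma pow_pres_class:
  "pres_class R u [^]\<^bsub>presented_group R\<^esub> n = pres_class R (concat (replicate n u))" for n :: nat
proof (induction n)
  case 0
  then show ?case by (simp add: one_presented_group)
next
  case (Suc n)
  have "concat (replicate n u) @ u = u @ concat (replicate n u)"
    by (induction n) auto
  then show ?case using Suc by (simp add: mult_pres_class)
qed

lemma relator_class: "r \<in> R \<Longrightarrow> pres_class R r = \<one>\<^bsub>presented_group R\<^esub>"
  using pres_eq.relator[of r R "[]" "[]"] by (simp add: one_presented_group pres_class_eq_iff)

lemma coxeter_triples_W: "2 \<le> m \<Longrightarrow> coxeter_triples (W m) m"
  by (simp add: coxeter_triples_def coxeter_triples_axioms_def group_W)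

lemma coxeter_triple_W:
  assumes "2 \<le> m"
  shows "coxeter_triples.coxeter_triple (W m) m (refl_gen m I1) (refl_gen m I2) (refl_gen m I3)"
proof -
  interpret coxeter_triples "W m" m using assms by (rule coxeter_triples_W)
  let ?R = "relators m"
  have map_concat_replicate: "map f (concat (replicate m u)) = concat (replicate m (map f u))"
    for f :: "index \<Rightarrow> index \<times> bool" and u
    by (induction m) auto
  have "map (\<lambda>i. (i, True)) [i, i] \<in> ?R" for i
    unfolding relators_def by (intro imageI) (cases i; simp)
  then have "pres_class ?R [(i, True), (i, True)] = \<one>\<^bsub>presented_group ?R\<^esub>" for i
    by (intro relator_class) simp
  then have inv: "refl_gen m i \<in> involutions" for i
    unfolding involutions_def unfolding refl_gen_def W_def
    by (simp add: mult_pres_class carrier_presented_group)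
  have "map (\<lambda>i. (i, True)) (concat (replicate m [I1, I2])) \<in> ?R"
    "map (\<lambda>i. (i, True)) (concat (replicate m [I2, I3])) \<in> ?R"
    unfolding relators_def by (intro imageI; simp)+
  then have "concat (replicate m [(I1, True), (I2, True)]) \<in> ?R"
    "concat (replicate m [(I2, True), (I3, True)]) \<in> ?R"
    unfolding map_concat_replicate by simp_all
  then have "(refl_gen m I1 \<otimes>\<^bsub>W m\<^esub> refl_gen m I2) [^]\<^bsub>W m\<^esub> m = \<one>\<^bsub>W m\<^esub>"
    "(refl_gen m I2 \<otimes>\<^bsub>W m\<^esub> refl_gen m I3) [^]\<^bsub>W m\<^esub> m = \<one>\<^bsub>W m\<^esub>"
    by (simp_all add: refl_gen_def W_def mult_pres_class pow_pres_class relator_class)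
  with inv show ?thesis by (simp add: coxeter_triple_def)
qed

lemma word_elt_eq_word_prod:
  "word_elt m w = group.word_prod (W m) (refl_gen m I1) (refl_gen m I2) (refl_gen m I3) w"
proof -
  have "letter (refl_gen m I1) (refl_gen m I2) (refl_gen m I3) i = refl_gen m i" for i
    by (cases i) auto
  then show ?thesis by (simp add: word_elt_def group.word_prod_def[OF group_W])
qed

section \<open>Roots of the rank 2 algebra\<close>

context lie_algebra begin

lemma bracket_0_left [simp]: "bracket L 0 x = 0"
  using bracket_add_left[of 0 0 x] by simp

lemma bracket_0_right [simp]: "bracket L x 0 = 0"
  using bracket_add_right[of x 0 0] by simp

lemma bracket_minus_left: "bracket L (- x) y = - bracket L x y"
  using bracket_add_left[of x "- x" y] by (simp add: eq_neg_iff_add_eq_0 add.commute)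

lemma bracket_minus_right: "bracket L x (- y) = - bracket L x y"
  using bracket_add_right[of x y "- y"] by (simp add: eq_neg_iff_add_eq_0 add.commute)

lemma bracket_commute: "bracket L x y = - bracket L y x"
proof -
  have "bracket L (x + y) (x + y) = 0" by (rule bracket_self)
  then have "bracket L x y + bracket L y x = 0"
    unfolding bracket_add_left bracket_add_right by (simp add: bracket_self add.commute)
  then show ?thesis by (simp add: eq_neg_iff_add_eq_0)
qed

lemma bracket_bracket:
  "bracket L x (bracket L y z) = bracket L (bracket L x y) z + bracket L y (bracket L x z)"
proof -
  have "bracket L x (bracket L y z) = - bracket L y (bracket L z x) - bracket L z (bracket L x y)"
    using jacobi[of x y z] by (simp add: eq_neg_iff_add_eq_0 algebra_simps)
  also have "bracket L z x = - bracket L x z" by (rule bracket_commute)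
  also have "bracket L z (bracket L x y) = - bracket L (bracket L x y) z" by (rule bracket_commute)
  finally show ?thesis by (simp add: bracket_minus_right)
qed

end

locale kac_moody_rank2 = kac_moody_algebra "cartan_matrix m" L
  for m :: nat and L :: "(2, 'g::ab_group_add, 'z) kac_moody_data_scheme"
begin

text \<open>Right-normed brackets of the generators \<open>chev_e\<close>; a relation, since one
  degree has many monomials and the vector 0 occurs in several degrees. Their span lies in a root
  space by \<open>e_space_weight\<close>, so a nonzero element of it certifies a root.\<close>

inductive e_monomial :: "(2 \<Rightarrow> nat) \<Rightarrow> 'g \<Rightarrow> bool" where
  gen: "e_monomial ((\<lambda>_. 0)(i := 1)) (chev_e L i)"
| step: "e_monomial d x \<Longrightarrow> e_monomial (d(j := Suc (d j))) (bracket L (chev_e L j) x)"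

definition e_space :: "(2 \<Rightarrow> nat) \<Rightarrow> 'g set" where
  "e_space d = span {x. e_monomial d x}"

lemma e_monomial_e_space: "e_monomial d x \<Longrightarrow> x \<in> e_space d"
  unfolding e_space_def by (intro span_base) simp

lemma e_space_closed:
  "0 \<in> e_space d" "x \<in> e_space d \<Longrightarrow> y \<in> e_space d \<Longrightarrow> x + y \<in> e_space d"
  "x \<in> e_space d \<Longrightarrow> lscale L c x \<in> e_space d" "x \<in> e_space d \<Longrightarrow> - x \<in> e_space d"
  by (simp_all add: e_space_def span_zero span_add span_scale span_neg)

lemma e_monomial_weight:
  assumes "h \<in> cartan L" "e_monomial d x"
  shows "bracket L h x = lscale L (\<Sum>i\<in>UNIV. of_nat (d i) * simple_root L i h) x"
  using assms(2)
proof induction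
  case (gen i)
  have "(\<Sum>k\<in>UNIV. of_nat (((\<lambda>_. 0)(i := 1)) k) * simple_root L k h) = simple_root L i h"
    using exhaust_2[of i] by (auto simp: UNIV_2)
  then show ?case using e_weight[OF assms(1), of i] by simp
next
  case (step d x j)
  have *: "(\<Sum>k\<in>UNIV. of_nat ((d(j := Suc (d j))) k) * simple_root L k h) =
      simple_root L j h + (\<Sum>k\<in>UNIV. of_nat (d k) * simple_root L k h)"
    using exhaust_2[of j] by (auto simp: UNIV_2 algebra_simps)
  show ?case
    unfolding bracket_bracket[of h] * step.IH e_weight[OF assms(1)]
    by (simp add: bracket_scale_left bracket_scale_right scale_left_distrib)
qed

lemma e_space_weight:
  assumes "h \<in> cartan L" "x \<in> e_space d"
  shows "bracket L h x = lscale L (\<Sum>i\<in>UNIV. of_nat (d i) * simple_root L i h) x"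
  using assms(2) unfolding e_space_def
proof (induction rule: span_induct_alt)
  case (step c x y)
  then show ?case
    using e_monomial_weight[OF assms(1), of d x]
    by (simp add: bracket_add_right bracket_scale_right scale_right_distrib scale_left_commute)
qed simp

lemma e_space_bracket_e:
  assumes "x \<in> e_space d"
  shows "bracket L (chev_e L j) x \<in> e_space (d(j := Suc (d j)))"
  using assms unfolding e_space_def[of d]
proof (induction rule: span_induct_alt)
  case (step c x y)
  then have "bracket L (chev_e L j) x \<in> e_space (d(j := Suc (d j)))"
    by (intro e_monomial_e_space e_monomial.step) simp
  then show ?case
    using step.IH unfolding bracket_add_right bracket_scale_right by (intro e_space_closed)
qed (simp add: e_space_closed)

lemma bracket_f_e:
  "bracket L (chev_f L i) (bracket L (chev_e L j) x) =
     bracket L (chev_e L j) (bracket L (chev_f L i) x) - (if i = j then bracket L (coroot L i) x else 0)"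
proof -
  have "bracket L (chev_f L i) (chev_e L j) = (if i = j then - coroot L i else 0)"
    using bracket_commute[of "chev_f L i" "chev_e L j"] e_f[of j i] by auto
  then show ?thesis
    using bracket_bracket[of "chev_f L i" "chev_e L j" x] by (simp add: bracket_minus_left)
qed

lemma e_monomial_one_sided:
  assumes "e_monomial d x" "i \<noteq> j" "d j = 0"
  shows "x = chev_e L i \<and> d = (\<lambda>_. 0)(i := 1) \<or> x = 0"
  using assms
proof induction
  case (gen k)
  then have "k = i" using exhaust_2[of i] exhaust_2[of j] exhaust_2[of k] by (auto split: if_splits)
  then show ?case by simp
next
  case (step d x k)
  then have k: "k = i" using exhaust_2[of i] exhaust_2[of j] exhaust_2[of k] by (auto split: if_splits)
  then have "d j = 0" using step.prems by auto
  then show ?case using step k by (auto simp: bracket_self)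
qed

text \<open>By the Jacobi identity \<open>chev_f L i\<close> passes through
  \<open>chev_e L j\<close> freely and through \<open>chev_e L i\<close> up to a coroot, which acts
  by a scalar. The degree in \<open>j\<close> keeps the result out of the Cartan subalgebra: where
  \<open>chev_f L i\<close> meets a lone \<open>chev_e L i\<close>, the resulting coroot is
  bracketed with \<open>chev_e L j\<close> and gives a multiple of
  \<open>chev_e L j\<close>.\<close>

lemma e_monomial_bracket_f:
  assumes "e_monomial d x" "i \<noteq> j" "d j > 0"
  shows "bracket L (chev_f L i) x \<in> (if d i = 0 then {0} else e_space (d(i := d i - 1)))"
  using assms
proof induction
  case (gen k)
  then have "k = j" by (auto split: if_splits)
  then show ?case using gen e_f[of j i] bracket_commute[of "chev_f L i" "chev_e L j"] by auto
next
  case (step d x k)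
  consider "k = i" | "k = j" "d j > 0" | "k = j" "d j = 0"
    using exhaust_2[of i] exhaust_2[of j] exhaust_2[of k] step.prems by auto
  then show ?case
  proof cases
    case 1
    have dj: "d j > 0" using step.prems 1 by auto
    have "bracket L (coroot L i) x \<in> e_space d"
      using e_space_weight[OF coroot_cartan e_monomial_e_space[OF step.hyps]]
      by (simp add: e_space_closed e_monomial_e_space[OF step.hyps])
    moreover have "bracket L (chev_e L i) (bracket L (chev_f L i) x) \<in> e_space d"
    proof (cases "d i = 0")
      case True
      then show ?thesis using step.IH[OF step.prems(1) dj] by (simp add: e_space_closed)
    next
      case False
      then show ?thesis
        using e_space_bracket_e[of "bracket L (chev_f L i) x" "d(i := d i - 1)" i]
          step.IH[OF step.prems(1) dj] by simp
    qed
    ultimately show ?thesis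
      using 1 bracket_f_e[of i i x] e_space_closed(2)[OF _ e_space_closed(4)] by simp
  next
    case 2
    then show ?thesis
      using step bracket_f_e[of i j x] e_space_bracket_e[of "bracket L (chev_f L i) x" "d(i := d i - 1)" j]
      by (auto simp: fun_upd_twist split: if_splits)
  next
    case 3
    show ?thesis
    proof (cases "x = 0")
      case True
      then show ?thesis by (simp add: e_space_closed)
    next
      case False
      then have x: "x = chev_e L i" "d = (\<lambda>_. 0)(i := 1)"
        using e_monomial_one_sided[OF step.hyps step.prems(1) 3(2)] by auto
      have "bracket L (chev_f L i) x = - coroot L i"
        using x e_f[of i i] bracket_commute[of "chev_f L i" "chev_e L i"] by simp
      then have "bracket L (chev_e L j) (bracket L (chev_f L i) x) =
          lscale L (simple_root L j (coroot L i)) (chev_e L j)"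
        using e_weight[OF coroot_cartan[of i], of j] bracket_commute[of "chev_e L j" "coroot L i"]
        by (simp add: bracket_minus_right)
      moreover have "chev_e L j \<in> e_space ((\<lambda>_. 0)(j := 1))"
        by (intro e_monomial_e_space gen)
      moreover have "(d(k := Suc (d k)))(i := (d(k := Suc (d k))) i - 1) = (\<lambda>_. 0)(j := 1)"
        using 3 x step.prems by auto
      ultimately show ?thesis
        using 3 x step.prems bracket_f_e[of i j x] by (simp add: e_space_closed)
    qed
  qed
qed

lemma e_space_bracket_f:
  assumes "x \<in> e_space d" "i \<noteq> j" "d j > 0"
  shows "bracket L (chev_f L i) x \<in> (if d i = 0 then {0} else e_space (d(i := d i - 1)))"
  using assms(1) unfolding e_space_def[of d]
proof (induction rule: span_induct_alt)
  case (step c x y)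
  then have "bracket L (chev_f L i) x \<in> (if d i = 0 then {0} else e_space (d(i := d i - 1)))"
    using e_monomial_bracket_f[of d x i j] assms(2,3) by blast
  with step.IH show ?case unfolding bracket_add_right bracket_scale_right
    by (cases "d i = 0") (auto intro!: e_space_closed simp del: fun_upd_apply)
qed (simp add: e_space_closed)

text \<open>Applying \<open>chev_f L i\<close> lowers \<open>d i\<close>, and in degree 0 it kills
  everything, so the last nonzero iterate is a lowest vector.\<close>

lemma e_space_lowest:
  assumes "x \<in> e_space d" "x \<noteq> 0" "i \<noteq> j" "d j > 0"
  shows "\<exists>a y. a \<le> d i \<and> y \<in> e_space (d(i := a)) \<and> y \<noteq> 0 \<and> bracket L (chev_f L i) y = 0"
  using assms
proof (induction "d i" arbitrary: d x)
  case 0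
  then have "d(i := 0) = d" by (simp add: fun_upd_idem)
  then show ?case using 0 e_space_bracket_f[of x d i j] by (intro exI[of _ 0] exI[of _ x]) auto
next
  case (Suc n)
  show ?case
  proof (cases "bracket L (chev_f L i) x = 0")
    case True
    then show ?thesis using Suc.prems by (intro exI[of _ "d i"] exI[of _ x]) auto
  next
    case False
    have "n = (d(i := d i - 1)) i" using Suc.hyps(2) by simp
    moreover have "bracket L (chev_f L i) x \<in> e_space (d(i := d i - 1))"
      using e_space_bracket_f[OF Suc.prems(1,3,4)] Suc.hyps(2) by auto
    moreover have "(d(i := d i - 1)) j > 0" using Suc.prems by simp
    ultimately obtain a y where "a \<le> n" "y \<in> e_space ((d(i := d i - 1))(i := a))" "y \<noteq> 0"
      "bracket L (chev_f L i) y = 0"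
      using Suc.hyps(1) False Suc.prems(3) by metis
    then have "a \<le> n" "y \<in> e_space (d(i := a))" "y \<noteq> 0" "bracket L (chev_f L i) y = 0"
      unfolding fun_upd_upd by blast+
    then show ?thesis using Suc.hyps(2) by (metis le_SucI)
  qed
qed

lemma weight_coroot:
  assumes "i \<noteq> j"
  shows "(\<Sum>k\<in>UNIV. of_nat (d k) * simple_root L k (coroot L i)) = 2 * of_nat (d i) - of_nat (m * d j)"
  using assms exhaust_2[of i] exhaust_2[of j]
  by (auto simp: UNIV_2 realization cartan_matrix_def vector_2 algebra_simps)

text \<open>The string of a copy of \<open>sl2\<close> through a lowest vector \<open>y\<close> of
  coroot weight \<open>- \<mu>\<close>: \<open>chev_f L i\<close> takes \<open>E (t + 1)\<close> to
  \<open>(t + 1) (\<mu> - t) E t\<close>, so \<open>E t\<close> stays nonzero up to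
  \<open>t = \<mu>\<close>. The bound on \<open>a + d i\<close>, together with
  \<open>a0 \<le> d i\<close>, puts \<open>a - a0\<close> in that range.\<close>

lemma e_space_string:
  assumes "x \<in> e_space d" "x \<noteq> 0" "i \<noteq> j" "d j > 0" "d i \<le> a" "a + d i \<le> m * d j"
  shows "\<exists>y \<in> e_space (d(i := a)). y \<noteq> 0"
proof -
  obtain a0 y where y: "a0 \<le> d i" "y \<in> e_space (d(i := a0))" "y \<noteq> 0" "bracket L (chev_f L i) y = 0"
    using e_space_lowest[OF assms(1-4)] by blast
  define E where "E t = (bracket L (chev_e L i) ^^ t) y" for t
  define \<mu> where "\<mu> = m * d j - 2 * a0"
  have \<mu>: "m * d j = \<mu> + 2 * a0" using assms y by (simp add: \<mu>_def)
  have E_mem: "E t \<in> e_space (d(i := a0 + t))" for t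
  proof (induction t)
    case 0
    show ?case using y(2) unfolding E_def funpow_0 add_0_right .
  next
    case (Suc t)
    have "(d(i := a0 + t))(i := Suc ((d(i := a0 + t)) i)) = d(i := a0 + Suc t)" by simp
    then show ?case using e_space_bracket_e[OF Suc, of i] unfolding E_def funpow.simps comp_def by metis
  qed
  have coroot_E: "bracket L (coroot L i) (E t) = lscale L (2 * of_nat t - of_nat \<mu>) (E t)" for t
  proof -
    have "of_nat (m * d j) = (of_nat \<mu> + 2 * of_nat a0 :: complex)" unfolding \<mu> by simp
    then have eq: "2 * of_nat ((d(i := a0 + t)) i) - of_nat (m * (d(i := a0 + t)) j) = (2 * of_nat t - of_nat \<mu> :: complex)"
      using assms(3) by simp
    show ?thesis
      using e_space_weight[OF coroot_cartan[of i] E_mem[of t]] unfolding weight_coroot[OF assms(3)] eq .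
  qed
  have f_E: "bracket L (chev_f L i) (E (Suc t)) = lscale L (of_nat (Suc t) * (of_nat \<mu> - of_nat t)) (E t)" for t
  proof (induction t)
    case 0
    then show ?case using y bracket_f_e[of i i "E 0"] coroot_E[of 0] by (simp add: E_def)
  next
    case (Suc t)
    have "bracket L (chev_f L i) (E (Suc (Suc t))) =
      bracket L (chev_e L i) (bracket L (chev_f L i) (E (Suc t))) - bracket L (coroot L i) (E (Suc t))"
      using bracket_f_e[of i i "E (Suc t)"] by (simp add: E_def)
    also have "\<dots> = lscale L (of_nat (Suc t) * (of_nat \<mu> - of_nat t)) (E (Suc t))
        - lscale L (2 * of_nat (Suc t) - of_nat \<mu>) (E (Suc t))"
      unfolding Suc coroot_E by (simp add: E_def bracket_scale_right)
    also have "\<dots> = lscale L (of_nat (Suc (Suc t)) * (of_nat \<mu> - of_nat (Suc t))) (E (Suc t))"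
      unfolding scale_left_diff_distrib[symmetric] by (simp add: algebra_simps)
    finally show ?case .
  qed
  have "t \<le> \<mu> \<Longrightarrow> E t \<noteq> 0" for t
  proof (induction t)
    case 0
    then show ?case using y by (simp add: E_def)
  next
    case (Suc t)
    have "of_nat (Suc t) * (of_nat \<mu> - of_nat t) \<noteq> (0::complex)"
      using Suc.prems by (simp del: of_nat_Suc)
    then show ?case using f_E[of t] Suc by auto
  qed
  then have "E (a - a0) \<noteq> 0" using assms y \<mu> by simp
  then show ?thesis using E_mem[of "a - a0"] assms y by auto
qed

definition root_exists :: "nat \<Rightarrow> nat \<Rightarrow> bool" where
  "root_exists a b \<longleftrightarrow> (\<exists>x \<in> e_space (\<lambda>k. if k = 1 then a else b). x \<noteq> 0)"

lemma root_exists_row: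
  assumes "root_exists c b" "b > 0" "c \<le> a" "a + c \<le> m * b"
  shows "root_exists a b"
proof -
  let ?d = "\<lambda>k::2. if k = 1 then c else b"
  have "?d(1 := a) = (\<lambda>k. if k = 1 then a else b)" by auto
  then show ?thesis using assms e_space_string[of _ ?d 1 2 a] by (auto simp: root_exists_def)
qed

lemma root_exists_column:
  assumes "root_exists a c" "a > 0" "c \<le> b" "b + c \<le> m * a"
  shows "root_exists a b"
proof -
  let ?d = "\<lambda>k::2. if k = 1 then a else c"
  have "?d(2 := b) = (\<lambda>k. if k = 1 then a else b)"
  proof
    fix k :: 2
    show "(?d(2 := b)) k = (if k = 1 then a else b)" using exhaust_2[of k] by auto
  qed
  then show ?thesis using assms e_space_string[of _ ?d 2 1 b] by (auto simp: root_exists_def)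
qed

lemma chev_e_nonzero: "chev_e L i \<noteq> 0"
proof
  assume "chev_e L i = 0"
  then have "coroot L i = 0" using e_f[of i i] by simp
  then have "0 \<in> range (coroot L)" by (metis rangeI)
  then show False using coroot_independent(2) dependent_zero by blast
qed

lemma root_exists_simple: "root_exists 1 0" "root_exists 0 1"
proof -
  have 1: "(\<lambda>_. 0)(1 := 1) = (\<lambda>k::2. if k = 1 then 1 else 0::nat)"
    by (simp add: fun_eq_iff)
  have 2: "(\<lambda>_. 0)(2 := 1) = (\<lambda>k::2. if k = 1 then 0 else 1::nat)"
  proof
    fix k :: 2
    show "((\<lambda>_. 0)(2 := 1)) k = (if k = 1 then 0 else 1::nat)" using exhaust_2[of k] by auto
  qed
  show "root_exists 1 0" "root_exists 0 1"
    unfolding root_exists_def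
    using e_monomial_e_space[OF gen, of 1, unfolded 1] e_monomial_e_space[OF gen, of 2, unfolded 2]
      chev_e_nonzero[of 1] chev_e_nonzero[of 2] by blast+
qed

text \<open>For \<open>b \<le> a\<close> the predecessor in the row is the reflection
  \<open>m b - a\<close> if \<open>a\<close> is beyond the middle of the string, and
  \<open>a - 1\<close> otherwise; both satisfy the quadratic inequality again. The descent ends at a
  simple root.\<close>

lemma root_exists_quadratic:
  assumes "m \<ge> 2" "a + b > 0" "a * a + b * b \<le> m * a * b + 1"
  shows "root_exists a b"
proof -
  \<comment> \<open>Stated for an arbitrary relation \<open>R\<close>, so that it also applies to
    columns with the coordinates exchanged.\<close>
  have descent: "R a b"
    if row: "\<And>c. R c b \<Longrightarrow> c \<le> a \<Longrightarrow> a + c \<le> m * b \<Longrightarrow> R a b"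
      and IH: "\<And>c. c < a \<Longrightarrow> c * c + b * b \<le> m * c * b + 1 \<Longrightarrow> R c b"
      and le: "0 < b" "b \<le> a" and Q: "a * a + b * b \<le> m * a * b + 1"
    for R :: "nat \<Rightarrow> nat \<Rightarrow> bool" and a b
  proof (cases "2 * a > m * b")
    case True
    have "a \<le> m * b"
    proof (rule ccontr)
      assume "\<not> a \<le> m * b"
      then have "(m * b + 1) * a \<le> a * a" by (intro mult_right_mono) auto
      then have "m * a * b + a \<le> a * a" by (simp add: algebra_simps)
      moreover have "b * b > 0" "a > 0" using le by auto
      ultimately show False using Q by linarith
    qed
    then obtain c where c: "m * b = a + c" using le_Suc_ex by blast
    have "m * a * b = a * a + a * c" "m * c * b = a * c + c * c"
      using c by (metis distrib_left distrib_right mult.assoc mult.commute)+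
    then have "c * c + b * b \<le> m * c * b + 1" using Q by linarith
    then have "R c b" using IH True c by simp
    then show ?thesis using row True c by simp
  next
    case False
    obtain c where c: "a = Suc c" using le by (cases a) auto
    have "c * c + b * b \<le> m * c * b + 1"
    proof (cases "a = b")
      case True
      \<comment> \<open>Here \<open>b = c + 1\<close>, so the inequality reads
        \<open>2 c b + 1 \<le> m c b + 1\<close>, which rests on \<open>m \<ge> 2\<close>.\<close>
      have "2 * (c * b) \<le> m * (c * b)" using assms(1) by (rule mult_right_mono) simp
      moreover have "c * c + b * b = 2 * (c * b) + 1" unfolding True[symmetric] c by (simp add: algebra_simps)
      ultimately show ?thesis by (simp add: mult.assoc)
    next
      case neq: False
      then have "b * b \<le> c * c" using c le by (intro mult_mono) auto
      moreover have "c * (2 * c) \<le> c * (m * b)" using False c by (intro mult_left_mono) auto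
      moreover have "c * (2 * c) = 2 * (c * c)" "c * (m * b) = m * c * b" by simp_all
      ultimately show ?thesis by linarith
    qed
    then have "R c b" using IH c by simp
    then show ?thesis using row False c by simp
  qed
  show ?thesis
    using assms(2,3)
  proof (induction "a + b" arbitrary: a b rule: less_induct)
    case less
    consider "b = 0" | "a = 0" | "0 < b" "b \<le> a" | "0 < a" "a \<le> b" by linarith
    then show ?case
    proof cases
      case 1
      then have "a * a \<le> 1" using less.prems by simp
      then have "a = 1" using less.prems 1 by (cases a) auto
      then show ?thesis using 1 root_exists_simple by simp
    next
      case 2
      then have "b * b \<le> 1" using less.prems by simp
      then have "b = 1" using less.prems 2 by (cases b) auto
      then show ?thesis using 2 root_exists_simple by simp
    next
      case 3
      show ?thesis
      proof (rule descent[of root_exists])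
        show "root_exists c b \<Longrightarrow> c \<le> a \<Longrightarrow> a + c \<le> m * b \<Longrightarrow> root_exists a b" for c
          using root_exists_row 3 by blast
        show "c < a \<Longrightarrow> c * c + b * b \<le> m * c * b + 1 \<Longrightarrow> root_exists c b" for c
          using less.hyps[of c b] 3 by linarith
      qed (use 3 less.prems in auto)
    next
      case 4
      show ?thesis
      proof (rule descent[of "\<lambda>b a. root_exists a b"])
        show "root_exists a c \<Longrightarrow> c \<le> b \<Longrightarrow> b + c \<le> m * a \<Longrightarrow> root_exists a b" for c
          using root_exists_column 4 by blast
        show "c < b \<Longrightarrow> c * c + a * a \<le> m * c * a + 1 \<Longrightarrow> root_exists a c" for c
          using less.hyps[of a c] 4 by (simp add: ac_simps)
      qed (use 4 less.prems in \<open>simp_all add: ac_simps\<close>)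
    qed
  qed
qed

lemma root_exists_is_root:
  assumes "root_exists a b" "a > 0 \<or> b > 0"
  shows "is_root L (vector [int a, int b])"
proof -
  obtain x where x: "x \<in> e_space (\<lambda>k. if k = 1 then a else b)" "x \<noteq> 0"
    using assms by (auto simp: root_exists_def)
  have "x \<in> root_space L (vector [int a, int b])"
    using e_space_weight[OF _ x(1)]
    by (auto simp: root_space_def lattice_weight_def UNIV_2 vector_2)
  moreover have "(vector [int a, int b] :: int^2) \<noteq> 0"
    using assms(2) by (auto simp: vec_eq_iff forall_2 vector_2)
  ultimately show ?thesis using x(2) by (auto simp: is_root_def)
qed

end

lemma reduced_positive_root:
  assumes "kac_moody_algebra (cartan_matrix m) L" "m \<ge> 2" "a > 0" "b > 0" "coprime a b"
    "a * a + b * b \<le> m * a * b + 1"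
  shows "(int a, int b) \<in> reduced_positive_roots L"
proof -
  interpret kac_moody_rank2 m L using assms(1) by (simp add: kac_moody_rank2_def)
  have "is_root L (vector [int a, int b])"
    using root_exists_is_root root_exists_quadratic assms by simp
  then show ?thesis using assms by (simp add: reduced_positive_roots_def)
qed

section \<open>Noncrossing chord systems\<close>

text \<open>Cyclic order on the real projective line, which models the boundary of a triangle with
  one corner at infinity. Unlike the linear order it is reversed by the projective map
  \<open>mirror\<close> and preserved by \<open>corner_rotate\<close>.\<close>

definition cyc :: "real \<Rightarrow> real \<Rightarrow> real \<Rightarrow> bool" where
  "cyc a b c \<longleftrightarrow> a < b \<and> b < c \<or> b < c \<and> c < a \<or> c < a \<and> a < b"

fun cross :: "real \<times> real \<Rightarrow> real \<times> real \<Rightarrow> bool" where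
  "cross (a, b) (c, d) \<longleftrightarrow> cyc a c b \<and> cyc b d a \<or> cyc a d b \<and> cyc b c a"

definition between :: "real \<Rightarrow> real \<Rightarrow> real \<Rightarrow> bool" where
  "between p q z \<longleftrightarrow> p < z \<and> z < q \<or> q < z \<and> z < p"

definition beyond :: "real \<Rightarrow> real \<Rightarrow> real \<Rightarrow> bool" where
  "beyond p q z \<longleftrightarrow> z < p \<and> z < q \<or> q < z \<and> p < z"

lemma cross_iff: "cross (a, b) (c, d) \<longleftrightarrow> between c d a \<and> beyond c d b \<or> beyond c d a \<and> between c d b"
  by (rule linorder_cases[of a b]; rule linorder_cases[of c d])
    (auto simp: cyc_def between_def beyond_def)

lemma cross_sym: "cross p q \<Longrightarrow> cross q p"
proof -
  obtain a b c d where "p = (a, b)" "q = (c, d)" by fastforce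
  moreover have "cross (a, b) (c, d) \<Longrightarrow> cross (c, d) (a, b)"
    unfolding cross_iff
    by (rule linorder_cases[of a b]; rule linorder_cases[of c d]) (auto simp: between_def beyond_def)
  ultimately show "cross p q \<Longrightarrow> cross q p" by simp
qed

definition noncrossing :: "(real \<times> real) set \<Rightarrow> bool" where
  "noncrossing C \<longleftrightarrow> (\<forall>p\<in>C. \<forall>q\<in>C. \<not> cross p q)"

fun pairs :: "'a list \<Rightarrow> ('a \<times> 'a) list" where
  "pairs (x # y # zs) = (x, y) # pairs zs"
| "pairs _ = []"

text \<open>The edges of the triangle, cut open at the vertex opposite to \<open>T\<^sub>1\<close>, are laid out on the
  line in the order \<open>T\<^sub>3 = {..<0}\<close>, \<open>T\<^sub>1 = {0<..<1}\<close>, \<open>T\<^sub>2 = {1<..}\<close>; the vertex between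
  \<open>T\<^sub>3\<close> and \<open>T\<^sub>1\<close> is \<open>0\<close>.  The half turn exchanging the two triangles reverses every edge.\<close>

definition side_of :: "real \<Rightarrow> index" where
  "side_of x = (if x < 0 then I3 else if x < 1 then I1 else I2)"

text \<open>Each branch is the projective involution exchanging the two ends of its edge among 0, 1
  and infinity; with this choice the flip commutes with \<open>mirror\<close> and
  \<open>corner_rotate\<close>. At the corner 1 division by zero gives the value 0, hence the
  hypotheses \<open>x \<noteq> 1\<close> below.\<close>

definition edge_flip :: "real \<Rightarrow> real" where
  "edge_flip x = (if x < 0 then 1 / x else if x = 0 then 0 else if x < 1 then 1 - x else x / (x - 1))"

text \<open>The pieces of a curve lie alternately in the two triangles. The first starts at the
  vertex in the first triangle; odd length puts the last one, which ends at the vertex, in the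
  second triangle, whose boundary is read through the half turn.\<close>

definition chord_system :: "real list \<Rightarrow> bool" where
  "chord_system xs \<longleftrightarrow> odd (length xs) \<and> distinct xs \<and> 0 \<notin> set xs \<and> 1 \<notin> set xs \<and>
     noncrossing (set (pairs (0 # xs))) \<and> noncrossing (set (pairs (map edge_flip xs @ [0])))"

lemma edge_flip_0 [simp]: "edge_flip 0 = 0"
  by (simp add: edge_flip_def)

lemma edge_flip_eq_0_iff: "x \<noteq> 1 \<Longrightarrow> edge_flip x = 0 \<longleftrightarrow> x = 0"
  by (auto simp: edge_flip_def)

lemma edge_flip_neq_1: "x \<noteq> 1 \<Longrightarrow> edge_flip x \<noteq> 1"
  by (auto simp: edge_flip_def field_simps)

lemma edge_flip_flip: "x \<noteq> 1 \<Longrightarrow> edge_flip (edge_flip x) = x"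
  by (auto simp: edge_flip_def field_simps)

lemma edge_flip_less_0_iff: "x \<noteq> 1 \<Longrightarrow> edge_flip x < 0 \<longleftrightarrow> x < 0"
  by (auto simp: edge_flip_def field_simps)

lemma edge_flip_gt_1_iff: "x \<noteq> 1 \<Longrightarrow> edge_flip x > 1 \<longleftrightarrow> x > 1"
  by (auto simp: edge_flip_def field_simps)

lemma side_of_flip: "x \<noteq> 1 \<Longrightarrow> side_of (edge_flip x) = side_of x"
  using edge_flip_less_0_iff[of x] edge_flip_gt_1_iff[of x] edge_flip_neq_1[of x]
  by (auto simp: side_of_def)

lemma side_of_eq_iff:
  "side_of x = I1 \<longleftrightarrow> 0 \<le> x \<and> x < 1" "side_of x = I2 \<longleftrightarrow> 1 \<le> x" "side_of x = I3 \<longleftrightarrow> x < 0"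
  by (auto simp: side_of_def)

lemma edge_flip_less_iff:
  assumes "side_of x = side_of y" "x \<notin> {0, 1}" "y \<notin> {0, 1}"
  shows "edge_flip x < edge_flip y \<longleftrightarrow> y < x"
proof (cases "side_of y")
  case I1
  moreover from this have "side_of x = I1" using assms by simp
  ultimately have "0 < x" "x < 1" "0 < y" "y < 1" using assms(2,3) by (auto simp: side_of_eq_iff)
  then show ?thesis by (simp add: edge_flip_def)
next
  case I2
  moreover from this have "side_of x = I2" using assms by simp
  ultimately have "x > 1" "y > 1" using assms(2,3) by (auto simp: side_of_eq_iff order_less_le)
  then show ?thesis by (simp add: edge_flip_def divide_less_eq less_divide_eq) (auto simp: field_simps)
next
  case I3
  moreover from this have "side_of x = I3" using assms by simp
  ultimately have "x < 0" "y < 0" using assms(2,3) by (auto simp: side_of_eq_iff)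
  then show ?thesis by (simp add: edge_flip_def field_simps)
qed

lemma edge_flip_inj: "x \<noteq> 1 \<Longrightarrow> y \<noteq> 1 \<Longrightarrow> edge_flip x = edge_flip y \<longleftrightarrow> x = y"
  using edge_flip_flip by metis

lemma distinct_edge_flip:
  assumes "distinct xs" "0 \<notin> set xs" "1 \<notin> set xs"
  shows "distinct (map edge_flip xs @ [0])"
proof -
  have "inj_on edge_flip (set xs)" using assms(3) by (intro inj_onI) (metis edge_flip_inj)
  moreover have "0 \<notin> edge_flip ` set xs" using assms(2,3) by (metis edge_flip_eq_0_iff imageE)
  ultimately show ?thesis using assms(1) by (simp add: distinct_map)
qed

lemma pairs_append: "even (length us) \<Longrightarrow> pairs (us @ vs) = pairs us @ pairs vs"
  by (induction us rule: pairs.induct) auto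

lemma pairs_map: "pairs (map f zs) = map (map_prod f f) (pairs zs)"
  by (induction zs rule: pairs.induct) auto

lemma pairs_split:
  "(p, q) \<in> set (pairs zs) \<Longrightarrow> \<exists>us vs. zs = us @ p # q # vs \<and> even (length us)"
proof (induction zs rule: pairs.induct)
  case (1 x y zs)
  then show ?case
  proof (cases "(p, q) = (x, y)")
    case True
    then show ?thesis by (intro exI[of _ "[]"] exI[of _ zs]) auto
  next
    case False
    then obtain us vs where "zs = us @ p # q # vs" "even (length us)" using 1 by auto
    then show ?thesis by (intro exI[of _ "x # y # us"] exI[of _ vs]) auto
  qed
qed auto

lemma pairs_set: "(p, q) \<in> set (pairs zs) \<Longrightarrow> p \<in> set zs \<and> q \<in> set zs"
  using pairs_split by fastforce

lemma pairs_Un: "even (length zs) \<Longrightarrow> set zs = fst ` set (pairs zs) \<union> snd ` set (pairs zs)"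
  by (induction zs rule: pairs.induct) auto

lemma pairs_neq: "distinct zs \<Longrightarrow> (p, q) \<in> set (pairs zs) \<Longrightarrow> p \<noteq> q"
  by (induction zs rule: pairs.induct) (auto dest: pairs_set)

lemma pairs_unique:
  "distinct zs \<Longrightarrow> (p, q) \<in> set (pairs zs) \<Longrightarrow> (p', q') \<in> set (pairs zs) \<Longrightarrow>
   p \<noteq> q' \<and> (p = p' \<longleftrightarrow> q = q')"
  by (induction zs rule: pairs.induct) (auto dest: pairs_set pairs_neq)

definition chord :: "'a list \<Rightarrow> 'a \<Rightarrow> 'a \<Rightarrow> bool" where
  "chord zs p q \<longleftrightarrow> (p, q) \<in> set (pairs zs) \<or> (q, p) \<in> set (pairs zs)"

lemma chord_sym: "chord zs p q \<Longrightarrow> chord zs q p"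
  by (auto simp: chord_def)

lemma chord_unique: "distinct zs \<Longrightarrow> chord zs p q \<Longrightarrow> chord zs p q' \<Longrightarrow> q = q'"
  using pairs_unique unfolding chord_def by metis

lemma chord_irrefl: "distinct zs \<Longrightarrow> chord zs p q \<Longrightarrow> p \<noteq> q"
  using pairs_neq unfolding chord_def by metis

lemma chord_set: "chord zs p q \<Longrightarrow> p \<in> set zs \<and> q \<in> set zs"
  using pairs_set unfolding chord_def by metis

lemma chord_exists:
  assumes "even (length zs)" "z \<in> set zs" shows "\<exists>z'. chord zs z z'"
  using assms(2) unfolding pairs_Un[OF assms(1)] chord_def by force

lemma cross_commute: "cross (a, b) (c, d) \<longleftrightarrow> cross (b, a) (c, d)"
  "cross (a, b) (c, d) \<longleftrightarrow> cross (a, b) (d, c)"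
  by auto

lemma chord_noncrossing:
  assumes "noncrossing (set (pairs zs))" "chord zs a b" "chord zs c d"
  shows "\<not> cross (a, b) (c, d)"
  using assms cross_commute unfolding chord_def noncrossing_def by metis

lemma chord_nested:
  assumes "noncrossing (set (pairs zs))" "distinct zs" "chord zs p q" "chord zs c d" "p < c" "c < q"
  shows "p < d \<and> d < q"
proof -
  have "p < q" using assms by simp
  have "d \<noteq> p" "d \<noteq> q"
    using chord_unique[OF assms(2)] chord_sym assms(3,4,5,6) by (metis less_irrefl)+
  then show ?thesis
    using chord_noncrossing[OF assms(1,4,3)] assms(5,6) \<open>p < q\<close>
    unfolding cross_iff between_def beyond_def by auto
qed

subsection \<open>Cancelling backtracks\<close>

lemma noncrossing_subset: "noncrossing D \<Longrightarrow> C \<subseteq> D \<Longrightarrow> noncrossing C"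
  unfolding noncrossing_def by blast

text \<open>Neither \<open>c\<close> nor \<open>d\<close> separates \<open>p\<close> from
  \<open>q\<close>, so these two lie on the same side of the chord \<open>(c, d)\<close>; if it
  separates \<open>x\<close> from \<open>y\<close>, it separates \<open>x\<close> from
  \<open>p\<close> or \<open>q\<close> from \<open>y\<close>.\<close>

lemma cross_merge:
  assumes "cross (x, y) (c, d)" "\<not> between p q c" "\<not> between p q d"
    "c \<noteq> p" "c \<noteq> q" "d \<noteq> p" "d \<noteq> q"
  shows "cross (x, p) (c, d) \<or> cross (q, y) (c, d)"
proof -
  have "between c d p \<longleftrightarrow> between c d q" "beyond c d p \<longleftrightarrow> beyond c d q"
    using assms(2-) by (auto simp: between_def beyond_def)
  moreover have "between c d p \<or> beyond c d p"
    using assms(2-) by (auto simp: between_def beyond_def)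
  ultimately show ?thesis using assms(1) unfolding cross_iff by blast
qed

lemma noncrossing_merge:
  assumes nc: "noncrossing (set (pairs (us @ x # p # q # y # vs)))"
    and even: "even (length us)" and dist: "distinct (us @ x # p # q # y # vs)"
    and adj: "\<forall>z\<in>set (us @ vs). \<not> between p q z"
  shows "noncrossing (set (pairs (us @ x # y # vs)))"
proof -
  let ?C = "set (pairs us) \<union> set (pairs vs)"
  have eq: "set (pairs (us @ x # p # q # y # vs)) = insert (x, p) (insert (q, y) ?C)"
    "set (pairs (us @ x # y # vs)) = insert (x, y) ?C"
    using even by (auto simp: pairs_append)
  have no: "\<not> cross (x, y) cd" if "cd \<in> ?C" for cd
  proof
    assume c: "cross (x, y) cd"
    obtain c d where cd: "cd = (c, d)" by fastforce
    have "c \<in> set (us @ vs)" "d \<in> set (us @ vs)" using that cd pairs_set by fastforce+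
    then have "cross (x, p) (c, d) \<or> cross (q, y) (c, d)"
      using c cd adj dist by (intro cross_merge) auto
    then show False using nc that cd unfolding eq noncrossing_def by blast
  qed
  moreover have "\<not> cross (x, y) (x, y)" by (auto simp: cyc_def)
  ultimately show ?thesis
    using nc cross_sym unfolding eq noncrossing_def by blast
qed

text \<open>Below any chord lies an innermost one: a chord starting at a point between
  \<open>p\<close> and \<open>q\<close> stays between them and spans fewer points.\<close>

lemma adjacent_chord:
  assumes nc: "noncrossing (set (pairs zs))" and dist: "distinct zs" and even: "even (length zs)"
  shows "chord zs p q \<Longrightarrow> \<exists>p' q'. chord zs p' q' \<and> min p q \<le> p' \<and> p' < q' \<and> q' \<le> max p q \<and>
    (\<forall>z\<in>set zs. \<not> between p' q' z)"
proof (induction "card {z \<in> set zs. between p q z}" arbitrary: p q rule: less_induct)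
  case less
  define l r where "l = min p q" and "r = max p q"
  have lr: "chord zs l r" "l < r" "between p q = between l r" "min p q = l" "max p q = r"
    using less.prems chord_sym chord_irrefl[OF dist less.prems]
    by (auto simp: l_def r_def min_def max_def between_def fun_eq_iff)
  show ?case
  proof (cases "\<exists>z\<in>set zs. between l r z")
    case False
    then show ?thesis using lr by auto
  next
    case True
    then obtain z where z: "z \<in> set zs" "l < z" "z < r" using lr(2) by (auto simp: between_def)
    then obtain z' where z': "chord zs z z'" using chord_exists[OF even] by blast
    have in': "l < z'" "z' < r" using chord_nested[OF nc dist lr(1) z'] z by auto
    have "{y \<in> set zs. between z z' y} \<subset> {y \<in> set zs. between p q y}"
      using z in' lr by (auto simp: between_def)
    then have "card {y \<in> set zs. between z z' y} < card {y \<in> set zs. between p q y}"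
      by (intro psubset_card_mono) auto
    from less.hyps[OF this z'] obtain p' q' where
      "chord zs p' q'" "min z z' \<le> p'" "p' < q'" "q' \<le> max z z'" "\<forall>y\<in>set zs. \<not> between p' q' y"
      by blast
    then show ?thesis using z in' lr by (intro exI[of _ p'] exI[of _ q']) auto
  qed
qed

lemma side_of_between:
  assumes "side_of p = side_of q" "min p q \<le> z" "z \<le> max p q"
  shows "side_of z = side_of p"
  using assms by (auto simp: side_of_def min_def max_def split: if_splits)

lemma between_edge_flip:
  assumes "side_of p = side_of q" "p \<notin> {0, 1}" "q \<notin> {0, 1}" "z \<notin> {0, 1}" "between p q z"
  shows "between (edge_flip p) (edge_flip q) (edge_flip z)"
proof -
  have "side_of z = side_of p"
    using assms(5) by (intro side_of_between[OF assms(1)]) (auto simp: between_def)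
  then show ?thesis using assms edge_flip_less_iff by (auto simp: between_def)
qed

text \<open>In one triangle the chord \<open>(p, q)\<close> is deleted, in the other the chords
  ending at \<open>p\<close> and \<open>q\<close> are merged into one. The parity of
  \<open>us\<close> decides which is which.\<close>

lemma chord_system_remove:
  assumes sys: "chord_system (us @ p # q # vs)" and eq: "side_of p = side_of q"
    and adj: "\<forall>z\<in>set (us @ vs). \<not> between p q z"
  shows "chord_system (us @ vs)"
proof -
  let ?xs = "us @ p # q # vs" and ?f = edge_flip
  have dist: "distinct ?xs" and no01: "0 \<notin> set ?xs" "1 \<notin> set ?xs" and odd: "odd (length ?xs)"
    and ev: "noncrossing (set (pairs (0 # ?xs)))" and od: "noncrossing (set (pairs (map ?f ?xs @ [0])))"
    using sys by (auto simp: chord_system_def)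
  have not0: "\<not> between p q 0" "\<not> between (?f p) (?f q) 0"
    using eq no01 edge_flip_less_0_iff[of p] edge_flip_less_0_iff[of q] edge_flip_eq_0_iff[of p] edge_flip_eq_0_iff[of q]
    by (auto simp: between_def side_of_def split: if_splits)
  have adj': "\<not> between (?f p) (?f q) (?f z)" if "z \<in> set (us @ vs)" for z
  proof
    assume "between (?f p) (?f q) (?f z)"
    moreover have z: "z \<noteq> 0" "z \<noteq> 1" "p \<noteq> 0" "p \<noteq> 1" "q \<noteq> 0" "q \<noteq> 1" using that no01 by auto
    ultimately have "between (?f (?f p)) (?f (?f q)) (?f (?f z))"
      using eq by (intro between_edge_flip[of "?f p" "?f q" "?f z"]) (auto simp: side_of_flip edge_flip_eq_0_iff edge_flip_neq_1)
    then show False using adj that z by (simp add: edge_flip_flip)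
  qed
  have distf: "distinct (map ?f ?xs @ [0])"
    using dist no01 by (rule distinct_edge_flip)
  have "noncrossing (set (pairs (0 # us @ vs))) \<and> noncrossing (set (pairs (map ?f (us @ vs) @ [0])))"
  proof (cases "even (length us)")
    case True
    \<comment> \<open>The odd total length provides a successor of \<open>q\<close>, and the vertex
      0 serves as predecessor of \<open>p\<close> if \<open>us\<close> is empty.\<close>
    then obtain y vs' where vs: "vs = y # vs'" using odd by (cases vs) auto
    obtain us' x where us: "0 # us = us' @ [x]" by (metis list.distinct(1) rev_exhaust)
    have "length us' = length us" using us by (metis length_Cons length_append_singleton nat.inject)
    moreover have "noncrossing (set (pairs (us' @ x # p # q # y # vs')))"
      using ev us vs by (metis append.assoc append_Cons append_Nil)
    moreover have "distinct (us' @ x # p # q # y # vs')"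
      using dist no01 us vs by (metis append.assoc append_Cons append_Nil distinct.simps(2))
    moreover have "\<forall>z\<in>set (us' @ vs'). \<not> between p q z"
    proof -
      have "set us' \<subseteq> insert 0 (set us)" using us by (metis Un_iff list.simps(15) set_append subsetI)
      then show ?thesis using adj vs not0 by auto
    qed
    ultimately have "noncrossing (set (pairs (us' @ x # y # vs')))"
      using True by (intro noncrossing_merge[of us' x p q y vs']) simp_all
    then have "noncrossing (set (pairs (0 # us @ vs)))"
      using us vs by (metis append.assoc append_Cons append_Nil)
    moreover have "noncrossing (set (pairs (map ?f (us @ vs) @ [0])))"
      using True by (intro noncrossing_subset[OF od]) (auto simp: pairs_append)
    ultimately show ?thesis by simp
  next
    case False
    then obtain us' x where us: "us = us' @ [x]" by (metis even_zero list.size(3) rev_exhaust)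
    obtain y vs' where vs: "map ?f vs @ [0] = y # vs'" by (cases "map ?f vs @ [0]") auto
    have vs'': "set vs' \<subseteq> insert 0 (?f ` set vs)" using vs
      by (metis Un_insert_right empty_set image_set list.simps(15) set_append set_subset_Cons sup_bot.right_neutral)
    have "map ?f ?xs @ [0] = map ?f us' @ ?f x # ?f p # ?f q # y # vs'" using us vs by simp
    moreover have "\<forall>z\<in>set (map ?f us' @ vs'). \<not> between (?f p) (?f q) z"
      using adj' not0(2) us vs'' by auto
    ultimately have "noncrossing (set (pairs (map ?f us' @ ?f x # y # vs')))"
      using False us od distf
      by (intro noncrossing_merge[of "map ?f us'" "?f x" "?f p" "?f q" y vs']) simp_all
    then have "noncrossing (set (pairs (map ?f (us @ vs) @ [0])))" using us vs by simp
    moreover have "set (pairs ((0 # us) @ vs)) \<subseteq> set (pairs ((0 # us) @ p # q # vs))"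
      using False by (subst (1 2) pairs_append) auto
    then have "noncrossing (set (pairs (0 # us @ vs)))"
      by (intro noncrossing_subset[OF ev]) simp
    ultimately show ?thesis by simp
  qed
  then show ?thesis using dist no01 odd by (auto simp: chord_system_def)
qed

inductive reduces :: "'a list \<Rightarrow> 'a list \<Rightarrow> bool" where
  refl: "reduces w w"
| cancel: "reduces (u @ v) w \<Longrightarrow> reduces (u @ i # i # v) w"

lemma not_distinct_adj_split:
  "\<not> distinct_adj (map f xs) \<Longrightarrow> \<exists>us p q vs. xs = us @ p # q # vs \<and> f p = f q"
proof (induction xs rule: induct_list012)
  case (3 x y zs)
  show ?case
  proof (cases "f x = f y")
    case True
    then show ?thesis by (intro exI[of _ "[]"]) auto
  next
    case False
    then obtain us p q vs where "y # zs = us @ p # q # vs" "f p = f q" using 3 by auto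
    then show ?thesis by (intro exI[of _ "x # us"]) auto
  qed
qed auto

text \<open>A repeated letter is a chord with both ends on one edge. Edges are intervals with the
  vertex outside or at the end, so an innermost chord below it also has both ends on that edge and
  avoids the vertex.\<close>

lemma chord_system_backtrack:
  assumes sys: "chord_system xs" and "\<not> distinct_adj (map side_of xs)"
  shows "\<exists>us p q vs. xs = us @ p # q # vs \<and> side_of p = side_of q \<and> (\<forall>z\<in>set (us @ vs). \<not> between p q z)"
proof -
  let ?f = edge_flip
  obtain us p q vs where xs: "xs = us @ p # q # vs" and eq: "side_of p = side_of q"
    using not_distinct_adj_split assms(2) by blast
  have dist: "distinct xs" and no01: "0 \<notin> set xs" "1 \<notin> set xs" and odd: "odd (length xs)"
    and ev: "noncrossing (set (pairs (0 # xs)))" and od: "noncrossing (set (pairs (map ?f xs @ [0])))"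
    using sys by (auto simp: chord_system_def)
  have pq: "p \<notin> {0, 1}" "q \<notin> {0, 1}" using xs no01 by auto
  have distf: "distinct (map ?f xs @ [0])"
    using dist no01 by (rule distinct_edge_flip)
  show ?thesis
  proof (cases "odd (length us)")
    case True
    then have "(p, q) \<in> set (pairs ((0 # us) @ p # q # vs))" by (subst pairs_append) auto
    then have "chord (0 # xs) p q" using xs by (simp add: chord_def)
    then obtain p' q' where pq': "chord (0 # xs) p' q'" "min p q \<le> p'" "p' < q'" "q' \<le> max p q"
      "\<forall>z\<in>set (0 # xs). \<not> between p' q' z"
      using adjacent_chord[OF ev _ _, of p q] dist no01 odd by auto
    have e: "side_of p' = side_of p" "side_of q' = side_of p"
      using pq' by (auto intro!: side_of_between[OF eq])
    have ne: "p' \<noteq> 0" "q' \<noteq> 0"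
      using pq'(2-4) eq pq by (auto simp: side_of_def min_def max_def split: if_splits)
    obtain p'' q'' where o: "(p'', q'') = (p', q') \<or> (p'', q'') = (q', p')" "(p'', q'') \<in> set (pairs (0 # xs))"
      using pq'(1) unfolding chord_def by blast
    obtain us' vs' where s: "0 # xs = us' @ p'' # q'' # vs'" using pairs_split[OF o(2)] by blast
    have "p'' \<noteq> 0" using o(1) ne by blast
    then obtain us'' where "us' = 0 # us''" using s by (cases us') simp_all
    then have xs': "xs = us'' @ p'' # q'' # vs'" using s by simp
    have "between p'' q'' = between p' q'" "side_of p'' = side_of q''"
      using o(1) e by (auto simp: between_def fun_eq_iff)
    moreover have "set (us'' @ vs') \<subseteq> set (0 # xs)" using xs' by auto
    ultimately show ?thesis using xs' pq'(5) by (metis subsetD)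
  next
    case False
    then have "(?f p, ?f q) \<in> set (pairs (map ?f us @ ?f p # ?f q # map ?f vs @ [0]))"
      by (subst pairs_append) auto
    then have c: "chord (map ?f xs @ [0]) (?f p) (?f q)" using xs by (simp add: chord_def)
    obtain p' q' where pq': "chord (map ?f xs @ [0]) p' q'" "min (?f p) (?f q) \<le> p'" "p' < q'"
      "q' \<le> max (?f p) (?f q)" "\<forall>z\<in>set (map ?f xs @ [0]). \<not> between p' q' z"
      using adjacent_chord[OF od distf _ c] odd by auto
    have eq': "side_of (?f p) = side_of (?f q)" and pq2: "?f p \<notin> {0, 1}" "?f q \<notin> {0, 1}"
      using eq pq by (auto simp: side_of_flip edge_flip_eq_0_iff edge_flip_neq_1)
    have e: "side_of p' = side_of (?f p)" "side_of q' = side_of (?f p)"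
      using pq' by (auto intro!: side_of_between[OF eq'])
    have ne: "p' \<noteq> 0" "q' \<noteq> 0"
      using pq'(2-4) eq' pq2 by (auto simp: side_of_def min_def max_def split: if_splits)
    obtain p'' q'' where o: "(p'', q'') = (p', q') \<or> (p'', q'') = (q', p')"
      "(p'', q'') \<in> set (pairs (map ?f xs @ [0]))"
      using pq'(1) unfolding chord_def by blast
    obtain us' vs' where s: "map ?f xs @ [0] = us' @ p'' # q'' # vs'" using pairs_split[OF o(2)] by blast
    have "q'' \<noteq> 0" using o(1) ne by blast
    then obtain vs'' z where "vs' = vs'' @ [z]" using s by (cases vs' rule: rev_cases) auto
    then have "map ?f xs = us' @ p'' # q'' # vs''" using s by simp
    then obtain ua a b vb where ab: "xs = ua @ a # b # vb" "p'' = ?f a" "q'' = ?f b"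
      by (auto simp: map_eq_append_conv map_eq_Cons_conv Cons_eq_map_conv append_eq_map_conv)
    have ab01: "a \<notin> {0, 1}" "b \<notin> {0, 1}" using ab no01 by auto
    have bt: "between p'' q'' = between p' q'" "side_of p'' = side_of q''"
      using o(1) e by (auto simp: between_def fun_eq_iff)
    have eab: "side_of a = side_of b" using bt(2) ab ab01 by (simp add: side_of_flip)
    have "\<not> between a b z" if "z \<in> set (ua @ vb)" for z
    proof
      assume "between a b z"
      moreover have "z \<notin> {0, 1}" "z \<in> set xs" using that ab no01 by auto
      ultimately have "between p'' q'' (?f z)" "?f z \<in> set (map ?f xs @ [0])"
        using between_edge_flip[OF eab ab01, of z] ab(2,3) by auto
      then show False using pq'(5) unfolding bt(1) by blast
    qed
    then show ?thesis using ab eab by blast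
  qed
qed

lemma chord_system_reduce:
  "chord_system xs \<Longrightarrow> \<exists>ys. chord_system ys \<and> distinct_adj (map side_of ys) \<and>
     reduces (map side_of xs) (map side_of ys)"
proof (induction "length xs" arbitrary: xs rule: less_induct)
  case less
  show ?case
  proof (cases "distinct_adj (map side_of xs)")
    case True
    then show ?thesis using less.prems reduces.refl by blast
  next
    case False
    then obtain us p q vs where *: "xs = us @ p # q # vs" "side_of p = side_of q"
      "\<forall>z\<in>set (us @ vs). \<not> between p q z"
      using chord_system_backtrack less.prems by blast
    then have "chord_system (us @ vs)" using chord_system_remove less.prems by blast
    with less.hyps[of "us @ vs"] * obtain ys where "chord_system ys" "distinct_adj (map side_of ys)"
      "reduces (map side_of (us @ vs)) (map side_of ys)" by auto
    then show ?thesis using * reduces.cancel[of "map side_of us" "map side_of vs"] by auto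
  qed
qed

subsection \<open>Straight systems\<close>

lemma card_involution:
  assumes "\<And>z. z \<in> A \<Longrightarrow> f z \<in> B \<and> f (f z) = z" "\<And>z. z \<in> B \<Longrightarrow> f z \<in> A \<and> f (f z) = z"
  shows "card A = card B"
  by (rule bij_betw_same_card[of f], rule bij_betw_byWitness[where f' = f]) (use assms in auto)

text \<open>\<open>f\<close> is the partner map of a noncrossing matching and \<open>v\<close> the partner of the vertex.\<close>

locale straight_matching =
  fixes Z :: "real set" and f :: "real \<Rightarrow> real" and v :: real
  assumes finite_Z: "finite Z" and vertex_Z: "0 \<in> Z" "1 \<notin> Z"
    and f_Z: "z \<in> Z \<Longrightarrow> f z \<in> Z" and f_f: "z \<in> Z \<Longrightarrow> f (f z) = z"
    and side_f: "z \<in> Z \<Longrightarrow> z \<noteq> 0 \<Longrightarrow> f z \<noteq> 0 \<Longrightarrow> side_of (f z) \<noteq> side_of z"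
    and nested: "z \<in> Z \<Longrightarrow> y \<in> Z \<Longrightarrow> y < z \<Longrightarrow> z < f y \<Longrightarrow> y < f z \<and> f z < f y"
    and f_0: "f 0 = v" and v: "v > 1"
begin

definition low where "low = {z \<in> Z. 0 < z \<and> z < 1}"
definition high where "high = {z \<in> Z. 1 < z}"
definition neg where "neg = {z \<in> Z. z < 0}"

lemma finite_blocks [simp]: "finite low" "finite high" "finite neg"
  using finite_Z by (auto simp: low_def high_def neg_def)

lemma block_cases: "z \<in> Z \<Longrightarrow> z = 0 \<or> z \<in> low \<or> z \<in> high \<or> z \<in> neg"
  using vertex_Z unfolding low_def high_def neg_def
  by (cases "z = 1") (auto simp: not_less)

lemma v_Z: "v \<in> Z" "f v = 0"
  using f_Z[OF vertex_Z(1)] f_f[OF vertex_Z(1)] f_0 by auto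

lemma not_same_block:
  "z \<in> low \<Longrightarrow> f z \<notin> low" "z \<in> high \<Longrightarrow> f z \<notin> high" "z \<in> neg \<Longrightarrow> f z \<notin> neg"
  using side_f[of z] by (auto simp: low_def high_def neg_def side_of_def)

lemma f_eq_0: "z \<in> Z \<Longrightarrow> f z = 0 \<Longrightarrow> z = v"
  using f_f f_0 by metis

text \<open>The chord from the vertex to \<open>v\<close> cuts the triangle in two:
  \<open>T\<^sub>1\<close> faces the part of \<open>T\<^sub>2\<close> below \<open>v\<close>, and
  \<open>T\<^sub>3\<close> the part above. This and the next three lemmas spell that out.\<close>

lemma f_low: "z \<in> low \<Longrightarrow> f z \<in> high \<and> f z < v"
proof -
  assume z: "z \<in> low"
  then have zZ: "z \<in> Z" and "0 < z" "z < v" using v by (auto simp: low_def)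
  then have "0 < f z" "f z < v" using nested[of z 0] f_0 vertex_Z by auto
  moreover have "f z \<noteq> 0" using \<open>0 < f z\<close> by simp
  ultimately show ?thesis using block_cases[OF f_Z[OF zZ]] not_same_block(1)[OF z]
    by (auto simp: neg_def)
qed

lemma f_high_less: "z \<in> high \<Longrightarrow> z < v \<Longrightarrow> f z \<in> low"
proof -
  assume z: "z \<in> high" "z < v"
  then have zZ: "z \<in> Z" and "0 < z" by (auto simp: high_def)
  then have "0 < f z" using nested[of z 0] f_0 vertex_Z z by auto
  then show ?thesis using block_cases[OF f_Z[OF zZ]] not_same_block(2)[OF z(1)]
    by (auto simp: neg_def)
qed

lemma f_neg: "z \<in> neg \<Longrightarrow> f z \<in> high \<and> v < f z"
proof -
  assume z: "z \<in> neg"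
  then have zZ: "z \<in> Z" and zn: "z < 0" by (auto simp: neg_def)
  have nz: "f z \<noteq> 0" using f_eq_0[OF zZ] zn v by auto
  have nl: "f z \<notin> low" using f_low[of "f z"] f_f[OF zZ] zn by (auto simp: high_def)
  have h: "f z \<in> high" using block_cases[OF f_Z[OF zZ]] nz nl not_same_block(3)[OF z] by blast
  moreover have "f z \<noteq> v" using f_f[OF zZ] v_Z zn by auto
  moreover have "\<not> f z < v" using f_high_less[OF h] f_f[OF zZ] zn by (auto simp: low_def)
  ultimately show ?thesis by auto
qed

lemma f_high_greater: "z \<in> high \<Longrightarrow> v < z \<Longrightarrow> f z \<in> neg"
proof -
  assume z: "z \<in> high" "v < z"
  then have zZ: "z \<in> Z" by (auto simp: high_def)
  have "f z \<noteq> 0" using f_eq_0[OF zZ] z by auto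
  moreover have "f z \<notin> low" using f_low[of "f z"] f_f[OF zZ] z by auto
  ultimately show ?thesis using block_cases[OF f_Z[OF zZ]] not_same_block(2)[OF z(1)] by auto
qed

lemma block_subset_Z: "z \<in> low \<Longrightarrow> z \<in> Z" "z \<in> high \<Longrightarrow> z \<in> Z" "z \<in> neg \<Longrightarrow> z \<in> Z"
  by (auto simp: low_def high_def neg_def)

text \<open>Position along \<open>T\<^sub>2\<close> counted from the corner 1. In
  \<open>chord_system_straight\<close> it becomes the numerator \<open>r\<close> of
  \<open>run\<close>.\<close>

definition rank where "rank z = card {y \<in> high. y \<le> z}"

lemma rank_less: "z \<in> high \<Longrightarrow> rank z = Suc (card {y \<in> high. y < z})"
proof -
  assume "z \<in> high"
  then have "{y \<in> high. y \<le> z} = insert z {y \<in> high. y < z}" by auto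
  then show ?thesis by (simp add: rank_def)
qed

lemma v_high: "v \<in> high"
  using v_Z v by (simp add: high_def)

lemma card_low: "card low = card {y \<in> high. y < v}"
  by (rule card_involution[of _ f]) (use f_low f_high_less f_f block_subset_Z in auto)

lemma rank_v: "rank v = card low + 1"
  using rank_less[OF v_high] card_low by simp

lemma card_neg: "card neg = card {y \<in> high. v < y}"
  by (rule card_involution[of _ f]) (use f_neg f_high_greater f_f block_subset_Z in auto)

lemma card_high: "card high = card low + card neg + 1"
proof -
  have "high = {y \<in> high. y < v} \<union> insert v {y \<in> high. v < y}" using v_high by auto
  then have "card high = card ({y \<in> high. y < v} \<union> insert v {y \<in> high. v < y})" by simp
  also have "\<dots> = card {y \<in> high. y < v} + card (insert v {y \<in> high. v < y})"
    by (rule card_Un_disjoint) auto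
  finally show ?thesis using card_low card_neg by simp
qed

lemma card_split: "finite A \<Longrightarrow> card A = card {y \<in> A. y \<le> z} + card {y \<in> A. (z::real) < y}"
proof -
  assume "finite A"
  moreover have "A = {y \<in> A. y \<le> z} \<union> {y \<in> A. z < y}" by auto
  ultimately show ?thesis
    by (metis (no_types, lifting) card_Un_disjoint disjoint_iff finite_Un leD mem_Collect_eq)
qed

text \<open>The chords between \<open>T\<^sub>1\<close> and \<open>T\<^sub>2\<close> are nested
  around the corner 1, so \<open>f\<close> reverses order: the points of \<open>T\<^sub>1\<close>
  beyond \<open>p\<close> match the points of \<open>T\<^sub>2\<close> before
  \<open>f p\<close>.\<close>

lemma rank_f_low:
  assumes "p \<in> low"
  shows "rank (f p) + card {y \<in> low. y \<le> p} = card low + 1"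
proof -
  have h: "f p \<in> high" using f_low assms by blast
  have pf: "p < f p" using h assms by (auto simp: low_def high_def)
  have pZ: "p \<in> Z" using assms block_subset_Z by blast
  have "card {y \<in> low. p < y} = card {y \<in> high. y < f p}"
  proof (rule card_involution[of _ f])
    fix y assume "y \<in> {y \<in> low. p < y}"
    then have y: "y \<in> low" "p < y" by auto
    then have "y < f p" using h by (auto simp: low_def high_def)
    then show "f y \<in> {y \<in> high. y < f p} \<and> f (f y) = y"
      using nested[of y p] f_low y pZ f_f block_subset_Z by auto
  next
    fix y assume "y \<in> {y \<in> high. y < f p}"
    then have y: "y \<in> high" "y < f p" by auto
    then have "p < y" "y < v" using assms f_low[OF assms] by (auto simp: low_def high_def)
    then show "f y \<in> {y \<in> low. p < y} \<and> f (f y) = y"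
      using nested[of y p] f_high_less y pZ f_f block_subset_Z by auto
  qed
  then show ?thesis using rank_less[OF h] card_split[of low p] by simp
qed

text \<open>These chords are nested around the corner at infinity: the points of
  \<open>T\<^sub>3\<close> beyond \<open>p\<close> match the points of \<open>T\<^sub>2\<close>
  between \<open>v\<close> and \<open>f p\<close>.\<close>

lemma rank_f_neg:
  assumes "p \<in> neg"
  shows "rank (f p) + card {y \<in> neg. y \<le> p} = card low + card neg + 2"
proof -
  have h: "f p \<in> high" "v < f p" using f_neg assms by blast+
  have pZ: "p \<in> Z" using assms block_subset_Z by blast
  have "card {y \<in> neg. p < y} = card {y \<in> high. v < y \<and> y < f p}"
  proof (rule card_involution[of _ f])
    fix y assume "y \<in> {y \<in> neg. p < y}"
    then have y: "y \<in> neg" "p < y" by auto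
    then have "y < f p" using h by (auto simp: neg_def high_def)
    then show "f y \<in> {y \<in> high. v < y \<and> y < f p} \<and> f (f y) = y"
      using nested[of y p] f_neg y pZ f_f block_subset_Z by auto
  next
    fix y assume "y \<in> {y \<in> high. v < y \<and> y < f p}"
    then have y: "y \<in> high" "v < y" "y < f p" by auto
    then have "p < y" using assms by (auto simp: neg_def high_def)
    then show "f y \<in> {y \<in> neg. p < y} \<and> f (f y) = y"
      using nested[of y p] f_high_greater y pZ f_f block_subset_Z by auto
  qed
  moreover have "card ({y \<in> high. y \<le> v} \<union> {y \<in> high. v < y \<and> y < f p}) =
      card {y \<in> high. y \<le> v} + card {y \<in> high. v < y \<and> y < f p}"
    by (rule card_Un_disjoint) auto
  moreover have "{y \<in> high. y \<le> v} \<union> {y \<in> high. v < y \<and> y < f p} = {y \<in> high. y < f p}"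
    using h by auto
  ultimately show ?thesis
    using rank_less[OF h(1)] rank_v card_split[of neg p] by (simp add: rank_def)
qed

end

lemma straight_matching_pairs:
  assumes dist: "distinct zs" and even: "even (length zs)" and nc: "noncrossing (set (pairs zs))"
    and zs: "0 \<in> set zs" "1 \<notin> set zs" and v: "chord zs 0 v" "v > 1"
    and side: "\<And>p q. chord zs p q \<Longrightarrow> p \<noteq> 0 \<Longrightarrow> q \<noteq> 0 \<Longrightarrow> side_of p \<noteq> side_of q"
  obtains f where "straight_matching (set zs) f v" "\<And>p q. chord zs p q \<Longrightarrow> f p = q"
proof -
  obtain f where f: "\<And>z. z \<in> set zs \<Longrightarrow> chord zs z (f z)"
    using chord_exists[OF even] by metis
  have u: "f p = q" if "chord zs p q" for p q
    using chord_unique[OF dist f that] chord_set[OF that] by blast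
  have "straight_matching (set zs) f v"
  proof
    show "f z \<in> set zs" if "z \<in> set zs" for z using chord_set[OF f[OF that]] by simp
    show "f (f z) = z" if "z \<in> set zs" for z using u[OF chord_sym[OF f[OF that]]] .
    show "side_of (f z) \<noteq> side_of z" if "z \<in> set zs" "z \<noteq> 0" "f z \<noteq> 0" for z
      using side[OF f[OF that(1)] that(2,3)] by simp
    show "y < f z \<and> f z < f y" if "z \<in> set zs" "y \<in> set zs" "y < z" "z < f y" for y z
      using chord_nested[OF nc dist f[OF that(2)] f[OF that(1)] that(3,4)] .
  qed (use zs v u in auto)
  then show ?thesis using that u by blast
qed

lemma chord_system_side:
  assumes "distinct_adj (map side_of xs)" "chord_system xs"
  shows "chord (0 # xs) p q \<Longrightarrow> p \<noteq> 0 \<Longrightarrow> q \<noteq> 0 \<Longrightarrow> side_of p \<noteq> side_of q"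
    and "chord (map edge_flip xs @ [0]) p q \<Longrightarrow> p \<noteq> 0 \<Longrightarrow> q \<noteq> 0 \<Longrightarrow> side_of p \<noteq> side_of q"
proof -
  have adj: "side_of p \<noteq> side_of q" if "xs = us @ p # q # vs" for us p q vs
    using assms(1) unfolding that by (simp add: distinct_adj_append_iff)
  have 1: "side_of p \<noteq> side_of q" if c: "(p, q) \<in> set (pairs (0 # xs))" and nz: "p \<noteq> 0" for p q
  proof -
    obtain us vs where s: "0 # xs = us @ p # q # vs" using pairs_split[OF c] by blast
    then obtain us' where "us = 0 # us'" using nz by (cases us) auto
    then show ?thesis using s adj by simp
  qed
  have 2: "side_of p \<noteq> side_of q"
    if c: "(p, q) \<in> set (pairs (map edge_flip xs @ [0]))" and nz: "q \<noteq> 0" for p q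
  proof -
    obtain us vs where s: "map edge_flip xs @ [0] = us @ p # q # vs" using pairs_split[OF c] by blast
    then obtain vs' z where "vs = vs' @ [z]" using nz by (cases vs rule: rev_cases) auto
    then have "map edge_flip xs = us @ p # q # vs'" using s by simp
    then obtain ua a b vb where ab: "xs = ua @ a # b # vb" "p = edge_flip a" "q = edge_flip b"
      by (auto simp: map_eq_append_conv map_eq_Cons_conv Cons_eq_map_conv append_eq_map_conv)
    moreover have "a \<noteq> 1" "b \<noteq> 1" using ab assms(2) by (auto simp: chord_system_def)
    ultimately show ?thesis using adj by (simp add: side_of_flip)
  qed
  show "chord (0 # xs) p q \<Longrightarrow> p \<noteq> 0 \<Longrightarrow> q \<noteq> 0 \<Longrightarrow> side_of p \<noteq> side_of q"
    "chord (map edge_flip xs @ [0]) p q \<Longrightarrow> p \<noteq> 0 \<Longrightarrow> q \<noteq> 0 \<Longrightarrow> side_of p \<noteq> side_of q"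
    using 1 2 by (metis chord_def)+
qed

lemma card_flip_image:
  assumes fin: "finite B" and B: "\<And>y. y \<in> B \<Longrightarrow> side_of y = i \<and> y \<notin> {0, 1}" and z: "z \<in> B"
  shows "card {y \<in> edge_flip ` B. y \<le> edge_flip z} + card {y \<in> B. y \<le> z} = card B + 1"
proof -
  have lt: "edge_flip x \<le> edge_flip y \<longleftrightarrow> y \<le> x" if "x \<in> B" "y \<in> B" for x y
    using edge_flip_less_iff[of y x] B that by (metis not_le)
  have "{y \<in> edge_flip ` B. y \<le> edge_flip z} = edge_flip ` {y \<in> B. z \<le> y}"
    using lt z by auto
  moreover have "inj_on edge_flip B" using B edge_flip_inj by (intro inj_onI) (metis insertCI)
  then have "card (edge_flip ` {y \<in> B. z \<le> y}) = card {y \<in> B. z \<le> y}"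
    by (intro card_image) (rule inj_on_subset, auto)
  moreover have "card {y \<in> B. z \<le> y} + card {y \<in> B. y \<le> z} = card B + 1"
  proof -
    have "card ({y \<in> B. z \<le> y} \<union> {y \<in> B. y \<le> z}) + card ({y \<in> B. z \<le> y} \<inter> {y \<in> B. y \<le> z}) =
        card {y \<in> B. z \<le> y} + card {y \<in> B. y \<le> z}"
      using fin by (intro card_Un_Int[symmetric]) auto
    moreover have "{y \<in> B. z \<le> y} \<union> {y \<in> B. y \<le> z} = B" "{y \<in> B. z \<le> y} \<inter> {y \<in> B. y \<le> z} = {z}"
      using z by auto
    ultimately show ?thesis by simp
  qed
  ultimately show ?thesis by simp
qed

text \<open>The ranks of a point of \<open>T\<^sub>2\<close> seen from the two triangles add up to
  \<open>a + b\<close>. Along a chord from \<open>x\<close> to \<open>p\<close> in the second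
  triangle and one from \<open>p\<close> to \<open>q\<close> in the first, the rank drops by
  \<open>a\<close> if \<open>p\<close> lies on \<open>T\<^sub>1\<close> and grows by
  \<open>b\<close> if it lies on \<open>T\<^sub>3\<close>. It starts at \<open>b\<close> and is
  \<open>a\<close> at the end: this is the recursion of \<open>run\<close>.\<close>

theorem chord_system_straight:
  assumes sys: "chord_system xs" and adj: "distinct_adj (map side_of xs)"
    and ends: "side_of (hd xs) = I2" "side_of (last xs) = I2"
  defines "a \<equiv> card {x \<in> set xs. side_of x = I3} + 1" and "b \<equiv> card {x \<in> set xs. side_of x = I1} + 1"
  shows "run a b b (map side_of (tl xs))"
proof -
  let ?f = edge_flip and ?ys = "map edge_flip xs @ [0]"
  have dist: "distinct xs" and no01: "0 \<notin> set xs" "1 \<notin> set xs" and odd: "odd (length xs)"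
    and ev: "noncrossing (set (pairs (0 # xs)))" and od: "noncrossing (set (pairs ?ys))"
    using sys by (auto simp: chord_system_def)
  have ne: "xs \<noteq> []" using odd by auto
  define v w where "v = hd xs" and "w = ?f (last xs)"
  have vin: "v \<in> set xs" "last xs \<in> set xs" using ne by (simp_all add: v_def)
  have v1: "v > 1" "last xs > 1" using ends vin no01 by (auto simp: v_def side_of_eq_iff order_less_le)
  have w1: "w > 1" using v1 by (simp add: w_def edge_flip_gt_1_iff)
  have cv: "chord (0 # xs) 0 v" using ne by (cases xs) (auto simp: chord_def v_def)
  obtain bs l where bl: "xs = bs @ [l]" using ne by (cases xs rule: rev_cases) auto
  then have "?ys = map ?f bs @ [w, 0]" "even (length bs)" using odd by (simp_all add: w_def)
  then have cw: "chord ?ys 0 w" by (simp add: chord_def pairs_append)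
  obtain f where f: "straight_matching (set (0 # xs)) f v" "\<And>p q. chord (0 # xs) p q \<Longrightarrow> f p = q"
    by (rule straight_matching_pairs[OF _ _ ev _ _ cv v1(1) chord_system_side(1)[OF adj sys]])
      (use dist no01 odd in auto)
  have distf: "distinct ?ys" using dist no01 by (rule distinct_edge_flip)
  have "1 \<notin> ?f ` set xs" using no01 edge_flip_neq_1 by (metis imageE)
  then have no1f: "1 \<notin> set ?ys" by simp
  obtain g where g: "straight_matching (set ?ys) g w" "\<And>p q. chord ?ys p q \<Longrightarrow> g p = q"
    by (rule straight_matching_pairs[OF distf _ od _ no1f cw w1 chord_system_side(2)[OF adj sys]])
      (use odd in auto)
  interpret F: straight_matching "set (0 # xs)" f v by (rule f(1))
  interpret G: straight_matching "set ?ys" g w by (rule g(1))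
  have low: "F.low = {x \<in> set xs. side_of x = I1}" and high: "F.high = {x \<in> set xs. side_of x = I2}"
    and neg: "F.neg = {x \<in> set xs. side_of x = I3}"
    unfolding F.low_def F.high_def F.neg_def using no01 by (auto simp: side_of_eq_iff order_less_le)
  have ysim: "{y \<in> set ?ys. P y} = ?f ` {x \<in> set xs. P (?f x)}" if "\<not> P 0" for P
    using that by auto
  have glow: "G.low = ?f ` F.low" and ghigh: "G.high = ?f ` F.high" and gneg: "G.neg = ?f ` F.neg"
  proof -
    have i: "0 < ?f x \<and> ?f x < 1 \<longleftrightarrow> 0 < x \<and> x < 1" "1 < ?f x \<longleftrightarrow> 1 < x" "?f x < 0 \<longleftrightarrow> x < 0"
      if "x \<in> set xs" for x
    proof -
      have x: "x \<noteq> 0" "x \<noteq> 1" using that no01 by auto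
      then have "?f x \<noteq> 0" "?f x \<noteq> 1" by (simp_all add: edge_flip_eq_0_iff edge_flip_neq_1)
      then show "0 < ?f x \<and> ?f x < 1 \<longleftrightarrow> 0 < x \<and> x < 1" "1 < ?f x \<longleftrightarrow> 1 < x" "?f x < 0 \<longleftrightarrow> x < 0"
        using x edge_flip_less_0_iff[of x] edge_flip_gt_1_iff[of x] by linarith+
    qed
    have l: "F.low = {x \<in> set xs. 0 < x \<and> x < 1}" "F.high = {x \<in> set xs. 1 < x}" "F.neg = {x \<in> set xs. x < 0}"
      unfolding F.low_def F.high_def F.neg_def by auto
    show "G.low = ?f ` F.low" "G.high = ?f ` F.high" "G.neg = ?f ` F.neg"
      unfolding G.low_def G.high_def G.neg_def l
      by (subst ysim; use i in force)+
  qed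
  have inj: "inj_on ?f (set xs)" using no01 edge_flip_inj by (intro inj_onI) metis
  have cards: "card G.low = card F.low" "card G.high = card F.high" "card G.neg = card F.neg"
    unfolding glow ghigh gneg low high neg
    by (intro card_image inj_on_subset[OF inj]; auto)+
  have ab: "a = card F.neg + 1" "b = card F.low + 1"
    unfolding a_def b_def low neg by - (rule HOL.refl)+
  have flip: "card {y \<in> ?f ` B. y \<le> ?f z} + card {y \<in> B. y \<le> z} = card B + 1"
    if "B = {x \<in> set xs. side_of x = i}" "z \<in> B" for B i z
  proof (rule card_flip_image)
    show "finite B" using that(1) by simp
    show "side_of y = i \<and> y \<notin> {0, 1}" if "y \<in> B" for y
      using that \<open>B = _\<close> no01 by blast
  qed (rule that(2))
  have rank_flip: "G.rank (?f x) + F.rank x = a + b" if "x \<in> F.high" for x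
    using flip[OF high that] ab F.card_high unfolding G.rank_def F.rank_def ghigh by linarith
  \<comment> \<open>\<open>x\<close> stands at an even position, where a chord of the second
    triangle starts; two crossings later the curve is on \<open>T\<^sub>2\<close> again.\<close>
  have "\<forall>us x. xs = us @ x # ws \<and> even (length us) \<and> x \<in> F.high \<longrightarrow> run a b (F.rank x) (map side_of ws)" for ws
  proof (induction ws rule: pairs.induct)
    case (1 p q ws)
    show ?case
    proof (intro allI impI, elim conjE)
      fix us x assume xs: "xs = us @ x # p # q # ws" and us: "even (length us)" and x: "x \<in> F.high"
      have ys: "?ys = map ?f us @ ?f x # ?f p # ?f q # map ?f ws @ [0]" using xs by simp
      have "chord ?ys (?f x) (?f p)" unfolding ys chord_def using us by (simp add: pairs_append)
      then have gp: "g (?f p) = ?f x" by (intro g(2)[OF chord_sym])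
      have xs': "0 # xs = (0 # us @ [x]) @ p # q # ws" using xs by simp
      have "chord (0 # xs) p q"
        unfolding xs' chord_def using us by (simp add: pairs_append del: append_Cons)
      then have fp: "f p = q" by (rule f(2))
      have p: "p \<in> set xs" using xs by simp
      have "side_of x \<noteq> side_of p" using adj unfolding xs by (simp add: distinct_adj_append_iff)
      moreover have "side_of x = I2" using x unfolding high by simp
      ultimately have "p \<notin> F.high" unfolding high by simp
      then have "p \<in> F.low \<or> p \<in> F.neg" using F.block_cases[of p] p no01 by auto
      then show "run a b (F.rank x) (map side_of (p # q # ws))"
      proof
        assume p: "p \<in> F.low"
        have "G.rank (?f x) + card {y \<in> G.low. y \<le> ?f p} = b"
          using G.rank_f_low[of "?f p"] p cards(1) unfolding gp ab glow by simp
        moreover have "card {y \<in> G.low. y \<le> ?f p} + card {y \<in> F.low. y \<le> p} = b"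
          using flip[OF low p] ab unfolding glow by linarith
        moreover have q: "F.rank q + card {y \<in> F.low. y \<le> p} = b" "q \<in> F.high"
          using F.rank_f_low[OF p] F.f_low[OF p] unfolding fp ab by blast+
        moreover have "card {y \<in> F.low. y \<le> p} \<le> card F.low"
          by (rule card_mono[OF F.finite_blocks(1)]) blast
        ultimately have r: "F.rank q = F.rank x - a" "F.rank x > a" using rank_flip[OF x] ab by linarith+
        have "xs = (us @ [x, p]) @ q # ws" "even (length (us @ [x, p]))" using xs us by simp_all
        then have "run a b (F.rank q) (map side_of ws)" using "1.IH" q(2) by blast
        moreover have "side_of p = I1" "side_of q = I2" using p q(2) unfolding low high by simp_all
        ultimately show ?thesis using run.high[of a "F.rank x" b "map side_of ws"] r by simp
      next
        assume p: "p \<in> F.neg"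
        have "G.rank (?f x) + card {y \<in> G.neg. y \<le> ?f p} = a + b"
          using G.rank_f_neg[of "?f p"] p cards(1,3) unfolding gp ab glow gneg by simp
        moreover have "card {y \<in> G.neg. y \<le> ?f p} + card {y \<in> F.neg. y \<le> p} = a"
          using flip[OF neg p] ab unfolding gneg by linarith
        moreover have q: "F.rank q + card {y \<in> F.neg. y \<le> p} = a + b" "q \<in> F.high"
          using F.rank_f_neg[OF p] F.f_neg[OF p] unfolding fp ab by linarith+
        moreover have "finite {y \<in> F.neg. y \<le> p}"
          by (rule finite_subset[OF _ F.finite_blocks(3)]) blast
        then have "card {y \<in> F.neg. y \<le> p} > 0" using p unfolding card_gt_0_iff by blast
        ultimately have r: "F.rank q = F.rank x + b" "F.rank x < a" using rank_flip[OF x] by linarith+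
        have "xs = (us @ [x, p]) @ q # ws" "even (length (us @ [x, p]))" using xs us by simp_all
        then have "run a b (F.rank q) (map side_of ws)" using "1.IH" q(2) by blast
        moreover have "side_of p = I3" "side_of q = I2" using p q(2) unfolding neg high by simp_all
        ultimately show ?thesis using run.low[of "F.rank x" a b "map side_of ws"] r by simp
      qed
    qed
  next
    case "2_1"
    show ?case
    proof (intro allI impI, elim conjE)
      fix us x assume xs: "xs = us @ [x]" and x: "x \<in> F.high"
      then have "w = ?f x" by (simp add: w_def)
      then have "G.rank (?f x) = b" using G.rank_v cards(1) ab by simp
      then have "F.rank x = a" using rank_flip[OF x] by simp
      then show "run a b (F.rank x) (map side_of [])" using run.stop by simp
    qed
  next
    case ("2_2" p)
    then show ?case using odd by auto
  qed
  from this[of "tl xs"] have "v \<in> F.high \<longrightarrow> run a b (F.rank v) (map side_of (tl xs))"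
    using ne unfolding v_def by (metis append_Nil even_zero hd_Cons_tl list.size(3))
  then show ?thesis using F.v_high F.rank_v ab by simp
qed

subsection \<open>Rotating and reflecting the triangle\<close>

lemma noncrossing_image:
  assumes "noncrossing C"
    and "\<And>a b c d. (a, b) \<in> C \<Longrightarrow> (c, d) \<in> C \<Longrightarrow> cross (f a, f b) (f c, f d) \<Longrightarrow> cross (a, b) (c, d)"
  shows "noncrossing (map_prod f f ` C)"
  using assms unfolding noncrossing_def by force

text \<open>Fixes the corner 0 and exchanges the corners 1 and infinity, hence exchanges
  \<open>T\<^sub>1\<close> and \<open>T\<^sub>3\<close>.\<close>

definition mirror :: "real \<Rightarrow> real" where "mirror x = x / (x - 1)"

text \<open>Carries the corners 1, 0, infinity to 0, infinity, 1, so that the corner between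
  \<open>T\<^sub>1\<close> and \<open>T\<^sub>2\<close> takes the place of the vertex.\<close>

definition corner_rotate :: "real \<Rightarrow> real" where "corner_rotate x = (x - 1) / x"

lemma mirror_less_iff:
  assumes "x \<noteq> 1" "y \<noteq> 1"
  shows "mirror x < mirror y \<longleftrightarrow> (if x < 1 then y < 1 \<and> y < x \<or> 1 < y else 1 < y \<and> y < x)"
  using assms unfolding mirror_def
  by (cases "x < 1"; cases "y < 1") (auto simp: divide_simps not_less; argo)+

lemma cyc_mirror:
  "a \<noteq> 1 \<Longrightarrow> b \<noteq> 1 \<Longrightarrow> c \<noteq> 1 \<Longrightarrow> cyc (mirror a) (mirror b) (mirror c) \<longleftrightarrow> cyc c b a"
  unfolding cyc_def mirror_less_iff by (auto split: if_splits)

lemma corner_rotate_less_iff: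
  assumes "x \<noteq> 0" "y \<noteq> 0"
  shows "corner_rotate x < corner_rotate y \<longleftrightarrow> (if x > 0 then y < 0 \<or> x < y else y < 0 \<and> x < y)"
  using assms unfolding corner_rotate_def
  by (cases "x < 0"; cases "y < 0") (auto simp: divide_simps not_less; argo)+

lemma cyc_corner_rotate:
  "a \<noteq> 0 \<Longrightarrow> b \<noteq> 0 \<Longrightarrow> c \<noteq> 0 \<Longrightarrow> cyc (corner_rotate a) (corner_rotate b) (corner_rotate c) \<longleftrightarrow> cyc a b c"
  unfolding cyc_def corner_rotate_less_iff by (auto split: if_splits)

lemma edge_flip_mirror: "x \<noteq> 1 \<Longrightarrow> edge_flip (mirror x) = mirror (edge_flip x)"
  by (auto simp: edge_flip_def mirror_def divide_simps) (simp_all add: algebra_simps)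

lemma edge_flip_corner_rotate: "x \<noteq> 0 \<Longrightarrow> x \<noteq> 1 \<Longrightarrow> edge_flip (corner_rotate x) = corner_rotate (edge_flip x)"
  by (auto simp: edge_flip_def corner_rotate_def divide_simps) (simp_all add: algebra_simps)

lemma side_of_mirror: "x \<noteq> 0 \<Longrightarrow> x \<noteq> 1 \<Longrightarrow> side_of (mirror x) = swap13 (side_of x)"
  by (auto simp: side_of_def mirror_def divide_simps)

fun cycle123 :: "index \<Rightarrow> index" where
  "cycle123 I1 = I3" | "cycle123 I2 = I1" | "cycle123 I3 = I2"

lemma side_of_corner_rotate: "x \<noteq> 0 \<Longrightarrow> x \<noteq> 1 \<Longrightarrow> side_of (corner_rotate x) = cycle123 (side_of x)"
  by (auto simp: side_of_def corner_rotate_def divide_simps)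

lemma mirror_eqs: "mirror 0 = 0" "x \<noteq> 1 \<Longrightarrow> mirror x = 0 \<longleftrightarrow> x = 0" "x \<noteq> 1 \<Longrightarrow> mirror x \<noteq> 1"
  by (auto simp: mirror_def field_simps)

lemma corner_rotate_eqs: "corner_rotate 1 = 0" "x \<noteq> 0 \<Longrightarrow> corner_rotate x = 0 \<longleftrightarrow> x = 1" "x \<noteq> 0 \<Longrightarrow> corner_rotate x \<noteq> 1"
  by (auto simp: corner_rotate_def field_simps)

lemma mirror_inj: "x \<noteq> 1 \<Longrightarrow> y \<noteq> 1 \<Longrightarrow> mirror x = mirror y \<Longrightarrow> x = y"
  using mirror_less_iff[of x y] mirror_less_iff[of y x] by (auto split: if_splits)

lemma corner_rotate_inj: "x \<noteq> 0 \<Longrightarrow> y \<noteq> 0 \<Longrightarrow> corner_rotate x = corner_rotate y \<Longrightarrow> x = y"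
  using corner_rotate_less_iff[of x y] corner_rotate_less_iff[of y x] by (auto split: if_splits)

lemma noncrossing_mirror:
  assumes "noncrossing (set (pairs zs))" "1 \<notin> set zs"
  shows "noncrossing (set (pairs (map mirror zs)))"
  unfolding pairs_map set_map
proof (rule noncrossing_image[OF assms(1)])
  fix a b c d assume "(a, b) \<in> set (pairs zs)" "(c, d) \<in> set (pairs zs)"
  then have "a \<noteq> 1" "b \<noteq> 1" "c \<noteq> 1" "d \<noteq> 1" using pairs_set assms(2) by metis+
  moreover assume "cross (mirror a, mirror b) (mirror c, mirror d)"
  ultimately show "cross (a, b) (c, d)" by (auto simp: cyc_mirror)
qed

lemma noncrossing_corner_rotate:
  assumes "noncrossing (set (pairs zs))" "0 \<notin> set zs"
  shows "noncrossing (set (pairs (map corner_rotate zs)))"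
  unfolding pairs_map set_map
proof (rule noncrossing_image[OF assms(1)])
  fix a b c d assume "(a, b) \<in> set (pairs zs)" "(c, d) \<in> set (pairs zs)"
  then have "a \<noteq> 0" "b \<noteq> 0" "c \<noteq> 0" "d \<noteq> 0" using pairs_set assms(2) by metis+
  moreover assume "cross (corner_rotate a, corner_rotate b) (corner_rotate c, corner_rotate d)"
  ultimately show "cross (a, b) (c, d)" by (auto simp: cyc_corner_rotate)
qed

lemma chord_system_mirror:
  assumes "chord_system xs"
  shows "chord_system (map mirror xs)" "map side_of (map mirror xs) = map swap13 (map side_of xs)"
proof -
  have sys: "distinct xs" "0 \<notin> set xs" "1 \<notin> set xs" "odd (length xs)"
    "noncrossing (set (pairs (0 # xs)))" "noncrossing (set (pairs (map edge_flip xs @ [0])))"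
    using assms by (auto simp: chord_system_def)
  have x: "x \<noteq> 0 \<and> x \<noteq> 1" if "x \<in> set xs" for x using that sys by auto
  have "inj_on mirror (set xs)" using x mirror_inj by (intro inj_onI) metis
  moreover have "mirror x \<noteq> 0 \<and> mirror x \<noteq> 1" if "x \<in> set xs" for x
    using x[OF that] by (simp add: mirror_eqs)
  moreover have "noncrossing (set (pairs (0 # map mirror xs)))"
    using noncrossing_mirror[OF sys(5)] sys(3) by (simp add: mirror_eqs)
  moreover have "map edge_flip (map mirror xs) @ [0] = map mirror (map edge_flip xs @ [0])"
    using x by (simp add: edge_flip_mirror mirror_eqs)
  moreover have "1 \<notin> set (map edge_flip xs @ [0])"
    using x edge_flip_neq_1 by auto
  ultimately show "chord_system (map mirror xs)"
    using sys(1-4) noncrossing_mirror[OF sys(6)]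
    by (auto simp: chord_system_def distinct_map image_iff simp del: map_map)
  show "map side_of (map mirror xs) = map swap13 (map side_of xs)"
    using x by (simp add: side_of_mirror)
qed

text \<open>An endpoint may slide along the boundary as long as it passes no other endpoint;
  \<open>chord_system_peel\<close> slides one into the corner \<open>r = 1\<close>.\<close>

lemma noncrossing_move_endpoint:
  assumes nc: "noncrossing (insert (p, q) C)"
    and free: "\<And>c d. (c, d) \<in> C \<Longrightarrow> c \<noteq> p \<and> d \<noteq> p \<and> \<not> (p < c \<and> c \<le> r) \<and> \<not> (p < d \<and> d \<le> r)"
    and pr: "p < r"
  shows "noncrossing (insert (r, q) C)"
proof -
  have no: "\<not> cross (r, q) (c, d)" if "(c, d) \<in> C" for c d
  proof -
    have "\<not> cross (p, q) (c, d)" using nc that unfolding noncrossing_def by blast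
    moreover have "between c d p \<longleftrightarrow> between c d r" "beyond c d p \<longleftrightarrow> beyond c d r"
      using free[OF that] pr by (auto simp: between_def beyond_def)
    ultimately show ?thesis unfolding cross_iff by blast
  qed
  have refl: "\<not> cross (r, q) (r, q)" by (auto simp: cyc_def)
  show ?thesis
    unfolding noncrossing_def
  proof (intro ballI)
    fix s t assume "s \<in> insert (r, q) C" "t \<in> insert (r, q) C"
    then consider "s = (r, q)" "t = (r, q)" | "s = (r, q)" "t \<in> C" | "s \<in> C" "t = (r, q)"
      | "s \<in> C" "t \<in> C" by blast
    then show "\<not> cross s t"
    proof cases
      case 2
      then show ?thesis using no by (cases t) blast
    next
      case 3
      then show ?thesis using no cross_sym by (cases s) blast
    next
      case 4
      then show ?thesis using nc unfolding noncrossing_def by blast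
    qed (use refl in simp)
  qed
qed

lemma noncrossing_swap:
  assumes "noncrossing (insert (p, q) C)" shows "noncrossing (insert (q, p) C)"
proof -
  have 1: "cross (q, p) t \<longleftrightarrow> cross (p, q) t" for t by (cases t) auto
  have 2: "cross s (q, p) \<longleftrightarrow> cross s (p, q)" for s by (cases s) auto
  show ?thesis
    unfolding noncrossing_def ball_simps(7) 1 2
    using assms unfolding noncrossing_def ball_simps(7) .
qed

text \<open>A point between the vertex and \<open>v\<close> would belong to a chord below
  \<open>(0, v)\<close>, which would have both ends on \<open>T\<^sub>1\<close>.\<close>

lemma first_in_low:
  assumes nc: "noncrossing (set (pairs zs))" and dist: "distinct zs" and even: "even (length zs)"
    and side: "\<And>p q. chord zs p q \<Longrightarrow> p \<noteq> 0 \<Longrightarrow> q \<noteq> 0 \<Longrightarrow> side_of p \<noteq> side_of q"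
    and v: "chord zs 0 v" "0 < v" "v < 1" and z: "z \<in> set zs" "0 < z"
  shows "v \<le> z"
proof (rule ccontr)
  assume "\<not> v \<le> z"
  then have "z < v" by simp
  obtain z' where z': "chord zs z z'" using chord_exists[OF even z(1)] by blast
  have "0 < z'" "z' < v" using chord_nested[OF nc dist v(1) z' z(2) \<open>z < v\<close>] by auto
  then show False using side[OF z'] z(2) \<open>z < v\<close> v(3) by (auto simp: side_of_def)
qed

text \<open>If the first chord joins the vertex to \<open>T\<^sub>1\<close>, the curve starts by turning around the vertex;
  the vertex is moved to the next corner and the first and last crossings disappear.\<close>

lemma chord_system_peel:
  assumes sys: "chord_system (p # xs @ [q])" and adj: "distinct_adj (map side_of (p # xs @ [q]))"
    and ends: "side_of p = I1" "side_of q = I1"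
  shows "chord_system (map (corner_rotate \<circ> edge_flip) xs)"
    "map side_of (map (corner_rotate \<circ> edge_flip) xs) = map cycle123 (map side_of xs)"
proof -
  let ?xs = "p # xs @ [q]" and ?f = edge_flip
  have dist: "distinct ?xs" and no01: "0 \<notin> set ?xs" "1 \<notin> set ?xs" and odd: "odd (length ?xs)"
    and ev: "noncrossing (set (pairs (0 # ?xs)))" and od: "noncrossing (set (pairs (map ?f ?xs @ [0])))"
    using sys by (auto simp: chord_system_def)
  have distf: "distinct (map ?f ?xs @ [0])" using dist no01 by (rule distinct_edge_flip)
  have x: "x \<noteq> 0 \<and> x \<noteq> 1 \<and> ?f x \<noteq> 0 \<and> ?f x \<noteq> 1" if "x \<in> set xs" for x
    using that no01 edge_flip_eq_0_iff[of x] edge_flip_neq_1[of x] by auto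
  have p: "0 < p" "p < 1" and q: "0 < q" "q < 1"
    using ends no01 by (auto simp: side_of_eq_iff order_less_le)
  have fp: "?f p = 1 - p" and fq: "?f q = 1 - q" using p q by (simp_all add: edge_flip_def)
  have "chord (0 # ?xs) 0 p" by (simp add: chord_def)
  then have min_p: "p \<le> z" if "z \<in> set ?xs" "0 < z" for z
    using first_in_low[OF ev _ _ chord_system_side(1)[OF adj sys]] dist no01 odd p that by auto
  have "map ?f ?xs @ [0] = map ?f (p # xs) @ [?f q, 0]" by simp
  then have "chord (map ?f ?xs @ [0]) 0 (?f q)"
    using odd pairs_append[of "map ?f (p # xs)" "[?f q, 0]"] by (simp add: chord_def)
  then have min_q: "?f q \<le> z" if "z \<in> set (map ?f ?xs)" "0 < z" for z
    using first_in_low[OF od distf _ chord_system_side(2)[OF adj sys], of "?f q" z] odd q fq that by auto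
  \<comment> \<open>The flip reverses \<open>T\<^sub>1\<close>, so the crossing nearest to the
    vertex in one triangle is nearest to the corner 1 in the other.\<close>
  have max_q: "\<not> (q < z \<and> z \<le> 1)" if "z \<in> set xs" for z
  proof
    assume z: "q < z \<and> z \<le> 1"
    then have "z < 1" "0 < z" using x[OF that] q by (auto simp: order_less_le)
    then have "?f z = 1 - z" "0 < ?f z" by (simp_all add: edge_flip_def)
    moreover have "?f z \<in> set (map ?f ?xs)" using that by simp
    ultimately show False using min_q[of "?f z"] fq z by linarith
  qed
  have max_p: "\<not> (?f p < ?f z \<and> ?f z \<le> 1)" if "z \<in> set xs" for z
  proof
    assume z: "?f p < ?f z \<and> ?f z \<le> 1"
    then have fz: "?f z < 1" "0 < ?f z" using x[OF that] p fp by (auto simp: order_less_le)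
    then have "z = 1 - ?f z" using x[OF that] edge_flip_flip[of z] by (simp add: edge_flip_def[of "?f z"])
    moreover have "z \<in> set ?xs" using that by simp
    ultimately show False using min_p[of z] fp z fz by linarith
  qed
  have len: "odd (length xs)" using odd by simp
  have dfp: "?f p \<notin> ?f ` set xs" "q \<notin> set xs" using distf dist by auto
  \<comment> \<open>The chords in the second triangle become the even ones of the new system, and vice versa.\<close>
  have "noncrossing (set (pairs (1 # map ?f xs)))"
  proof -
    obtain y ys where xs: "xs = y # ys" using len by (cases xs) auto
    have 1: "set (pairs (?f p # map ?f xs)) = insert (?f p, ?f y) (set (pairs (map ?f ys)))"
      "set (pairs (1 # map ?f xs)) = insert (1, ?f y) (set (pairs (map ?f ys)))"
      using xs by auto
    have eq: "map ?f ?xs @ [0] = (?f p # map ?f xs) @ [?f q, 0]" by simp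
    have "set (pairs (?f p # map ?f xs)) \<subseteq> set (pairs (map ?f ?xs @ [0]))"
      unfolding eq using len pairs_append[of "?f p # map ?f xs" "[?f q, 0]"]
      by (simp add: subset_insertI)
    then have "noncrossing (insert (?f p, ?f y) (set (pairs (map ?f ys))))"
      using noncrossing_subset[OF od] unfolding 1 by blast
    then have "noncrossing (insert (1, ?f y) (set (pairs (map ?f ys))))"
    proof (rule noncrossing_move_endpoint)
      fix c d assume "(c, d) \<in> set (pairs (map ?f ys))"
      then have "c \<in> ?f ` set xs" "d \<in> ?f ` set xs" using pairs_set[of c d "map ?f ys"] xs by auto
      then show "c \<noteq> ?f p \<and> d \<noteq> ?f p \<and> \<not> (?f p < c \<and> c \<le> 1) \<and> \<not> (?f p < d \<and> d \<le> 1)"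
        using max_p dfp by blast
    qed (use fp p in simp)
    then show ?thesis unfolding 1 .
  qed
  moreover have "0 \<notin> set (1 # map ?f xs)" using x by auto
  ultimately have A: "noncrossing (set (pairs (map corner_rotate (1 # map ?f xs))))"
    by (rule noncrossing_corner_rotate)
  have "noncrossing (set (pairs (xs @ [1])))"
  proof -
    obtain ys y where xs: "xs = ys @ [y]" using len by (cases xs rule: rev_cases) auto
    have l: "even (length ys)" using len xs by simp
    have 1: "set (pairs (xs @ [q])) = insert (y, q) (set (pairs ys))"
      "set (pairs (xs @ [1])) = insert (y, 1) (set (pairs ys))"
      using xs l by (auto simp: pairs_append)
    have "set (pairs (xs @ [q])) \<subseteq> set (pairs (0 # ?xs))" by auto
    then have "noncrossing (insert (y, q) (set (pairs ys)))"
      using noncrossing_subset[OF ev] unfolding 1 by blast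
    then have "noncrossing (insert (q, y) (set (pairs ys)))" by (rule noncrossing_swap)
    then have "noncrossing (insert (1, y) (set (pairs ys)))"
    proof (rule noncrossing_move_endpoint)
      fix c d assume "(c, d) \<in> set (pairs ys)"
      then have "c \<in> set xs" "d \<in> set xs" using pairs_set[of c d ys] xs by auto
      then show "c \<noteq> q \<and> d \<noteq> q \<and> \<not> (q < c \<and> c \<le> 1) \<and> \<not> (q < d \<and> d \<le> 1)"
        using max_q dfp by blast
    qed (use q in simp)
    then show ?thesis unfolding 1 by (rule noncrossing_swap)
  qed
  moreover have "0 \<notin> set (xs @ [1])" using x by auto
  ultimately have B: "noncrossing (set (pairs (map corner_rotate (xs @ [1]))))"
    by (rule noncrossing_corner_rotate)
  have E1: "map ?f (map (corner_rotate \<circ> ?f) xs) @ [0] = map corner_rotate (xs @ [1])"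
    using x by (simp add: edge_flip_corner_rotate edge_flip_flip corner_rotate_eqs)
  have E2: "0 # map (corner_rotate \<circ> ?f) xs = map corner_rotate (1 # map ?f xs)"
    by (simp add: corner_rotate_eqs)
  have "inj_on (corner_rotate \<circ> ?f) (set xs)"
  proof (rule inj_onI)
    fix y z assume "y \<in> set xs" "z \<in> set xs" "(corner_rotate \<circ> ?f) y = (corner_rotate \<circ> ?f) z"
    then show "y = z" using x[of y] x[of z] corner_rotate_inj[of "?f y" "?f z"] edge_flip_inj[of y z] by simp
  qed
  then have D1: "distinct (map (corner_rotate \<circ> ?f) xs)" using dist by (simp add: distinct_map)
  have nz: "corner_rotate (?f z) \<noteq> 0 \<and> corner_rotate (?f z) \<noteq> 1" if "z \<in> set xs" for z
    using x[OF that] by (simp add: corner_rotate_eqs)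
  have D2: "0 \<notin> set (map (corner_rotate \<circ> ?f) xs)" "1 \<notin> set (map (corner_rotate \<circ> ?f) xs)"
    using nz by fastforce+
  show "chord_system (map (corner_rotate \<circ> ?f) xs)"
    unfolding chord_system_def E1 E2 by (intro conjI A B D1 D2) (use len in simp)
  show "map side_of (map (corner_rotate \<circ> ?f) xs) = map cycle123 (map side_of xs)"
    using x by (simp add: side_of_corner_rotate side_of_flip)
qed

subsection \<open>The element of a chord system\<close>

text \<open>The labels after peeling refer to the triple conjugated by \<open>x\<close>; the two
  outer factors \<open>x\<close> are the letters of the first and last crossing, which peeling
  removes.\<close>

lemma (in group) word_prod_cycle123:
  assumes "x \<in> involutions" "y \<in> involutions" "z \<in> involutions"
  shows "word_prod (x \<otimes> (y \<otimes> x)) (x \<otimes> (z \<otimes> x)) x (map cycle123 w) = x \<otimes> (word_prod x y z w \<otimes> x)"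
proof (induction w)
  case (Cons i w)
  then show ?case using assms by (cases i) (simp_all add: m_assoc)
qed (use assms in simp)

lemma distinct_adj_map_inj: "distinct_adj (map f xs) \<Longrightarrow> inj g \<Longrightarrow> distinct_adj (map g (map f xs))"
  by (induction xs rule: induct_list012) (auto dest: injD)

lemma inj_cycle123: "inj cycle123"
proof (rule injI)
  fix i j show "cycle123 i = cycle123 j \<Longrightarrow> i = j" by (cases i; cases j) auto
qed

lemma inj_swap13: "inj swap13"
proof (rule injI)
  fix i j show "swap13 i = swap13 j \<Longrightarrow> i = j" by (cases i; cases j) auto
qed

context coxeter_triples begin

text \<open>As the word is a palindrome, both ends lie on the same edge: on \<open>T\<^sub>2\<close>
  the system is straight, on \<open>T\<^sub>1\<close> it is peeled, on \<open>T\<^sub>3\<close> it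
  is mirrored first. All sector triples are covered at once because each peeling changes the
  triple.\<close>

lemma chord_system_reduced_word:
  assumes "chord_system xs" "distinct_adj (map side_of xs)" "rev (map side_of xs) = map side_of xs"
    "sector_triple R x y z"
  shows "word_prod x y z (map side_of xs) \<in> R"
  using assms
proof (induction "length xs" arbitrary: xs x y z rule: less_induct)
  case less
  note sys = less.prems(1) and adj = less.prems(2) and pal = less.prems(3)
  have ne: "xs \<noteq> []" and odd: "odd (length xs)" using sys by (auto simp: chord_system_def)
  have ends: "side_of (hd xs) = side_of (last xs)"
    using pal ne by (metis hd_rev last_map list.map_sel(1) map_is_Nil_conv)
  \<comment> \<open>The case of \<open>T\<^sub>1\<close>, for any system of the same length, so that
    it also serves the mirror image.\<close>
  have low: "word_prod x y z (map side_of ws) \<in> R"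
    if ws: "chord_system ws" "distinct_adj (map side_of ws)" "rev (map side_of ws) = map side_of ws"
      "side_of (hd ws) = I1" "side_of (last ws) = I1" and len: "length ws = length xs"
      and tri: "sector_triple R x y z" for ws x y z
  proof -
    have inv: "x \<in> involutions" "y \<in> involutions" "z \<in> involutions"
      using tri by (auto simp: sector_triple_def)
    obtain p ys where p: "ws = p # ys" using ne len by (cases ws) auto
    show ?thesis
    proof (cases ys rule: rev_cases)
      case Nil
      then show ?thesis using p ws sector_triple_slope_elt[OF tri, of 1 0] inv by simp
    next
      case (snoc us q)
      then have w: "ws = p # us @ [q]" using p by simp
      have e: "side_of p = I1" "side_of q = I1" using ws(4,5) unfolding w by simp_all
      have "distinct_adj (side_of p # map side_of us @ [side_of q])" using ws(2) unfolding w by simp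
      then have "distinct_adj (map side_of us @ [side_of q])" by (rule distinct_adj_ConsD)
      then have "distinct_adj (map side_of us)" unfolding distinct_adj_append_iff by blast
      then have "distinct_adj (map cycle123 (map side_of us))"
        using distinct_adj_map_inj inj_cycle123 by blast
      moreover have "rev (map side_of us) = map side_of us"
        using ws(3) unfolding w by (simp add: e)
      then have "rev (map cycle123 (map side_of us)) = map cycle123 (map side_of us)"
        by (simp only: rev_map)
      moreover have sys': "chord_system (map (corner_rotate \<circ> edge_flip) us)"
        "map side_of (map (corner_rotate \<circ> edge_flip) us) = map cycle123 (map side_of us)"
        using chord_system_peel ws(1,2) e unfolding w by blast+
      ultimately have "word_prod (x \<otimes> (y \<otimes> x)) (x \<otimes> (z \<otimes> x)) x (map cycle123 (map side_of us)) \<in> R"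
        using less.hyps[of "map (corner_rotate \<circ> edge_flip) us", OF _ sys'(1) _ _ sector_triple_turn[OF tri]]
          len w by (simp del: map_map)
      moreover have "word_prod x y z (map side_of ws) = x \<otimes> (word_prod x y z (map side_of us) \<otimes> x)"
        using inv e by (simp add: w word_prod_append)
      ultimately show ?thesis using inv by (simp only: word_prod_cycle123)
    qed
  qed
  show ?case
  proof (cases "side_of (hd xs)")
    case I1
    then show ?thesis using low[OF sys adj pal _ _ _ less.prems(4)] ends by simp
  next
    case I2
    define a b where "a = card {x \<in> set xs. side_of x = I3} + 1"
      and "b = card {x \<in> set xs. side_of x = I1} + 1"
    have "run a b b (map side_of (tl xs))"
      unfolding a_def b_def using chord_system_straight[OF sys adj I2] ends I2 by simp
    then have "word_prod x y z (I2 # map side_of (tl xs)) = slope_elt x y z a b"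
      using less.prems(4) by (intro run_slope_elt) (auto simp: sector_triple_def a_def b_def)
    moreover have "map side_of xs = I2 # map side_of (tl xs)" using ne I2 by (cases xs) auto
    ultimately show ?thesis using sector_triple_slope_elt[OF less.prems(4), of a b] by (simp add: a_def)
  next
    case I3
    have m: "chord_system (map mirror xs)" "map side_of (map mirror xs) = map swap13 (map side_of xs)"
      using chord_system_mirror[OF sys] by auto
    have "rev (map swap13 (map side_of xs)) = map swap13 (map side_of xs)"
      using pal by (metis rev_map)
    moreover have "distinct_adj (map swap13 (map side_of xs))"
      using adj distinct_adj_map_inj inj_swap13 by blast
    moreover have "side_of (hd (map mirror xs)) = I1 \<and> side_of (last (map mirror xs)) = I1"
    proof -
      have "hd (map side_of (map mirror xs)) = swap13 (side_of (hd xs))"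
        "last (map side_of (map mirror xs)) = swap13 (side_of (last xs))"
        unfolding m(2) using ne by (simp_all add: hd_map last_map)
      then show ?thesis using ne I3 ends by (simp add: hd_map last_map)
    qed
    ultimately have "word_prod z y x (map swap13 (map side_of xs)) \<in> R"
      using low[OF m(1) _ _ _ _ _ sector_triple_mirror[OF less.prems(4)]] unfolding m(2) by simp
    then show ?thesis unfolding word_prod_swap13 .
  qed
qed

end

section \<open>Free reduction of words\<close>

fun push :: "index \<Rightarrow> index list \<Rightarrow> index list" where
  "push i [] = [i]"
| "push i (j # w) = (if i = j then w else i # j # w)"

lemma push_push: "distinct_adj w \<Longrightarrow> push i (push i w) = w"
  by (cases w rule: remdups_adj.cases) auto

lemma distinct_adj_push: "distinct_adj w \<Longrightarrow> distinct_adj (push i w)"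
  by (cases w rule: remdups_adj.cases) auto

lemma distinct_adj_foldr_push: "distinct_adj (foldr push w [])"
  by (induction w) (auto intro: distinct_adj_push)

lemma foldr_push_distinct_adj: "distinct_adj w \<Longrightarrow> foldr push w [] = w"
  by (induction w rule: induct_list012) auto

lemma reduces_foldr_push: "reduces w w' \<Longrightarrow> foldr push w [] = foldr push w' []"
  by (induction rule: reduces.induct) (simp_all add: push_push distinct_adj_foldr_push)

lemma reduces_rev: "reduces w w' \<Longrightarrow> reduces (rev w) (rev w')"
proof (induction rule: reduces.induct)
  case (cancel u v w i)
  then show ?case using reduces.cancel[of "rev v" "rev u" "rev w" i] by simp
qed (rule reduces.refl)

text \<open>\<open>push\<close> is left multiplication on normal forms in the free product of three
  groups of order two, so the reduced form is unique; reversing the reduction of a palindrome yields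
  a second reduced form, the reversed one.\<close>

lemma reduces_palindrome:
  fixes w w' :: "index list"
  assumes "reduces w w'" "distinct_adj w'" "rev w = w"
  shows "rev w' = w'"
proof -
  have "foldr push w [] = w'" using reduces_foldr_push[OF assms(1)] foldr_push_distinct_adj[OF assms(2)] by simp
  moreover have "foldr push w [] = rev w'"
    using reduces_foldr_push[OF reduces_rev[OF assms(1)]] foldr_push_distinct_adj[of "rev w'"] assms(2,3) by simp
  ultimately show ?thesis by simp
qed

lemma (in group) reduces_word_prod:
  assumes "reduces w w'" "x \<in> involutions" "y \<in> involutions" "z \<in> involutions"
  shows "word_prod x y z w = word_prod x y z w'"
  using assms(1)
proof induction
  case (cancel u v w i)
  have "letter x y z i \<in> involutions" using assms by simp
  then show ?case using cancel assms(2-) by (simp add: word_prod_append)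
qed simp

theorem (in coxeter_triples) chord_system_word:
  assumes "chord_system xs" "rev (map side_of xs) = map side_of xs" "sector_triple R x y z"
  shows "word_prod x y z (map side_of xs) \<in> R"
proof -
  obtain ys where ys: "chord_system ys" "distinct_adj (map side_of ys)"
    "reduces (map side_of xs) (map side_of ys)"
    using chord_system_reduce assms(1) by blast
  have "word_prod x y z (map side_of ys) \<in> R"
    using ys reduces_palindrome[OF ys(3,2) assms(2)] assms(3) by (intro chord_system_reduced_word)
  then show ?thesis using reduces_word_prod[OF ys(3)] assms(3) by (simp add: sector_triple_def)
qed

section \<open>From curves to chord systems\<close>

subsection \<open>Lifting curves to the plane\<close>

lemma torus_proj_eq_iff: "torus_proj p = torus_proj q \<longleftrightarrow> fst p - fst q \<in> \<int> \<and> snd p - snd q \<in> \<int>"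
  by (simp add: torus.abs_eq_iff lattice_equiv_def)

lemma torus_proj_surj: obtains p where "q = torus_proj p"
  by (metis Quotient_torus Quotient_abs_rep)

lemma cis_eq_iff: "cis (2 * pi * x) = cis (2 * pi * y) \<longleftrightarrow> x - y \<in> \<int>"
proof -
  have "cis (2 * pi * x) = cis (2 * pi * y) \<longleftrightarrow> (\<exists>n::int. 2 * pi * x = 2 * pi * y + 2 * pi * n)"
    using sin_cos_eq_iff[of "2 * pi * x" "2 * pi * y"] by (auto simp: complex_eq_iff)
  also have "\<dots> \<longleftrightarrow> (\<exists>n::int. x - y = n)"
  proof -
    have "2 * pi * x = 2 * pi * y + 2 * pi * r \<longleftrightarrow> 2 * pi * (x - y) = 2 * pi * r" for r
      unfolding right_diff_distrib by linarith
    then show ?thesis by simp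
  qed
  finally show ?thesis by (auto simp: Ints_def)
qed

lift_definition circle1 :: "torus \<Rightarrow> complex" is "\<lambda>p. cis (2 * pi * fst p)"
  by (simp add: lattice_equiv_def cis_eq_iff)

lift_definition circle2 :: "torus \<Rightarrow> complex" is "\<lambda>p. cis (2 * pi * snd p)"
  by (simp add: lattice_equiv_def cis_eq_iff)

lemma continuous_on_torus:
  fixes f :: "torus \<Rightarrow> 'a::topological_space"
  assumes "continuous_on UNIV (\<lambda>p. f (torus_proj p))"
  shows "continuous_on UNIV f"
  unfolding continuous_on_open_vimage[OF open_UNIV]
proof (intro allI impI)
  fix B :: "'a set" assume "open B"
  then have "open ((\<lambda>p. f (torus_proj p)) -` B)"
    using assms unfolding continuous_on_open_vimage[OF open_UNIV] by simp
  then show "open (f -` B \<inter> UNIV)"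
    by (simp add: open_torus_def vimage_def)
qed

lemma continuous_on_torus_proj: "continuous_on UNIV torus_proj"
  unfolding continuous_on_open_vimage[OF open_UNIV] by (simp add: open_torus_def)

lemma circle_lift:
  fixes c :: "real \<Rightarrow> complex"
  assumes "continuous_on {0..1} c" "\<And>t. t \<in> {0..1} \<Longrightarrow> norm (c t) = 1"
  obtains g where "continuous_on {0..1} g" "\<And>t. t \<in> {0..1} \<Longrightarrow> c t = cis (2 * pi * g t)"
proof -
  have "c t \<noteq> 0" if "t \<in> {0..1}" for t using assms(2)[OF that] by auto
  then obtain h where h: "continuous_on {0..1} h" "\<And>t. t \<in> {0..1} \<Longrightarrow> c t = exp (h t)"
    using continuous_logarithm_on_contractible[OF assms(1)] convex_imp_contractible[of "{0..1::real}"]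
    by (metis convex_real_interval(5))
  show thesis
  proof
    show "continuous_on {0..1} (\<lambda>t. Im (h t) / (2 * pi))" by (intro continuous_intros h(1)) simp
    fix t :: real assume t: "t \<in> {0..1}"
    then have "exp (Re (h t)) = 1" using h(2)[OF t] assms(2)[OF t] by simp
    then show "c t = cis (2 * pi * (Im (h t) / (2 * pi)))"
      using h(2)[OF t] exp_eq_polar[of "h t"] by simp
  qed
qed

text \<open>Each coordinate is sent to the unit circle and recovered from a continuous logarithm
  along the interval.\<close>

lemma torus_path_lift:
  assumes "path \<eta>"
  obtains \<gamma> :: "real \<Rightarrow> real \<times> real"
  where "continuous_on {0..1} \<gamma>" "\<And>t. t \<in> {0..1} \<Longrightarrow> torus_proj (\<gamma> t) = \<eta> t"
proof -
  have cont: "continuous_on UNIV circle1" "continuous_on UNIV circle2"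
    by (intro continuous_on_torus; simp add: circle1.abs_eq circle2.abs_eq cis_conv_exp continuous_intros)+
  have norm: "norm (circle1 q) = 1" "norm (circle2 q) = 1" for q
    by (transfer; simp)+
  have "continuous_on {0..1} (\<lambda>t. circle1 (\<eta> t))" "continuous_on {0..1} (\<lambda>t. circle2 (\<eta> t))"
    using assms cont unfolding path_def by (auto intro: continuous_on_compose2)
  then obtain g h where g: "continuous_on {0..1} g" "\<And>t. t \<in> {0..1} \<Longrightarrow> circle1 (\<eta> t) = cis (2 * pi * g t)"
    and h: "continuous_on {0..1} h" "\<And>t. t \<in> {0..1} \<Longrightarrow> circle2 (\<eta> t) = cis (2 * pi * h t)"
    using circle_lift norm by metis
  show thesis
  proof
    show "continuous_on {0..1} (\<lambda>t. (g t, h t))" by (intro continuous_intros g h)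
    fix t :: real assume t: "t \<in> {0..1}"
    obtain p where p: "\<eta> t = torus_proj p" using torus_proj_surj by blast
    then have "cis (2 * pi * g t) = cis (2 * pi * fst p)" "cis (2 * pi * h t) = cis (2 * pi * snd p)"
      using g(2)[OF t] h(2)[OF t] by (simp_all add: circle1.abs_eq circle2.abs_eq)
    then show "torus_proj (g t, h t) = \<eta> t"
      unfolding p torus_proj_eq_iff cis_eq_iff by simp
  qed
qed

lemma level_simps: "level I1 p = snd p" "level I2 p = fst p + snd p" "level I3 p = fst p"
  by (cases p; simp)+

lemma level_add: "level i (p + q) = level i p + level i q" "level i (p - q) = level i p - level i q"
  by (cases i; simp add: level_simps)+

lemma level_diff_Ints:
  assumes "torus_proj p = torus_proj q" shows "level i p - level i q \<in> \<int>"
proof -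
  have "fst p - fst q \<in> \<int>" "snd p - snd q \<in> \<int>" using assms by (auto simp: torus_proj_eq_iff)
  moreover from this have "(fst p - fst q) + (snd p - snd q) \<in> \<int>" by (rule Ints_add)
  ultimately show ?thesis by (cases i) (simp_all add: level_simps algebra_simps)
qed

lemma torus_proj_in_edge: "torus_proj p \<in> edge i \<longleftrightarrow> level i p \<in> \<int>"
proof
  assume "torus_proj p \<in> edge i"
  then obtain q where "level i q \<in> \<int>" "torus_proj p = torus_proj q" by (auto simp: edge_def)
  then have "level i q + (level i p - level i q) \<in> \<int>"
    using level_diff_Ints[of p q i] by (intro Ints_add) simp_all
  then show "level i p \<in> \<int>" by simp
qed (auto simp: edge_def)

lemma torus_proj_eq_vertex: "torus_proj p = vertex \<longleftrightarrow> fst p \<in> \<int> \<and> snd p \<in> \<int>"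
  by (simp add: vertex_def torus_proj_eq_iff)

lemma Ints_add_left_iff: "(a::real) \<in> \<int> \<Longrightarrow> a + b \<in> \<int> \<longleftrightarrow> b \<in> \<int>"
  using Ints_add Ints_diff by (metis add_diff_cancel_left')

lemma two_levels_vertex:
  assumes "level i p \<in> \<int>" "level j p \<in> \<int>" "i \<noteq> j" shows "torus_proj p = vertex"
  using assms unfolding torus_proj_eq_vertex
  by (cases i; cases j) (auto simp: level_simps Ints_add_left_iff add.commute[of _ "snd p"])

lemma continuous_on_level: "continuous_on S \<gamma> \<Longrightarrow> continuous_on S (\<lambda>t. level i (\<gamma> t))"
  by (cases i) (auto simp: level_simps intro!: continuous_intros)

lemma continuous_Ints_constant:
  fixes f :: "real \<Rightarrow> real"
  assumes "continuous_on S f" "connected S" "\<And>x. x \<in> S \<Longrightarrow> f x \<in> \<int>"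
  shows "\<exists>c. \<forall>x\<in>S. f x = c"
proof -
  have "f constant_on S"
  proof (rule continuous_discrete_range_constant[OF assms(2,1)])
    fix x assume x: "x \<in> S"
    have "1 \<le> norm (f y - f x)" if "y \<in> S" "f y \<noteq> f x" for y
    proof -
      have "f y - f x \<in> \<int>" using assms(3) x that by auto
      then show ?thesis using that(2) Ints_nonzero_abs_ge1 by force
    qed
    then show "\<exists>e>0. \<forall>y. y \<in> S \<and> f y \<noteq> f x \<longrightarrow> e \<le> norm (f y - f x)"
      by (intro exI[of _ 1]) auto
  qed
  then show ?thesis by (auto simp: constant_on_def)
qed

lemma continuous_floor_constant:
  fixes f :: "real \<Rightarrow> real"
  assumes "continuous_on S f" "connected S" "\<And>x. x \<in> S \<Longrightarrow> f x \<notin> \<int>" "x \<in> S" "y \<in> S"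
  shows "\<lfloor>f x\<rfloor> = \<lfloor>f y\<rfloor>"
proof -
  have "\<lfloor>f x\<rfloor> \<le> \<lfloor>f y\<rfloor>" if "x \<in> S" "y \<in> S" for x y
  proof (rule ccontr)
    assume "\<not> \<lfloor>f x\<rfloor> \<le> \<lfloor>f y\<rfloor>"
    then have "f y \<le> of_int \<lfloor>f x\<rfloor>" "of_int \<lfloor>f x\<rfloor> \<le> f x" by linarith+
    then have "of_int \<lfloor>f x\<rfloor> \<in> f ` S"
      using connected_continuous_image[OF assms(1,2)] that unfolding connected_iff_interval by blast
    then obtain z where "z \<in> S" "f z = of_int \<lfloor>f x\<rfloor>" by auto
    then show False using assms(3)[of z] by (metis Ints_of_int)
  qed
  then show ?thesis using assms(4,5) by (simp add: antisym)
qed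

subsection \<open>Arcs in a triangle\<close>

text \<open>The strict bound removes the corner (0,1) opposite to \<open>T\<^sub>1\<close>, at which
  the boundary is cut open.\<close>

definition triangle :: "(real \<times> real) set" where
  "triangle = {(u, v). 0 \<le> u \<and> 0 \<le> v \<and> u + v \<le> 1 \<and> v < 1}"

text \<open>The projective map sending the vertex \<open>(0, 1)\<close> to infinity takes the triangle to a half
  strip, which \<open>(U, V) \<mapsto> (U + (2 U - 1) V, V U (1 - U))\<close> opens up to a half plane.\<close>

definition unfold_x :: "real \<times> real \<Rightarrow> real" where
  "unfold_x = (\<lambda>(u, v). let U = u / (1 - v); V = v / (1 - v) in U + (2 * U - 1) * V)"

definition unfold_y :: "real \<times> real \<Rightarrow> real" where
  "unfold_y = (\<lambda>(u, v). let U = u / (1 - v); V = v / (1 - v) in V * (U * (1 - U)))"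

definition unfold :: "real \<times> real \<Rightarrow> real ^ 2" where
  "unfold p = (\<chi> i. if i = 1 then unfold_x p else unfold_y p)"

text \<open>On a curve \<open>V U (1 - U) = Z\<close> with \<open>0 < U < 1\<close> the first
  coordinate is \<open>U + Z (1 / (1 - U) - 1 / U)\<close>, strictly increasing in \<open>U\<close>.
  The vertical sides \<open>U = 0\<close> and \<open>U = 1\<close> are compared separately.\<close>

lemma half_strip_inj:
  fixes U V U' V' :: real
  assumes "0 \<le> U" "U \<le> 1" "0 \<le> V" "0 \<le> U'" "U' \<le> 1" "0 \<le> V'"
    and X: "U + (2 * U - 1) * V = U' + (2 * U' - 1) * V'" and Y: "V * (U * (1 - U)) = V' * (U' * (1 - U'))"
  shows "U = U' \<and> V = V'"
proof -
  have not_less: "\<not> U < U'"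
    if h: "0 \<le> U" "U \<le> 1" "0 \<le> V" "0 \<le> U'" "U' \<le> 1" "0 \<le> V'"
      "U + (2 * U - 1) * V = U' + (2 * U' - 1) * V'" "V * (U * (1 - U)) = V' * (U' * (1 - U'))"
    for U V U' V' :: real
  proof
    assume lt: "U < U'"
    consider "U = 0" | "U' = 1" | "0 < U" "U' < 1" using h(1,5) by linarith
    then show False
    proof cases
      case 1
      then have "V' = 0 \<or> U' = 1" using h lt by auto
      then show False using 1 h lt by (auto simp: algebra_simps)
    next
      case 2
      then have "V = 0 \<or> U = 0" using h lt by auto
      then show False using 2 h lt by (auto simp: algebra_simps)
    next
      case 3
      define Z where "Z = V * (U * (1 - U))"
      have V: "V = Z / (U * (1 - U))" "V' = Z / (U' * (1 - U'))"
        using 3 lt h(8) unfolding Z_def by (auto simp: field_simps)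
      have Z: "Z \<ge> 0" using h by (simp add: Z_def)
      have "(2 * W - 1) * (Z / (W * (1 - W))) = Z * (1 / (1 - W) - 1 / W)" if "0 < W" "W < 1" for W
        using that by (simp add: field_simps)
      then have "(2 * U - 1) * V = Z * (1 / (1 - U) - 1 / U)" "(2 * U' - 1) * V' = Z * (1 / (1 - U') - 1 / U')"
        unfolding V using 3 lt by simp_all
      moreover have "1 / (1 - U) - 1 / U \<le> 1 / (1 - U') - 1 / U'"
        using 3 lt by (intro diff_mono divide_left_mono) auto
      then have "Z * (1 / (1 - U) - 1 / U) \<le> Z * (1 / (1 - U') - 1 / U')"
        using Z by (rule mult_left_mono)
      ultimately show False using h(7) lt by linarith
    qed
  qed
  have "U = U'" using not_less[OF assms] not_less[OF assms(4-6,1-3) X[symmetric] Y[symmetric]] by simp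
  moreover have "V = V'"
  proof (cases "U = 0 \<or> U = 1")
    case True
    then show ?thesis using X \<open>U = U'\<close> by auto
  next
    case False
    then show ?thesis using Y \<open>U = U'\<close> by auto
  qed
  ultimately show ?thesis by simp
qed

lemma unfold_inj:
  assumes "p \<in> triangle" "q \<in> triangle" "unfold p = unfold q"
  shows "p = q"
proof -
  obtain u v u' v' where pq: "p = (u, v)" "q = (u', v')" by fastforce
  have t: "0 \<le> u" "0 \<le> v" "u + v \<le> 1" "v < 1" "0 \<le> u'" "0 \<le> v'" "u' + v' \<le> 1" "v' < 1"
    using assms pq by (auto simp: triangle_def)
  have eq: "unfold_x p = unfold_x q" "unfold_y p = unfold_y q"
    using assms(3) unfolding unfold_def vec_eq_iff forall_2 by simp_all
  have "u / (1 - v) = u' / (1 - v') \<and> v / (1 - v) = v' / (1 - v')"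
    using t eq unfolding pq unfold_x_def unfold_y_def Let_def prod.case
    by (intro half_strip_inj) auto
  moreover from this have "v = v'" using t by (simp add: field_simps)
  ultimately show ?thesis using t pq by simp
qed

lemma unfold_y_nonneg: "p \<in> triangle \<Longrightarrow> 0 \<le> unfold_y p"
  by (auto simp: triangle_def unfold_y_def Let_def intro!: mult_nonneg_nonneg)

lemma continuous_on_unfold:
  assumes "continuous_on S f" "f ` S \<subseteq> triangle"
  shows "continuous_on S (\<lambda>s. unfold (f s))"
proof -
  have "1 - snd (f s) \<noteq> 0" if "s \<in> S" for s using assms(2) that by (force simp: triangle_def)
  then have "continuous_on S (\<lambda>s. unfold_x (f s))" "continuous_on S (\<lambda>s. unfold_y (f s))"
    unfolding unfold_x_def unfold_y_def Let_def split_def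
    by (auto intro!: continuous_intros assms(1))
  then have "continuous_on S (\<lambda>s. if i = 1 then unfold_x (f s) else unfold_y (f s))" for i :: 2
    by (cases "i = 1") simp_all
  then show ?thesis
    unfolding unfold_def by (rule continuous_on_vec_lambda)
qed

lemma cross_cases:
  assumes "cross (a, b) (c, d)"
  shows "min a b < min c d \<and> min c d < max a b \<and> max a b < max c d \<or>
         min c d < min a b \<and> min a b < max c d \<and> max c d < max a b"
  using assms unfolding cross_iff between_def beyond_def by (auto simp: min_def max_def)

text \<open>Interlacing endpoints on the bottom of a box that contains both paths force them to
  meet, by \<open>fashoda_interlace\<close>. Reversal orients both paths to the right, and
  exchanging the paths covers the other interlacing order.\<close>

lemma half_plane_noncrossing:
  fixes f g :: "real \<Rightarrow> real ^ 2"
  assumes f: "path f" "\<And>z. z \<in> path_image f \<Longrightarrow> 0 \<le> z $ 2" "pathstart f $ 2 = 0" "pathfinish f $ 2 = 0"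
    and g: "path g" "\<And>z. z \<in> path_image g \<Longrightarrow> 0 \<le> z $ 2" "pathstart g $ 2 = 0" "pathfinish g $ 2 = 0"
    and disj: "path_image f \<inter> path_image g = {}"
  shows "\<not> cross (pathstart f $ 1, pathfinish f $ 1) (pathstart g $ 1, pathfinish g $ 1)"
proof
  assume c: "cross (pathstart f $ 1, pathfinish f $ 1) (pathstart g $ 1, pathfinish g $ 1)"
  have main: False
    if f: "path f" "\<And>z. z \<in> path_image f \<Longrightarrow> 0 \<le> z $ 2" "pathstart f $ 2 = 0" "pathfinish f $ 2 = 0"
    and g: "path g" "\<And>z. z \<in> path_image g \<Longrightarrow> 0 \<le> z $ 2" "pathstart g $ 2 = 0" "pathfinish g $ 2 = 0"
    and disj: "path_image f \<inter> path_image g = {}"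
    and lt: "pathstart f $ 1 < pathstart g $ 1" "pathstart g $ 1 < pathfinish f $ 1"
      "pathfinish f $ 1 < pathfinish g $ 1" for f g :: "real \<Rightarrow> real ^ 2"
  proof -
    have "bounded (path_image f \<union> path_image g)" using f g by (simp add: bounded_path_image)
    then obtain R where R: "\<And>z. z \<in> path_image f \<union> path_image g \<Longrightarrow> norm z \<le> R"
      unfolding bounded_iff by blast
    define a b :: "real ^ 2" where "a = vector [- R, 0]" and "b = vector [R, R]"
    have box: "z \<in> cbox a b" if "z \<in> path_image f \<union> path_image g" for z
      using R[OF that] component_le_norm_cart[of z 1] component_le_norm_cart[of z 2] that f(2) g(2)
      unfolding mem_box_cart a_def b_def by (auto simp: forall_2 vector_2)
    show False
      by (rule fashoda_interlace[of f g a b])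
        (use f g lt box disj in \<open>auto simp: a_def vector_2\<close>)
  qed
  define f' where "f' = (if pathstart f $ 1 \<le> pathfinish f $ 1 then f else reversepath f)"
  define g' where "g' = (if pathstart g $ 1 \<le> pathfinish g $ 1 then g else reversepath g)"
  have f': "path f'" "path_image f' = path_image f" "pathstart f' $ 2 = 0" "pathfinish f' $ 2 = 0"
    "pathstart f' $ 1 = min (pathstart f $ 1) (pathfinish f $ 1)"
    "pathfinish f' $ 1 = max (pathstart f $ 1) (pathfinish f $ 1)"
    using f by (auto simp: f'_def)
  have g': "path g'" "path_image g' = path_image g" "pathstart g' $ 2 = 0" "pathfinish g' $ 2 = 0"
    "pathstart g' $ 1 = min (pathstart g $ 1) (pathfinish g $ 1)"
    "pathfinish g' $ 1 = max (pathstart g $ 1) (pathfinish g $ 1)"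
    using g by (auto simp: g'_def)
  have nn: "\<And>z. z \<in> path_image f' \<Longrightarrow> 0 \<le> z $ 2" "\<And>z. z \<in> path_image g' \<Longrightarrow> 0 \<le> z $ 2"
    using f(2) g(2) unfolding f'(2) g'(2) by blast+
  have disj': "path_image f' \<inter> path_image g' = {}" "path_image g' \<inter> path_image f' = {}"
    using disj unfolding f'(2) g'(2) by blast+
  show False
    using cross_cases[OF c] main[OF f'(1) nn(1) f'(3,4) g'(1) nn(2) g'(3,4) disj'(1)]
      main[OF g'(1) nn(2) g'(3,4) f'(1) nn(1) f'(3,4) disj'(2)]
    unfolding f'(5,6) g'(5,6) by blast
qed

lemma triangle_noncrossing:
  fixes f g :: "real \<Rightarrow> real \<times> real"
  assumes "continuous_on {0..1} f" "continuous_on {0..1} g"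
    and "f ` {0..1} \<subseteq> triangle" "g ` {0..1} \<subseteq> triangle" "f ` {0..1} \<inter> g ` {0..1} = {}"
    and "unfold_y (f 0) = 0" "unfold_y (f 1) = 0" "unfold_y (g 0) = 0" "unfold_y (g 1) = 0"
  shows "\<not> cross (unfold_x (f 0), unfold_x (f 1)) (unfold_x (g 0), unfold_x (g 1))"
proof -
  define F G where "F = (\<lambda>s. unfold (f s))" and "G = (\<lambda>s. unfold (g s))"
  have comp: "unfold p $ 1 = unfold_x p" "unfold p $ 2 = unfold_y p" for p
    by (simp_all add: unfold_def)
  have "path F" "path G"
    unfolding path_def F_def G_def using assms(1-4) by (auto intro: continuous_on_unfold)
  moreover have "0 \<le> z $ 2" if "z \<in> path_image F \<union> path_image G" for z
    using that assms(3,4) by (auto simp: path_image_def F_def G_def comp intro!: unfold_y_nonneg)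
  moreover have "path_image F \<inter> path_image G = {}"
  proof (rule ccontr)
    assume "path_image F \<inter> path_image G \<noteq> {}"
    then obtain z where "z \<in> F ` {0..1}" "z \<in> G ` {0..1}" unfolding path_image_def by blast
    then obtain s t where st: "s \<in> {0..1}" "t \<in> {0..1}" "unfold (f s) = unfold (g t)"
      unfolding F_def G_def by (metis imageE)
    then have "f s = g t" using assms(3,4) by (intro unfold_inj) auto
    then show False using assms(5) st by blast
  qed
  ultimately have "\<not> cross (pathstart F $ 1, pathfinish F $ 1) (pathstart G $ 1, pathfinish G $ 1)"
    using assms(6-9) by (intro half_plane_noncrossing) (auto simp: pathstart_def pathfinish_def F_def G_def comp)
  then show ?thesis by (simp add: pathstart_def pathfinish_def F_def G_def comp)
qed

text \<open>On the boundary of the triangle this is \<open>unfold_x\<close>; off the edges the value is junk.\<close>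

definition edge_pos :: "real \<times> real \<Rightarrow> real" where
  "edge_pos = (\<lambda>(x, y). if y \<in> \<int> then frac x
     else if x \<in> \<int> then - frac y / (1 - frac y) else 1 / (1 - frac y))"

lemma frac_minus: "x \<notin> \<int> \<Longrightarrow> frac (of_int n - x) = 1 - frac x" for x :: real
proof -
  assume "x \<notin> \<int>"
  then have "of_int \<lfloor>x\<rfloor> < x" by (metis Ints_of_int of_int_floor_le order_le_less)
  then have "\<lfloor>of_int n - x\<rfloor> = n - \<lfloor>x\<rfloor> - 1" by (intro floor_unique) (simp_all, linarith+)
  then show ?thesis by (simp add: frac_def)
qed

lemma edge_pos_shift: "edge_pos (x - of_int m, y - of_int n) = edge_pos (x, y)"
proof -
  have "frac (x - of_int m) = frac x" "frac (y - of_int n) = frac y" by (simp_all add: frac_def)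
  moreover have "x - of_int m \<in> \<int> \<longleftrightarrow> x \<in> \<int>" "y - of_int n \<in> \<int> \<longleftrightarrow> y \<in> \<int>"
    by (metis Ints_add Ints_diff Ints_of_int diff_add_cancel)+
  ultimately show ?thesis by (simp add: edge_pos_def)
qed

lemma edge_pos_side:
  assumes "level i (x, y) \<in> \<int>" "torus_proj (x, y) \<noteq> vertex"
  shows "side_of (edge_pos (x, y)) = i \<and> edge_pos (x, y) \<notin> {0, 1}"
proof -
  have other: "level j (x, y) \<notin> \<int>" if "j \<noteq> i" for j
    using two_levels_vertex assms that by blast
  have f: "\<not> frac x < 0" "frac x < 1" "\<not> frac y < 0" "frac y < 1" by (auto simp: frac_lt_1 not_less)
  show ?thesis
  proof (cases i)
    case I1
    then have "frac x \<noteq> 0" using other[of I3] by (simp add: frac_eq_0_iff)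
    then show ?thesis using I1 assms f by (auto simp: edge_pos_def side_of_def)
  next
    case I2
    then have "y \<notin> \<int>" "x \<notin> \<int>" "frac y > 0" using other[of I3] other[of I1] by (auto simp: frac_gt_0_iff)
    then show ?thesis using I2 f by (auto simp: edge_pos_def side_of_def field_simps)
  next
    case I3
    then have "y \<notin> \<int>" "x \<in> \<int>" "frac y > 0" using other[of I1] assms by (auto simp: frac_gt_0_iff)
    then show ?thesis using I3 f by (auto simp: edge_pos_def side_of_def field_simps)
  qed
qed

lemma edge_pos_flip:
  assumes "level i (x, y) \<in> \<int>" "torus_proj (x, y) \<noteq> vertex"
  shows "edge_pos (of_int m - x, of_int n - y) = edge_flip (edge_pos (x, y))"
proof -
  have other: "level j (x, y) \<notin> \<int>" if "j \<noteq> i" for j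
    using two_levels_vertex assms that by blast
  have Z: "of_int m - x \<in> \<int> \<longleftrightarrow> x \<in> \<int>" "of_int n - y \<in> \<int> \<longleftrightarrow> y \<in> \<int>"
    by (metis Ints_diff Ints_of_int diff_diff_eq2 add_diff_cancel_left')+
  have f: "\<not> frac x < 0" "frac x < 1" "\<not> frac y < 0" "frac y < 1" by (auto simp: frac_lt_1 not_less)
  show ?thesis
  proof (cases i)
    case I1
    then have x: "y \<in> \<int>" "x \<notin> \<int>" "frac x > 0" using other[of I3] assms by (auto simp: frac_gt_0_iff)
    then show ?thesis using f frac_minus[OF x(2)] Z by (simp add: edge_pos_def edge_flip_def)
  next
    case I2
    then have x: "y \<notin> \<int>" "x \<notin> \<int>" "frac y > 0" using other[of I3] other[of I1] by (auto simp: frac_gt_0_iff)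
    then show ?thesis using f frac_minus[OF x(1)] Z by (simp add: edge_pos_def edge_flip_def field_simps)
  next
    case I3
    then have x: "y \<notin> \<int>" "x \<in> \<int>" "frac y > 0" using other[of I1] assms by (auto simp: frac_gt_0_iff)
    have w: "frac (of_int n - y) = 1 - frac y" by (rule frac_minus[OF x(1)])
    have "edge_pos (of_int m - x, of_int n - y) = - ((1 - frac y) / frac y)"
      using x Z w by (simp add: edge_pos_def minus_divide_left)
    moreover have "edge_pos (x, y) = - (frac y / (1 - frac y))" using x by (simp add: edge_pos_def)
    moreover have "frac y / (1 - frac y) > 0" using x f by simp
    ultimately show ?thesis by (simp add: edge_flip_def)
  qed
qed

lemma unfold_edge:
  assumes "level i p \<in> \<int>" "torus_proj p \<noteq> vertex" "p \<in> triangle"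
  shows "unfold_x p = edge_pos p \<and> unfold_y p = 0"
proof -
  obtain u v where p: "p = (u, v)" by fastforce
  have t: "0 \<le> u" "0 \<le> v" "u + v \<le> 1" "v < 1" using assms(3) p by (auto simp: triangle_def)
  have other: "level j (u, v) \<notin> \<int>" if "j \<noteq> i" for j
    using two_levels_vertex assms that p by blast
  have small: "w = 0" if "w \<in> \<int>" "0 \<le> w" "w < 1" for w :: real
    using that by (metis Ints_cases floor_of_int floor_eq_iff of_int_0 add_0 frac_eq_0_iff frac_eq)
  show ?thesis
  proof (cases i)
    case I1
    then have "v = 0" using assms(1) t p small by simp
    moreover have "frac u = u" using t other[of I3] I1 \<open>v = 0\<close>
      by (intro frac_eq[THEN iffD2]) (auto simp: order_less_le)
    ultimately show ?thesis using p by (simp add: unfold_x_def unfold_y_def edge_pos_def)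
  next
    case I2
    have "v \<notin> \<int>" using other[of I1] I2 by simp
    then have "v \<noteq> 0" by (metis Ints_0)
    then have "u + v \<noteq> 0" using t by linarith
    then have uv: "u + v = 1" using assms(1) t p I2 small[of "u + v"] by fastforce
    moreover have "frac v = v" using t by (intro frac_eq[THEN iffD2]) auto
    moreover have u: "u = 1 - v" using uv by simp
    moreover have "1 + v / (1 - v) = 1 / (1 - v)" "1 - v \<noteq> 0" using t by (simp_all add: field_simps)
    moreover have "v \<notin> \<int>" "1 - v \<notin> \<int>" using other[of I1] other[of I3] I2 u by simp_all
    ultimately show ?thesis unfolding p u unfold_x_def unfold_y_def edge_pos_def prod.case Let_def
      by (simp only: divide_self if_False) simp
  next
    case I3
    have "v \<notin> \<int>" using other[of I1] I3 by simp
    then have "v \<noteq> 0" by (metis Ints_0)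
    then have "u < 1" using t by linarith
    then have "u = 0" using assms(1) I3 t p small[of u] by simp
    moreover have "frac v = v" using t by (intro frac_eq[THEN iffD2]) auto
    ultimately show ?thesis using p t other[of I1] I3
      by (auto simp: unfold_x_def unfold_y_def edge_pos_def)
  qed
qed

lemma edge_pos_inj:
  assumes "level i p \<in> \<int>" "level j q \<in> \<int>" "torus_proj p \<noteq> vertex" "torus_proj q \<noteq> vertex"
    "edge_pos p = edge_pos q"
  shows "torus_proj p = torus_proj q"
proof -
  obtain x y x' y' where pq: "p = (x, y)" "q = (x', y')" by fastforce
  have "i = j" using edge_pos_side[of i x y] edge_pos_side[of j x' y'] assms pq by simp
  have other: "level k p \<notin> \<int>" "level k q \<notin> \<int>" if "k \<noteq> i" for k
    using two_levels_vertex assms that \<open>i = j\<close> by blast+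
  have fr: "frac a = frac b \<Longrightarrow> a - b \<in> \<int>" for a b :: real
    by (simp add: frac_def) (metis Ints_diff Ints_of_int add_diff_cancel_left' diff_add_cancel diff_diff_eq2)
  have f1: "frac y < 1" "frac y' < 1" by (auto simp: frac_lt_1)
  show ?thesis
  proof (cases i)
    case I1
    then have Z: "y \<in> \<int>" "y' \<in> \<int>" using assms(1,2) \<open>i = j\<close> pq by auto
    then have "frac x = frac x'" using assms(5) pq by (simp add: edge_pos_def)
    then show ?thesis using Z fr unfolding pq torus_proj_eq_iff by simp
  next
    case I2
    then have Z: "y \<notin> \<int>" "y' \<notin> \<int>" "x \<notin> \<int>" "x' \<notin> \<int>" using other[of I1] other[of I3] pq by auto
    have "frac y = frac y'" using assms(5) pq Z f1 by (simp add: edge_pos_def field_simps)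
    then have "y - y' \<in> \<int>" by (rule fr)
    moreover have "(x + y) - (x' + y') \<in> \<int>" using assms(1,2) \<open>i = j\<close> I2 pq by (intro Ints_diff) auto
    ultimately have d: "((x + y) - (x' + y')) - (y - y') \<in> \<int>" by (rule Ints_diff[rotated])
    have "((x + y) - (x' + y')) - (y - y') = x - x'" by simp
    then have "x - x' \<in> \<int>" using d by (rule subst)
    then show ?thesis using \<open>y - y' \<in> \<int>\<close> unfolding pq torus_proj_eq_iff by simp
  next
    case I3
    then have Z: "y \<notin> \<int>" "y' \<notin> \<int>" "x \<in> \<int>" "x' \<in> \<int>" using other[of I1] assms(1,2) \<open>i = j\<close> pq by auto
    have "frac y = frac y'" using assms(5) pq Z f1 by (simp add: edge_pos_def field_simps)
    then show ?thesis using Z fr unfolding pq torus_proj_eq_iff by simp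
  qed
qed

lemma sorted_wrt_no_gap:
  assumes "sorted_wrt (<) zs" "Suc l < length zs" "zs ! l < (x::real)" "x < zs ! Suc l"
  shows "x \<notin> set zs"
proof
  assume "x \<in> set zs"
  then obtain j where j: "j < length zs" "x = zs ! j" by (metis in_set_conv_nth)
  have mono: "a < b \<Longrightarrow> b < length zs \<Longrightarrow> zs ! a < zs ! b" for a b
    using assms(1) sorted_wrt_iff_nth_less by blast
  have "j = l \<or> j = Suc l \<or> j < l \<or> Suc l < j" by linarith
  then show False using mono[of j l] mono[of "Suc l" j] assms j by auto
qed

lemma curve_word_eq_map:
  assumes "\<And>x. x \<in> {0<..<1} \<Longrightarrow> \<eta> x \<in> edges \<Longrightarrow> torus_proj (\<gamma> x) = \<eta> x \<and> \<eta> x \<noteq> vertex"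
    and "finite {x \<in> {0<..<1}. \<eta> x \<in> edges}"
  shows "curve_word \<eta> =
    map (\<lambda>x. side_of (edge_pos (\<gamma> x))) (sorted_list_of_set {x \<in> {0<..<1}. \<eta> x \<in> edges})"
  unfolding curve_word_def
proof (rule map_cong[OF HOL.refl])
  fix x assume "x \<in> set (sorted_list_of_set {x \<in> {0<..<1}. \<eta> x \<in> edges})"
  then have x: "\<eta> x \<in> edges" "torus_proj (\<gamma> x) = \<eta> x" "\<eta> x \<noteq> vertex"
    using assms by auto
  then obtain i where i: "\<eta> x \<in> edge i" by (auto simp: edges_def)
  then have i': "level i (\<gamma> x) \<in> \<int>" using x torus_proj_in_edge by metis
  have "j = i" if "\<eta> x \<in> edge j" for j
    using two_levels_vertex[OF _ i'] that x torus_proj_in_edge by metis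
  then have "(THE i. \<eta> x \<in> edge i) = i" using i by blast
  then show "(THE i. \<eta> x \<in> edge i) = side_of (edge_pos (\<gamma> x))"
    using edge_pos_side[of i "fst (\<gamma> x)" "snd (\<gamma> x)"] i' x by simp
qed

section \<open>The chord system of a non-self-crossing curve\<close>

locale rigid_curve =
  fixes \<eta> :: "real \<Rightarrow> torus" and \<gamma> :: "real \<Rightarrow> real \<times> real"
  assumes admissible: "admissible \<eta>" and loop_free: "loop_free \<eta>"
    and cont: "continuous_on {0..1} \<gamma>" and lift: "t \<in> {0..1} \<Longrightarrow> torus_proj (\<gamma> t) = \<eta> t"
    and odd_word: "odd (length (curve_word \<eta>))"
begin

definition crossings :: "real set" where
  "crossings = {x \<in> {0<..<1}. \<eta> x \<in> edges}"

definition times :: "real list" where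
  "times = 0 # sorted_list_of_set crossings @ [1]"

definition k :: nat where
  "k = card crossings"

definition T :: "nat \<Rightarrow> real" where
  "T l = times ! l"

text \<open>\<open>sorted_list_of_set\<close> of an infinite set is the empty list, whose length
  would be even.\<close>

lemma finite_crossings: "finite crossings"
proof (rule ccontr)
  assume "infinite crossings"
  then have "sorted_list_of_set crossings = []" by simp
  then show False using odd_word by (simp add: curve_word_def crossings_def)
qed

lemma odd_k: "odd k"
  using odd_word by (simp add: curve_word_def crossings_def k_def)

lemma length_times: "length times = k + 2"
  by (simp add: times_def k_def)

lemma sorted_times: "sorted_wrt (<) times"
  using finite_crossings
  by (auto simp: times_def sorted_wrt_append crossings_def strict_sorted_list_of_set)

lemma T_less: "l < l' \<Longrightarrow> l' \<le> k + 1 \<Longrightarrow> T l < T l'"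
  using sorted_times sorted_wrt_iff_nth_less[of "(<)" times] length_times by (simp add: T_def)

lemma T_le: "l \<le> l' \<Longrightarrow> l' \<le> k + 1 \<Longrightarrow> T l \<le> T l'"
  using T_less[of l l'] by (cases "l = l'") auto

lemma T_ends: "T 0 = 0" "T (Suc k) = 1"
  by (simp_all add: T_def times_def k_def nth_append)

lemma T_range: "l \<le> k + 1 \<Longrightarrow> 0 \<le> T l \<and> T l \<le> 1"
  using T_le[of 0 l] T_le[of l "Suc k"] T_ends by auto

lemma T_crossing: "0 < l \<Longrightarrow> l \<le> k \<Longrightarrow> T l \<in> crossings"
proof -
  assume l: "0 < l" "l \<le> k"
  then have "T l = sorted_list_of_set crossings ! (l - 1)"
    by (simp add: T_def times_def nth_append k_def nth_Cons')
  moreover have "\<dots> \<in> set (sorted_list_of_set crossings)" using l by (intro nth_mem) (simp add: k_def)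
  ultimately show ?thesis using finite_crossings by simp
qed

lemma not_vertex: "0 < t \<Longrightarrow> t < 1 \<Longrightarrow> torus_proj (\<gamma> t) \<noteq> vertex"
  using admissible lift[of t] by (auto simp: admissible_def)

lemma vertex_ends: "torus_proj (\<gamma> 0) = vertex" "torus_proj (\<gamma> 1) = vertex"
  using admissible lift[of 0] lift[of 1] by (auto simp: admissible_def)

lemma crossing_level:
  assumes "t \<in> crossings"
  obtains i where "level i (\<gamma> t) \<in> \<int>" "\<And>j. j \<noteq> i \<Longrightarrow> level j (\<gamma> t) \<notin> \<int>"
proof -
  have t: "0 < t" "t < 1" "\<eta> t \<in> edges" using assms by (auto simp: crossings_def)
  then obtain i where "\<eta> t \<in> edge i" by (auto simp: edges_def)
  then have "level i (\<gamma> t) \<in> \<int>" using lift[of t] t torus_proj_in_edge[of "\<gamma> t" i] by simp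
  then show thesis using that two_levels_vertex not_vertex[OF t(1,2)] by metis
qed

lemma no_crossing: "l \<le> k \<Longrightarrow> T l < t \<Longrightarrow> t < T (Suc l) \<Longrightarrow> level i (\<gamma> t) \<notin> \<int>"
proof
  assume l: "l \<le> k" "T l < t" "t < T (Suc l)" and i: "level i (\<gamma> t) \<in> \<int>"
  have t: "0 < t" "t < 1" using l T_range[of l] T_range[of "Suc l"] by auto
  then have "\<eta> t \<in> edge i" using i lift[of t] torus_proj_in_edge[of "\<gamma> t" i] by simp
  then have "t \<in> set times" using t finite_crossings by (auto simp: times_def crossings_def edges_def)
  then show False using sorted_wrt_no_gap[OF sorted_times, of l t] l length_times by (simp add: T_def)
qed

text \<open>The floors of the three levels name the triangle of the plane that contains the
  \<open>l\<close>-th piece: \<open>I3\<close> and \<open>I1\<close> give the unit square,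
  \<open>I2\<close> its half. The midpoint merely samples the open time interval, on which the
  floors are constant.\<close>

definition cell :: "nat \<Rightarrow> index \<Rightarrow> int" where
  "cell l i = \<lfloor>level i (\<gamma> ((T l + T (Suc l)) / 2))\<rfloor>"

lemma cont_level: "0 \<le> a \<Longrightarrow> b \<le> 1 \<Longrightarrow> continuous_on {a..b} (\<lambda>t. level i (\<gamma> t))"
  by (rule continuous_on_level) (rule continuous_on_subset[OF cont], auto)

lemma open_cell:
  assumes "l \<le> k" "T l < t" "t < T (Suc l)"
  shows "of_int (cell l i) < level i (\<gamma> t)" "level i (\<gamma> t) < of_int (cell l i) + 1"
    "\<lfloor>level i (\<gamma> t)\<rfloor> = cell l i"
proof -
  have r: "0 \<le> T l" "T (Suc l) \<le> 1" "T l < T (Suc l)" using T_range assms T_less[of l "Suc l"] by auto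
  have "continuous_on {T l<..<T (Suc l)} (\<lambda>t. level i (\<gamma> t))"
    by (rule continuous_on_subset[OF cont_level[OF r(1,2)]]) auto
  then show fl: "\<lfloor>level i (\<gamma> t)\<rfloor> = cell l i"
    unfolding cell_def using assms r(3) no_crossing[OF assms(1)]
    by (intro continuous_floor_constant[of "{T l<..<T (Suc l)}"]) auto
  have "of_int \<lfloor>level i (\<gamma> t)\<rfloor> \<noteq> level i (\<gamma> t)" using no_crossing[OF assms] by (metis Ints_of_int)
  then show "of_int (cell l i) < level i (\<gamma> t)" "level i (\<gamma> t) < of_int (cell l i) + 1"
    unfolding fl[symmetric] by linarith+
qed

lemma closed_cell:
  assumes "l \<le> k" "T l \<le> t" "t \<le> T (Suc l)"
  shows "of_int (cell l i) \<le> level i (\<gamma> t) \<and> level i (\<gamma> t) \<le> of_int (cell l i) + 1"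
proof -
  have r: "0 \<le> T l" "T (Suc l) \<le> 1" "T l < T (Suc l)" using T_range assms T_less[of l "Suc l"] by auto
  have t: "t \<in> {T l..T (Suc l)}" using assms by simp
  have "of_int (cell l i) \<le> level i (\<gamma> t)"
    by (rule continuous_ge_on_Ioo[OF cont_level[OF r(1,2)] _ r(3) t])
      (use open_cell(1)[OF assms(1)] in \<open>simp add: less_imp_le\<close>)
  moreover have "- (of_int (cell l i) + 1) \<le> - level i (\<gamma> s)" if "s \<in> {T l<..<T (Suc l)}" for s
    using open_cell(2)[OF assms(1), of s i] that by simp
  then have "- (of_int (cell l i) + 1) \<le> - level i (\<gamma> t)"
    by (rule continuous_ge_on_Ioo[OF continuous_on_minus[OF cont_level[OF r(1,2)]] _ r(3) t])
  ultimately show ?thesis by simp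
qed

lemma cell_cases: "l \<le> k \<Longrightarrow> cell l I2 = cell l I1 + cell l I3 \<or> cell l I2 = cell l I1 + cell l I3 + 1"
proof -
  assume l: "l \<le> k"
  let ?t = "(T l + T (Suc l)) / 2"
  have "T l < ?t" "?t < T (Suc l)" using T_less[of l "Suc l"] l by auto
  note c = open_cell(1,2)[OF l this]
  have "of_int (cell l I2) < (of_int (cell l I1 + cell l I3 + 2) :: real)"
    "of_int (cell l I1 + cell l I3) < (of_int (cell l I2 + 1) :: real)"
    using c[of I1] c[of I2] c[of I3] by (simp_all add: level_simps)
  then show ?thesis unfolding of_int_less_iff by linarith
qed

text \<open>The level of the local lift in \<open>crosses_transversally\<close> differs from that of
  \<open>\<gamma>\<close> by an integer, hence by a constant on the interval, so the strict
  inequalities carry over.\<close>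

lemma crossing_transversal:
  assumes "t \<in> crossings" "level i (\<gamma> t) \<in> \<int>"
  shows "\<exists>\<epsilon>>0. (\<forall>s\<in>{t-\<epsilon>..<t}. level i (\<gamma> s) < level i (\<gamma> t)) \<and> (\<forall>s\<in>{t<..t+\<epsilon>}. level i (\<gamma> s) > level i (\<gamma> t)) \<or>
    (\<forall>s\<in>{t-\<epsilon>..<t}. level i (\<gamma> s) > level i (\<gamma> t)) \<and> (\<forall>s\<in>{t<..t+\<epsilon>}. level i (\<gamma> s) < level i (\<gamma> t))"
proof -
  have t: "0 < t" "t < 1" "\<eta> t \<in> edges" "\<eta> t \<noteq> vertex"
    using assms(1) not_vertex lift[of t] by (auto simp: crossings_def)
  then have "crosses_transversally \<eta> t" using admissible by (auto simp: admissible_def)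
  then obtain j \<epsilon> \<beta> where e: "\<epsilon> > 0" "{t-\<epsilon>..t+\<epsilon>} \<subseteq> {0..1}" and b: "continuous_on {t-\<epsilon>..t+\<epsilon>} \<beta>"
    "\<forall>s\<in>{t-\<epsilon>..t+\<epsilon>}. torus_proj (\<beta> s) = \<eta> s" and j: "level j (\<beta> t) \<in> \<int>"
    and d: "(\<forall>s\<in>{t-\<epsilon>..<t}. level j (\<beta> s) < level j (\<beta> t)) \<and> (\<forall>s\<in>{t<..t+\<epsilon>}. level j (\<beta> s) > level j (\<beta> t)) \<or>
      (\<forall>s\<in>{t-\<epsilon>..<t}. level j (\<beta> s) > level j (\<beta> t)) \<and> (\<forall>s\<in>{t<..t+\<epsilon>}. level j (\<beta> s) < level j (\<beta> t))"
    unfolding crosses_transversally_def by blast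
  have eq: "torus_proj (\<gamma> s) = torus_proj (\<beta> s)" if "s \<in> {t-\<epsilon>..t+\<epsilon>}" for s
    using lift[of s] b(2) e(2) that by (metis subsetD)
  have "level j (\<gamma> t) \<in> \<int>"
    using eq[of t] e(1) j torus_proj_in_edge[of "\<gamma> t" j] torus_proj_in_edge[of "\<beta> t" j] by simp
  then have "j = i" using two_levels_vertex[OF _ assms(2)] not_vertex t by metis
  have c1: "continuous_on {t-\<epsilon>..t+\<epsilon>} \<gamma>" by (rule continuous_on_subset[OF cont e(2)])
  have "\<exists>c. \<forall>s\<in>{t-\<epsilon>..t+\<epsilon>}. level i (\<gamma> s) - level i (\<beta> s) = c"
    by (rule continuous_Ints_constant[OF continuous_on_diff[OF continuous_on_level[OF c1]
          continuous_on_level[OF b(1)]] connected_Icc]) (rule level_diff_Ints[OF eq])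
  then obtain c where c: "\<forall>s\<in>{t-\<epsilon>..t+\<epsilon>}. level i (\<gamma> s) - level i (\<beta> s) = c" ..
  have "level i (\<gamma> s) = level i (\<beta> s) + c" if "s \<in> {t-\<epsilon>..t+\<epsilon>}" for s using c that by force
  then show ?thesis using d e(1) \<open>j = i\<close> by (intro exI[of _ \<epsilon>]) auto
qed

text \<open>At a crossing time the other two levels are not integers, so their floors agree before
  and after; transversality puts level \<open>i\<close> on different sides of an integer.\<close>

lemma cell_step:
  assumes "0 < l" "l \<le> k"
  obtains i where "\<And>j. j \<noteq> i \<Longrightarrow> cell l j = cell (l - 1) j"
    "cell l i = cell (l - 1) i + 1 \<or> cell l i = cell (l - 1) i - 1"
proof -
  let ?t = "T l"
  have tc: "?t \<in> crossings" using T_crossing assms by blast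
  obtain i where i: "level i (\<gamma> ?t) \<in> \<int>" "\<And>j. j \<noteq> i \<Longrightarrow> level j (\<gamma> ?t) \<notin> \<int>"
    using crossing_level[OF tc] by blast
  have l1: "l - 1 \<le> k" "Suc (l - 1) = l" using assms by auto
  have lt: "T (l - 1) < ?t" "?t < T (Suc l)" using T_less[of "l - 1" l] T_less[of l "Suc l"] assms by auto
  have same: "cell l j = cell (l - 1) j" if "j \<noteq> i" for j
  proof -
    have fl: "\<lfloor>level j (\<gamma> ?t)\<rfloor> = cell n j"
      if "of_int (cell n j) \<le> level j (\<gamma> ?t)" "level j (\<gamma> ?t) \<le> of_int (cell n j) + 1" for n
    proof (rule floor_unique[OF that(1)])
      have "level j (\<gamma> ?t) \<noteq> of_int (cell n j + 1)" using i(2)[OF \<open>j \<noteq> i\<close>] by (metis Ints_of_int)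
      then show "level j (\<gamma> ?t) < of_int (cell n j) + 1" using that(2) by simp
    qed
    show ?thesis
      using fl[of l] fl[of "l - 1"] closed_cell[OF assms(2), of ?t j] closed_cell[OF l1(1), of ?t j] lt
      unfolding l1(2) by simp
  qed
  obtain \<epsilon> where e: "\<epsilon> > 0" and d:
    "(\<forall>s\<in>{?t-\<epsilon>..<?t}. level i (\<gamma> s) < level i (\<gamma> ?t)) \<and> (\<forall>s\<in>{?t<..?t+\<epsilon>}. level i (\<gamma> s) > level i (\<gamma> ?t)) \<or>
     (\<forall>s\<in>{?t-\<epsilon>..<?t}. level i (\<gamma> s) > level i (\<gamma> ?t)) \<and> (\<forall>s\<in>{?t<..?t+\<epsilon>}. level i (\<gamma> s) < level i (\<gamma> ?t))"
    using crossing_transversal[OF tc i(1)] by blast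
  define a b where "a = max (?t - \<epsilon>) ((T (l - 1) + ?t) / 2)" and "b = min (?t + \<epsilon>) ((?t + T (Suc l)) / 2)"
  have ab: "a \<in> {?t-\<epsilon>..<?t}" "T (l - 1) < a" "b \<in> {?t<..?t+\<epsilon>}" "b < T (Suc l)"
    using e lt by (auto simp: a_def b_def less_max_iff_disj min_less_iff_disj)
  obtain n where n: "level i (\<gamma> ?t) = of_int n" using i(1) by (metis Ints_cases)
  have fa: "of_int (cell (l - 1) i) < level i (\<gamma> a)" "level i (\<gamma> a) < of_int (cell (l - 1) i) + 1"
    using open_cell(1,2)[OF l1(1), of a i] ab unfolding l1(2) by auto
  have fb: "of_int (cell l i) < level i (\<gamma> b)" "level i (\<gamma> b) < of_int (cell l i) + 1"
    using open_cell(1,2)[OF assms(2), of b i] ab by auto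
  have ca: "of_int (cell (l - 1) i) \<le> level i (\<gamma> ?t)" "level i (\<gamma> ?t) \<le> of_int (cell (l - 1) i) + 1"
    using closed_cell[OF l1(1), of ?t i] lt unfolding l1(2) by auto
  have cb: "of_int (cell l i) \<le> level i (\<gamma> ?t)" "level i (\<gamma> ?t) \<le> of_int (cell l i) + 1"
    using closed_cell[OF assms(2), of ?t i] lt by auto
  have "cell l i = n \<and> cell (l - 1) i = n - 1 \<or> cell l i = n - 1 \<and> cell (l - 1) i = n"
    using d
  proof
    assume "(\<forall>s\<in>{?t-\<epsilon>..<?t}. level i (\<gamma> s) < level i (\<gamma> ?t)) \<and> (\<forall>s\<in>{?t<..?t+\<epsilon>}. level i (\<gamma> s) > level i (\<gamma> ?t))"
    then have "level i (\<gamma> a) < of_int n" "level i (\<gamma> b) > of_int n" using ab n by auto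
    then show ?thesis using fa fb ca cb unfolding n by linarith
  next
    assume "(\<forall>s\<in>{?t-\<epsilon>..<?t}. level i (\<gamma> s) > level i (\<gamma> ?t)) \<and> (\<forall>s\<in>{?t<..?t+\<epsilon>}. level i (\<gamma> s) < level i (\<gamma> ?t))"
    then have "level i (\<gamma> a) > of_int n" "level i (\<gamma> b) < of_int n" using ab n by auto
    then show ?thesis using fa fb ca cb unfolding n by linarith
  qed
  then show thesis using that[of i] same by auto
qed

lemma start_point: "cell 0 I2 = cell 0 I1 + cell 0 I3" "\<gamma> 0 = (of_int (cell 0 I3), of_int (cell 0 I1))"
proof -
  obtain m n where z: "fst (\<gamma> 0) = of_int m" "snd (\<gamma> 0) = of_int n"
    using vertex_ends(1) unfolding torus_proj_eq_vertex by (auto elim!: Ints_cases)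
  obtain \<epsilon> where e: "\<epsilon> > 0" "\<epsilon> \<le> 1" "\<eta> ` {0..\<epsilon>} \<subseteq> start_segment"
    using admissible by (auto simp: admissible_def)
  \<comment> \<open>The offset \<open>r\<close> along the start segment is at most 1/3 as well, so
    with this tolerance the integer parts of \<open>\<gamma> t\<close> and \<open>\<gamma> 0\<close>
    are less than 1 apart, hence equal.\<close>
  obtain \<delta> where d: "\<delta> > 0" "\<And>t. t \<in> {0..1} \<Longrightarrow> dist t 0 < \<delta> \<Longrightarrow> dist (\<gamma> t) (\<gamma> 0) < 1 / 3"
    using cont unfolding continuous_on_iff by (metis atLeastAtMost_iff zero_le_one order_refl zero_less_divide_1_iff zero_less_numeral)
  have T1: "T 0 = 0" "0 < T 1" "T 1 \<le> 1" using T_ends T_less[of 0 1] T_range[of 1] by auto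
  define t where "t = min \<epsilon> (min (\<delta> / 2) (T 1 / 2))"
  have t: "0 < t" "t \<le> \<epsilon>" "t < \<delta>" "t < T 1" "t < 1" using e d T1 by (auto simp: t_def)
  have "\<eta> t \<in> start_segment" using e(3) t by auto
  then obtain q where "torus_proj (\<gamma> t) = torus_proj q" "q \<in> closed_segment (1/3, 1/3) (0, 0)"
    using lift[of t] t by (auto simp: start_segment_def)
  moreover from this(2) obtain u where u: "0 \<le> u" "u \<le> 1" "q = (1 - u) *\<^sub>R (1/3, 1/3) + u *\<^sub>R (0, 0)"
    by (auto simp: closed_segment_def)
  moreover define r where "r = (1 - u) / 3"
  have "q = (r, r)" unfolding u(3) r_def by simp
  ultimately have r: "0 \<le> r" "r \<le> 1 / 3" "torus_proj (\<gamma> t) = torus_proj (r, r)"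
    by (auto simp: r_def)
  then have Z: "fst (\<gamma> t) - r \<in> \<int>" "snd (\<gamma> t) - r \<in> \<int>" by (auto simp: torus_proj_eq_iff)
  have "r \<noteq> 0" using not_vertex[of t] t r(3) by (auto simp: vertex_def)
  have "dist t 0 < \<delta>" using t by (simp add: dist_real_def)
  then have "dist (\<gamma> t) (\<gamma> 0) < 1 / 3" using t by (intro d(2)) auto
  then have "dist (fst (\<gamma> t)) (fst (\<gamma> 0)) < 1 / 3" "dist (snd (\<gamma> t)) (snd (\<gamma> 0)) < 1 / 3"
    using dist_fst_le[of "\<gamma> t" "\<gamma> 0"] dist_snd_le[of "\<gamma> t" "\<gamma> 0"] by linarith+
  then have near: "\<bar>fst (\<gamma> t) - of_int m\<bar> < 1 / 3" "\<bar>snd (\<gamma> t) - of_int n\<bar> < 1 / 3"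
    unfolding z dist_real_def .
  have int: "w - r = of_int q" if w: "w - r \<in> \<int>" "\<bar>w - of_int q\<bar> < 1 / 3" for w q
  proof -
    obtain p where p: "w - r = of_int p" using w(1) by (metis Ints_cases)
    then have "\<bar>of_int (p - q) :: real\<bar> < 1" using w(2) r(1,2) unfolding of_int_diff by linarith
    then have "p = q" by linarith
    then show ?thesis using p by simp
  qed
  have xy: "fst (\<gamma> t) = of_int m + r" "snd (\<gamma> t) = of_int n + r"
    using int[OF Z(1) near(1)] int[OF Z(2) near(2)] by simp_all
  have "\<lfloor>level i (\<gamma> t)\<rfloor> = cell 0 i" for i using open_cell(3)[of 0 t i] t T1 by simp
  moreover have "\<lfloor>level I1 (\<gamma> t)\<rfloor> = n" "\<lfloor>level I3 (\<gamma> t)\<rfloor> = m" "\<lfloor>level I2 (\<gamma> t)\<rfloor> = m + n"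
    using xy r \<open>r \<noteq> 0\<close> by (auto simp: level_simps intro!: floor_unique)
  ultimately have c: "cell 0 I1 = n" "cell 0 I3 = m" "cell 0 I2 = m + n" by metis+
  show "cell 0 I2 = cell 0 I1 + cell 0 I3" using c by simp
  show "\<gamma> 0 = (of_int (cell 0 I3), of_int (cell 0 I1))" using z c by (simp add: prod_eq_iff)
qed

lemma end_point: "\<gamma> 1 = (of_int (cell k I3) + 1, of_int (cell k I1) + 1)"
proof -
  obtain m n where z: "fst (\<gamma> 1) = of_int m" "snd (\<gamma> 1) = of_int n"
    using vertex_ends(2) unfolding torus_proj_eq_vertex by (auto elim!: Ints_cases)
  obtain \<epsilon> where e: "\<epsilon> > 0" "\<epsilon> \<le> 1" "\<eta> ` {1-\<epsilon>..1} \<subseteq> end_segment"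
    using admissible by (auto simp: admissible_def)
  obtain \<delta> where d: "\<delta> > 0" "\<And>t. t \<in> {0..1} \<Longrightarrow> dist t 1 < \<delta> \<Longrightarrow> dist (\<gamma> t) (\<gamma> 1) < 1 / 3"
    using cont unfolding continuous_on_iff by (metis atLeastAtMost_iff zero_le_one order_refl zero_less_divide_1_iff zero_less_numeral)
  have Tk: "T (Suc k) = 1" "T k < 1" "0 \<le> T k" using T_ends T_less[of k "Suc k"] T_range[of k] by auto
  define s where "s = min \<epsilon> (min (\<delta> / 2) ((1 - T k) / 2))"
  define t where "t = 1 - s"
  have s: "0 < s" "s \<le> \<epsilon>" "s < \<delta>" "s < 1 - T k" using e d Tk by (auto simp: s_def min_less_iff_disj)
  then have t: "t < 1" "1 - \<epsilon> \<le> t" "T k < t" "0 < t" "dist t 1 < \<delta>" using Tk by (auto simp: t_def dist_real_def)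
  have "\<eta> t \<in> end_segment" using e(3) t by auto
  then obtain q where "torus_proj (\<gamma> t) = torus_proj q" "q \<in> closed_segment (2/3, 2/3) (1, 1)"
    using lift[of t] t by (auto simp: end_segment_def)
  moreover from this(2) obtain u where u: "0 \<le> u" "u \<le> 1" "q = (1 - u) *\<^sub>R (2/3, 2/3) + u *\<^sub>R (1, 1)"
    by (auto simp: closed_segment_def)
  moreover define r where "r = (1 - u) / 3"
  have "q = (1 - r, 1 - r)" unfolding u(3) r_def by (simp add: field_simps)
  ultimately have r: "0 \<le> r" "r \<le> 1 / 3" "torus_proj (\<gamma> t) = torus_proj (1 - r, 1 - r)"
    by (auto simp: r_def)
  then have "fst (\<gamma> t) - (1 - r) \<in> \<int>" "snd (\<gamma> t) - (1 - r) \<in> \<int>" by (auto simp: torus_proj_eq_iff)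
  then have "fst (\<gamma> t) - (1 - r) + 1 \<in> \<int>" "snd (\<gamma> t) - (1 - r) + 1 \<in> \<int>"
    by (simp_all only: Ints_add[OF _ Ints_1])
  moreover have "w - (1 - r) + 1 = w + r" for w by simp
  ultimately have Z: "fst (\<gamma> t) + r \<in> \<int>" "snd (\<gamma> t) + r \<in> \<int>" by metis+
  have "r \<noteq> 0"
  proof
    assume "r = 0"
    then have "torus_proj (\<gamma> t) = vertex" using r(3) by (simp add: torus_proj_eq_vertex)
    then show False using not_vertex[of t] t by simp
  qed
  have "dist t 1 < \<delta>" using t by (simp add: dist_real_def)
  then have "dist (\<gamma> t) (\<gamma> 1) < 1 / 3" using t by (intro d(2)) auto
  then have "dist (fst (\<gamma> t)) (fst (\<gamma> 1)) < 1 / 3" "dist (snd (\<gamma> t)) (snd (\<gamma> 1)) < 1 / 3"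
    using dist_fst_le[of "\<gamma> t" "\<gamma> 1"] dist_snd_le[of "\<gamma> t" "\<gamma> 1"] by linarith+
  then have near: "\<bar>fst (\<gamma> t) - of_int m\<bar> < 1 / 3" "\<bar>snd (\<gamma> t) - of_int n\<bar> < 1 / 3"
    unfolding z dist_real_def .
  have int: "w + r = of_int q" if w: "w + r \<in> \<int>" "\<bar>w - of_int q\<bar> < 1 / 3" for w q
  proof -
    obtain p where p: "w + r = of_int p" using w(1) by (metis Ints_cases)
    then have "\<bar>of_int (p - q) :: real\<bar> < 1" using w(2) r(1,2) unfolding of_int_diff by linarith
    then have "p = q" by linarith
    then show ?thesis using p by simp
  qed
  have xy: "fst (\<gamma> t) = of_int m - r" "snd (\<gamma> t) = of_int n - r"
    using int[OF Z(1) near(1)] int[OF Z(2) near(2)] by simp_all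
  have "\<lfloor>level i (\<gamma> t)\<rfloor> = cell k i" for i using open_cell(3)[of k t i] t Tk by simp
  moreover have "\<lfloor>level I1 (\<gamma> t)\<rfloor> = n - 1" "\<lfloor>level I3 (\<gamma> t)\<rfloor> = m - 1"
    using xy r \<open>r \<noteq> 0\<close> by (auto simp: level_simps intro!: floor_unique)
  ultimately have c: "cell k I1 = n - 1" "cell k I3 = m - 1" by metis+
  show ?thesis using z c by (simp add: prod_eq_iff)
qed

text \<open>Each crossing changes exactly one of the three floors by one, so the parity of the
  excess of \<open>cell l I2\<close> alternates, and by \<open>cell_cases\<close> the excess is 0 or
  1. Even pieces thus lie in translates of the first triangle, odd ones in translates of the
  second.\<close>

lemma cell_parity:
  "l \<le> k \<Longrightarrow> cell l I2 = cell l I1 + cell l I3 + (if even l then 0 else 1)"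
proof (induction l)
  case 0
  then show ?case using start_point by simp
next
  case (Suc l)
  obtain i where i: "\<And>j. j \<noteq> i \<Longrightarrow> cell (Suc l) j = cell l j"
    "cell (Suc l) i = cell l i + 1 \<or> cell (Suc l) i = cell l i - 1"
    using cell_step[of "Suc l"] Suc.prems by auto
  have "odd (cell (Suc l) I2 - cell (Suc l) I1 - cell (Suc l) I3) \<longleftrightarrow>
      even (cell l I2 - cell l I1 - cell l I3)"
    using i(2) i(1)[of I1] i(1)[of I2] i(1)[of I3] by (cases i) auto
  then show ?case using Suc cell_cases[of "Suc l"] by auto
qed

text \<open>Brings the \<open>l\<close>-th piece into the standard triangle, from the first triangle
  by a translation and from the second by a half turn.\<close>

definition arc :: "nat \<Rightarrow> real \<Rightarrow> real \<times> real" where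
  "arc l t = (if even l then \<gamma> t - (of_int (cell l I3), of_int (cell l I1))
     else (of_int (cell l I3 + 1), of_int (cell l I1 + 1)) - \<gamma> t)"

lemma arc_ends: "arc 0 0 = (0, 0)" "arc k 1 = (0, 0)"
  using start_point end_point odd_k by (simp_all add: arc_def zero_prod_def)

lemma arc_eq: "arc l t = arc l' t' \<Longrightarrow> even l = even l' \<Longrightarrow> torus_proj (\<gamma> t) = torus_proj (\<gamma> t')"
proof -
  assume eq: "arc l t = arc l' t'" "even l = even l'"
  have "fst (\<gamma> t) - fst (\<gamma> t') = of_int (cell l I3 - cell l' I3)"
    "snd (\<gamma> t) - snd (\<gamma> t') = of_int (cell l I1 - cell l' I1)"
    using eq unfolding arc_def by (cases "even l"; simp add: prod_eq_iff)+
  then show ?thesis unfolding torus_proj_eq_iff by (metis Ints_of_int)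
qed

lemma arc_level: "level i (arc l t) \<in> \<int> \<longleftrightarrow> level i (\<gamma> t) \<in> \<int>"
proof -
  have Z: "w - of_int n \<in> \<int> \<longleftrightarrow> w \<in> \<int>" "of_int n - w \<in> \<int> \<longleftrightarrow> w \<in> \<int>" for w :: real and n
    by (metis Ints_diff Ints_of_int diff_diff_eq2 add_diff_cancel_left' Ints_add diff_add_cancel)+
  have "\<exists>z::int. level i (of_int m, of_int n) = of_int z" for m n
    by (cases i) (auto simp: level_simps intro: exI[of _ "m + n"])
  then obtain z z' :: int where "level i (of_int (cell l I3), of_int (cell l I1)) = of_int z"
    "level i (of_int (cell l I3 + 1), of_int (cell l I1 + 1)) = of_int z'" by blast
  then have "level i (arc l t) = (if even l then level i (\<gamma> t) - of_int z else of_int z' - level i (\<gamma> t))"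
    unfolding arc_def by (simp add: level_add(2) del: of_int_add)
  then show ?thesis by (simp add: Z)
qed

lemma arc_vertex: "torus_proj (arc l t) = vertex \<longleftrightarrow> torus_proj (\<gamma> t) = vertex"
  using arc_level[of I3 l t] arc_level[of I1 l t] by (simp add: torus_proj_eq_vertex level_simps)

lemma arc_triangle:
  assumes "l \<le> k" "T l \<le> t" "t \<le> T (Suc l)"
  shows "arc l t \<in> triangle"
proof -
  have c: "of_int (cell l i) \<le> level i (\<gamma> t)" "level i (\<gamma> t) \<le> of_int (cell l i) + 1" for i
    using closed_cell[OF assms] by auto
  have p: "(of_int (cell l I2) :: real) = of_int (cell l I1) + of_int (cell l I3) + (if even l then 0 else 1)"
    using cell_parity[OF assms(1)] by simp
  have b: "0 \<le> fst (arc l t)" "0 \<le> snd (arc l t)" "fst (arc l t) + snd (arc l t) \<le> 1"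
    using c[of I1] c[of I2] c[of I3] p by (auto simp: arc_def level_simps)
  \<comment> \<open>The corner (0,1) is a vertex point; the curve meets those only at its end times,
    where \<open>arc\<close> is (0,0).\<close>
  have "snd (arc l t) \<noteq> 1"
  proof
    assume s: "snd (arc l t) = 1"
    then have "fst (arc l t) = 0" using b by simp
    then have "torus_proj (\<gamma> t) = vertex" using s arc_vertex[of l t] by (simp add: torus_proj_eq_vertex)
    then consider "t = 0" | "t = 1" using not_vertex[of t] T_range[of l] T_range[of "Suc l"] assms by force
    then show False
    proof cases
      case 1
      then have "l = 0" using T_less[of 0 l] T_ends assms by (cases l) auto
      then show False using 1 s arc_ends by simp
    next
      case 2
      then have "l = k" using T_less[of "Suc l" "Suc k"] T_ends assms by (cases "l = k") auto
      then show False using 2 s arc_ends by simp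
    qed
  qed
  then show ?thesis using b by (cases "arc l t") (auto simp: triangle_def)
qed

definition positions :: "real list" where
  "positions = map (\<lambda>t. edge_pos (\<gamma> t)) (sorted_list_of_set crossings)"

definition stops :: "real list" where
  "stops = 0 # positions @ [0]"

lemma stops_nth:
  assumes "l \<le> k + 1"
  shows "stops ! l = (if l = 0 \<or> l = k + 1 then 0 else edge_pos (\<gamma> (T l)))"
proof -
  have "length positions = k" by (simp add: positions_def k_def)
  then show ?thesis using assms
    by (auto simp: stops_def T_def times_def nth_Cons' nth_append positions_def k_def)
qed

lemma crossing_pos:
  assumes "t \<in> crossings"
  obtains i where "level i (\<gamma> t) \<in> \<int>" "torus_proj (\<gamma> t) \<noteq> vertex" "side_of (edge_pos (\<gamma> t)) = i"
    "edge_pos (\<gamma> t) \<notin> {0, 1}"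
proof -
  obtain i where i: "level i (\<gamma> t) \<in> \<int>" using crossing_level assms by blast
  have v: "torus_proj (\<gamma> t) \<noteq> vertex" using not_vertex assms by (auto simp: crossings_def)
  show thesis using that[OF i v] edge_pos_side[of i "fst (\<gamma> t)" "snd (\<gamma> t)"] i v by simp
qed

lemma arc_position:
  assumes "l \<le> k" "e = l \<or> e = Suc l"
  shows "unfold_x (arc l (T e)) = (if even l then stops ! e else edge_flip (stops ! e)) \<and>
    unfold_y (arc l (T e)) = 0"
proof -
  have e: "e \<le> k + 1" using assms by auto
  show ?thesis
  proof (cases "e = 0 \<or> e = k + 1")
    case True
    then have "e = 0 \<and> l = 0 \<or> e = Suc k \<and> l = k" using assms by auto
    then have "arc l (T e) = (0, 0)" using arc_ends T_ends by auto
    then show ?thesis using True stops_nth[OF e] by (simp add: unfold_x_def unfold_y_def)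
  next
    case False
    then have "T e \<in> crossings" using T_crossing e by simp
    then obtain i where i: "level i (\<gamma> (T e)) \<in> \<int>" "torus_proj (\<gamma> (T e)) \<noteq> vertex" by (rule crossing_pos)
    have "arc l (T e) \<in> triangle"
      using arc_triangle[OF assms(1), of "T e"] assms T_le[of l "Suc l"] by auto
    then have u: "unfold_x (arc l (T e)) = edge_pos (arc l (T e)) \<and> unfold_y (arc l (T e)) = 0"
      using unfold_edge[of i "arc l (T e)"] i by (simp add: arc_level arc_vertex)
    obtain x y where xy: "\<gamma> (T e) = (x, y)" by fastforce
    have "edge_pos (arc l (T e)) = (if even l then edge_pos (x, y) else edge_flip (edge_pos (x, y)))"
      using edge_pos_shift[of x "cell l I3" y "cell l I1"]
        edge_pos_flip[of i x y "cell l I3 + 1" "cell l I1 + 1"] i xy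
      by (simp add: arc_def)
    then show ?thesis using u xy stops_nth[OF e] False by simp
  qed
qed

lemma continuous_arc: "0 \<le> a \<Longrightarrow> b \<le> 1 \<Longrightarrow> continuous_on {a..b} (arc l)"
proof -
  assume "0 \<le> a" "b \<le> 1"
  then have "continuous_on {a..b} \<gamma>" by (intro continuous_on_subset[OF cont]) auto
  then show ?thesis unfolding arc_def by (cases "even l") (simp_all add: continuous_intros)
qed

text \<open>Pieces in the same triangle are disjoint because the curve is \<open>loop_free\<close>.
  The common vertex of the first and the last piece does no harm: \<open>k\<close> is odd, so these
  two lie in different triangles.\<close>

lemma arcs_noncrossing:
  assumes l: "l \<le> k" "l' \<le> k" "l < l'" "even l = even l'"
  defines "q \<equiv> \<lambda>e. if even l then stops ! e else edge_flip (stops ! e)"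
  shows "\<not> cross (q l, q (Suc l)) (q l', q (Suc l'))"
proof -
  define f where "f n s = arc n (T n + s * (T (Suc n) - T n))" for n s
  have param: "T n + s * (T (Suc n) - T n) \<in> {T n..T (Suc n)}" if "n \<le> k" "s \<in> {0..1}" for n s
  proof -
    have "0 \<le> T (Suc n) - T n" using T_le[of n "Suc n"] that by simp
    moreover from this have "s * (T (Suc n) - T n) \<le> 1 * (T (Suc n) - T n)"
      using that by (intro mult_right_mono) auto
    moreover have "0 \<le> s" using that by simp
    ultimately show ?thesis by simp
  qed
  have c: "continuous_on {0..1} (f n)" if "n \<le> k" for n
    unfolding f_def
    by (rule continuous_on_compose2[of "{T n..T (Suc n)}" "arc n"])
      (use that param T_range[of n] T_range[of "Suc n"] in \<open>auto intro!: continuous_arc continuous_intros\<close>)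
  have tri: "f n ` {0..1} \<subseteq> triangle" if "n \<le> k" for n
    using arc_triangle[OF that] param[OF that] by (auto simp: f_def)
  have disj: "f l ` {0..1} \<inter> f l' ` {0..1} = {}"
  proof (rule ccontr)
    assume "f l ` {0..1} \<inter> f l' ` {0..1} \<noteq> {}"
    then obtain z where "z \<in> f l ` {0..1}" "z \<in> f l' ` {0..1}" by blast
    then obtain s s' where s: "s \<in> {0..1}" "s' \<in> {0..1}" "f l s = f l' s'" by (metis imageE)
    define t t' where "t = T l + s * (T (Suc l) - T l)" and "t' = T l' + s' * (T (Suc l') - T l')"
    have t: "t \<in> {T l..T (Suc l)}" "t' \<in> {T l'..T (Suc l')}" using param s l by (auto simp: t_def t'_def)
    have "Suc l < l'" using l by presburger
    then have "T (Suc l) < T l'" using T_less l by simp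
    then have "t < t'" using t by simp
    have r: "t \<in> {0..1}" "t' \<in> {0..1}"
      using t T_range[of l] T_range[of l'] T_range[of "Suc l"] T_range[of "Suc l'"] l by auto
    have "arc l t = arc l' t'" using s(3) by (simp add: f_def t_def t'_def)
    then have "\<eta> t = \<eta> t'" using arc_eq[OF _ l(4)] lift r by metis
    then have e: "t = 0" "t' = 1"
      using loop_free r \<open>t < t'\<close> unfolding loop_free_def by force+
    have "l = 0" using T_less[of 0 l] T_ends t e l by (cases l) auto
    moreover have "l' = k" using T_less[of "Suc l'" "Suc k"] T_ends t e l by (cases "l' = k") auto
    ultimately show False using l odd_k by simp
  qed
  have ends: "f n 0 = arc n (T n)" "f n 1 = arc n (T (Suc n))" for n by (simp_all add: f_def)
  show ?thesis
    using triangle_noncrossing[OF c[OF l(1)] c[OF l(2)] tri[OF l(1)] tri[OF l(2)] disj]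
      arc_position[OF l(1)] arc_position[OF l(2)] l(4)
    unfolding ends q_def by simp
qed

text \<open>\<open>r\<close> is the index of the first piece in the triangle considered: 0 for the
  first triangle, 1 for the second, where positions are flipped.\<close>

lemma noncrossing_arcs:
  assumes ws: "length ws = k + 1" and r: "r = 0 \<or> r = (1::nat)"
    and q: "\<And>j. j < k + 1 \<Longrightarrow> ws ! j = (if r = 0 then stops ! (j + r) else edge_flip (stops ! (j + r)))"
  shows "noncrossing (set (pairs ws))"
  unfolding noncrossing_def
proof (intro ballI)
  have idx: "\<exists>l. l + 1 \<le> k \<and> even l \<and> fst p = ws ! l \<and> snd p = ws ! Suc l" if "p \<in> set (pairs ws)" for p
  proof -
    obtain us vs where "ws = us @ fst p # snd p # vs" "even (length us)"
      using pairs_split[of "fst p" "snd p" ws] \<open>p \<in> _\<close> by auto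
    then show ?thesis using ws by (intro exI[of _ "length us"]) (auto simp: nth_append)
  qed
  fix p p' assume "p \<in> set (pairs ws)" "p' \<in> set (pairs ws)"
  then obtain l l' where l: "l + 1 \<le> k" "even l" "p = (ws ! l, ws ! Suc l)"
    "l' + 1 \<le> k" "even l'" "p' = (ws ! l', ws ! Suc l')"
    using idx by (metis prod.collapse)
  have par: "even (l + r) = even (l' + r)" "even (l + r) \<longleftrightarrow> r = 0" using l r by auto
  have w: "ws ! l = (if even (l + r) then stops ! (l + r) else edge_flip (stops ! (l + r)))"
    "ws ! Suc l = (if even (l + r) then stops ! Suc (l + r) else edge_flip (stops ! Suc (l + r)))"
    "ws ! l' = (if even (l + r) then stops ! (l' + r) else edge_flip (stops ! (l' + r)))"
    "ws ! Suc l' = (if even (l + r) then stops ! Suc (l' + r) else edge_flip (stops ! Suc (l' + r)))"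
    using q[of l] q[of "Suc l"] q[of l'] q[of "Suc l'"] l par(2) by auto
  consider "l = l'" | "l < l'" | "l' < l" by linarith
  then show "\<not> cross p p'"
  proof cases
    case 1
    then show ?thesis unfolding l(3,6) by (auto simp: cyc_def)
  next
    case 2
    then show ?thesis using arcs_noncrossing[of "l + r" "l' + r"] l r par unfolding l(3,6) w by auto
  next
    case 3
    then have "\<not> cross p' p"
      using arcs_noncrossing[of "l' + r" "l + r"] l r par unfolding l(3,6) w by auto
    then show ?thesis using cross_sym by blast
  qed
qed

lemma chord_system_positions: "chord_system positions"
  unfolding chord_system_def
proof (intro conjI)
  have len: "length positions = k" by (simp add: positions_def k_def)
  then show "odd (length positions)" using odd_k by simp
  have set: "set positions = (\<lambda>t. edge_pos (\<gamma> t)) ` crossings"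
    using finite_crossings by (simp add: positions_def)
  have "inj_on (\<lambda>t. edge_pos (\<gamma> t)) crossings"
  proof (rule inj_onI)
    fix s t assume st: "s \<in> crossings" "t \<in> crossings" "edge_pos (\<gamma> s) = edge_pos (\<gamma> t)"
    obtain i where i: "level i (\<gamma> s) \<in> \<int>" "torus_proj (\<gamma> s) \<noteq> vertex" using crossing_pos[OF st(1)] by blast
    obtain j where j: "level j (\<gamma> t) \<in> \<int>" "torus_proj (\<gamma> t) \<noteq> vertex" using crossing_pos[OF st(2)] by blast
    have "torus_proj (\<gamma> s) = torus_proj (\<gamma> t)" using edge_pos_inj[OF i(1) j(1) i(2) j(2) st(3)] .
    then have "\<eta> s = \<eta> t" using lift[of s] lift[of t] st by (simp add: crossings_def)
    then show "s = t" using loop_free st unfolding loop_free_def crossings_def by force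
  qed
  then show "distinct positions" using finite_crossings by (simp add: positions_def distinct_map)
  show "0 \<notin> set positions" "1 \<notin> set positions"
    unfolding set by (auto elim!: crossing_pos)
  show "noncrossing (set (pairs (0 # positions)))"
  proof (rule noncrossing_arcs[of _ 0])
    fix j assume "j < k + 1"
    then show "(0 # positions) ! j = (if (0::nat) = 0 then stops ! (j + 0) else edge_flip (stops ! (j + 0)))"
      using len by (cases j) (simp_all add: stops_def nth_append)
  qed (use len in auto)
  show "noncrossing (set (pairs (map edge_flip positions @ [0])))"
  proof (rule noncrossing_arcs[of _ 1])
    fix j assume "j < k + 1"
    then show "(map edge_flip positions @ [0]) ! j = (if (1::nat) = 0 then stops ! (j + 1) else edge_flip (stops ! (j + 1)))"
      using len by (simp add: stops_def nth_append)
  qed (use len in auto)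
qed

lemma curve_word_positions: "curve_word \<eta> = map side_of positions"
proof -
  have "curve_word \<eta> = map (\<lambda>x. side_of (edge_pos (\<gamma> x))) (sorted_list_of_set crossings)"
    unfolding crossings_def
    using lift not_vertex finite_crossings by (intro curve_word_eq_map) (auto simp: crossings_def)
  then show ?thesis by (simp add: positions_def comp_def)
qed

end

theorem curve_chord_system:
  assumes "admissible \<eta>" "loop_free \<eta>" "odd (length (curve_word \<eta>))"
  shows "\<exists>xs. chord_system xs \<and> curve_word \<eta> = map side_of xs"
proof -
  have "path \<eta>" using assms(1) by (simp add: admissible_def)
  then obtain \<gamma> where "continuous_on {0..1} \<gamma>" "\<And>t. t \<in> {0..1} \<Longrightarrow> torus_proj (\<gamma> t) = \<eta> t"
    using torus_path_lift by blast
  then interpret rigid_curve \<eta> \<gamma> using assms by unfold_locales auto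
  show ?thesis using chord_system_positions curve_word_positions by blast
qed

section \<open>Straight curves\<close>

lemma strict_sorted_set_unique:
  fixes xs :: "real list"
  assumes "sorted_wrt (<) xs" "set xs = X" shows "sorted_list_of_set X = xs"
  using assms sorted_list_of_set.idem_if_sorted_distinct strict_sorted_iff by blast

locale coprime_slope =
  fixes a b :: nat
  assumes a_pos: "0 < a" and b_pos: "0 < b" and coprime: "coprime a b"
begin

definition line :: "real \<Rightarrow> real \<times> real" where
  "line t = (t * real a, t * real b)"

lemma straight_curve_line: "straight_curve (int a, int b) t = torus_proj (line t)"
  by (simp add: straight_curve_def line_def)

text \<open>The increase of \<open>level i\<close> along the segment, so that edge \<open>i\<close>
  is crossed \<open>slope i - 1\<close> times in the interior.\<close>

definition slope :: "index \<Rightarrow> nat" where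
  "slope i = (case i of I1 \<Rightarrow> b | I2 \<Rightarrow> a + b | I3 \<Rightarrow> a)"

lemma slope_pos: "0 < slope i"
  using a_pos b_pos by (cases i) (auto simp: slope_def)

lemma level_line: "level i (line t) = t * real (slope i)"
  by (cases i) (simp_all add: slope_def line_def algebra_simps)

lemma line_not_vertex:
  assumes "0 < t" "t < 1"
  shows "torus_proj (line t) \<noteq> vertex"
proof
  assume "torus_proj (line t) = vertex"
  then obtain p q where pq: "t * real a = of_int p" "t * real b = of_int q"
    unfolding torus_proj_eq_vertex line_def by (auto elim!: Ints_cases)
  have "real_of_int (p * int b) = real_of_int (q * int a)"
    using pq by (metis mult.assoc mult.commute of_int_mult of_int_of_nat_eq)
  then have "p * int b = q * int a" by (simp only: of_int_eq_iff)
  then have "int a dvd p" using coprime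
    by (metis coprime_dvd_mult_left_iff coprime_int_iff dvd_triv_right)
  moreover have "0 < t * real a" "t * real a < real a" using assms a_pos by simp_all
  then have "0 < p" "p < int a" unfolding pq by linarith+
  ultimately show False using zdvd_not_zless by blast
qed

definition line_crossings :: "real set" where
  "line_crossings = {t \<in> {0<..<1}. torus_proj (line t) \<in> edges}"

lemma line_crossings_iff:
  "t \<in> line_crossings \<longleftrightarrow> 0 < t \<and> t < 1 \<and> (\<exists>i. t * real (slope i) \<in> \<int>)"
  by (auto simp: line_crossings_def edges_def torus_proj_in_edge level_line)

lemma side_crossings: "{t. 0 < t \<and> t < 1 \<and> t * real (slope i) \<in> \<int>} = (\<lambda>n. real n / real (slope i)) ` {1..<slope i}"
proof (intro equalityI subsetI)
  fix t assume "t \<in> {t. 0 < t \<and> t < 1 \<and> t * real (slope i) \<in> \<int>}"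
  then have t: "0 < t" "t < 1" "t * real (slope i) \<in> \<int>" by auto
  then obtain z where z: "t * real (slope i) = of_int z" by (auto elim: Ints_cases)
  have "0 < t * real (slope i)" "t * real (slope i) < real (slope i)" using t slope_pos[of i] by simp_all
  then have "0 < z" "z < int (slope i)" unfolding z by linarith+
  then have "t = real (nat z) / real (slope i)" "nat z \<in> {1..<slope i}"
    using z slope_pos[of i] by (auto simp: field_simps)
  then show "t \<in> (\<lambda>n. real n / real (slope i)) ` {1..<slope i}" by blast
qed (use slope_pos[of i] in auto)

lemma card_side_crossings: "card {t. 0 < t \<and> t < 1 \<and> t * real (slope i) \<in> \<int>} = slope i - 1"
  unfolding side_crossings using slope_pos[of i] by (subst card_image) (auto simp: inj_on_def)

lemma finite_line_crossings: "finite line_crossings"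
proof -
  have "i \<in> {I1, I2, I3}" for i by (cases i) auto
  then have "finite (UNIV :: index set)" using finite_subset[of UNIV "{I1, I2, I3}"] by blast
  moreover have "line_crossings = (\<Union>i. {t. 0 < t \<and> t < 1 \<and> t * real (slope i) \<in> \<int>})"
    by (auto simp: line_crossings_iff)
  ultimately show ?thesis by (simp add: side_crossings)
qed

definition side_at :: "real \<Rightarrow> index" where
  "side_at t = side_of (edge_pos (line t))"

lemma side_at_iff:
  assumes "t \<in> line_crossings"
  shows "side_at t = i \<longleftrightarrow> t * real (slope i) \<in> \<int>"
proof -
  have t: "0 < t" "t < 1" using assms by (auto simp: line_crossings_iff)
  have v: "torus_proj (fst (line t), snd (line t)) \<noteq> vertex" using line_not_vertex[OF t] by simp
  have imp: "side_at t = j" if "t * real (slope j) \<in> \<int>" for j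
    using edge_pos_side[OF _ v, of j] that by (simp add: side_at_def flip: level_line)
  obtain j where "t * real (slope j) \<in> \<int>" using assms by (auto simp: line_crossings_iff)
  then show ?thesis using imp by metis
qed

definition word :: "index list" where
  "word = map side_at (sorted_list_of_set line_crossings)"

lemma curve_word_straight: "curve_word (straight_curve (int a, int b)) = word"
proof -
  have X: "{x \<in> {0<..<1}. straight_curve (int a, int b) x \<in> edges} = line_crossings"
    by (auto simp: line_crossings_def straight_curve_line)
  show ?thesis
    using curve_word_eq_map[of "straight_curve (int a, int b)" line]
      finite_line_crossings line_not_vertex
    unfolding X by (simp add: word_def side_at_def straight_curve_line)
qed

lemma length_filter_word: "length (filter (\<lambda>j. j = i) word) = slope i - 1"
proof -
  have "length (filter (\<lambda>j. j = i) word) = length (filter (\<lambda>t. side_at t = i) (sorted_list_of_set line_crossings))"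
    by (simp add: word_def filter_map comp_def)
  also have "\<dots> = card {t \<in> line_crossings. side_at t = i}"
    using distinct_length_filter[of "sorted_list_of_set line_crossings" "\<lambda>t. side_at t = i"] finite_line_crossings
    by (simp add: Int_def conj_commute)
  also have "{t \<in> line_crossings. side_at t = i} = {t. 0 < t \<and> t < 1 \<and> t * real (slope i) \<in> \<int>}"
    using side_at_iff by (auto simp: line_crossings_iff)
  finally show ?thesis by (simp add: card_side_crossings)
qed

lemma odd_length_word: "odd (length word)"
proof -
  have len: "length w = length (filter (\<lambda>j. j = I1) w) + length (filter (\<lambda>j. j = I2) w) + length (filter (\<lambda>j. j = I3) w)" for w
  proof (induction w)
    case (Cons i w)
    then show ?case by (cases i) auto
  qed simp
  have "length word = (b - 1) + (a + b - 1) + (a - 1)"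
    unfolding len[of word] length_filter_word by (simp add: slope_def)
  then have "length word + 3 = 2 * (a + b)" using a_pos b_pos by simp
  then show ?thesis by presburger
qed

lemma reflect_crossings: "t \<in> line_crossings \<Longrightarrow> 1 - t \<in> line_crossings \<and> side_at (1 - t) = side_at t"
proof -
  assume t: "t \<in> line_crossings"
  have Z: "(1 - t) * real (slope i) \<in> \<int> \<longleftrightarrow> t * real (slope i) \<in> \<int>" for i
  proof -
    have "(1 - t) * real (slope i) = of_nat (slope i) - t * real (slope i)" by (simp add: algebra_simps)
    then show ?thesis by (metis Ints_diff Ints_of_nat diff_diff_eq2 add_diff_cancel_left')
  qed
  have "1 - t \<in> line_crossings" using t unfolding line_crossings_iff Z by auto
  moreover from this have "side_at (1 - t) = side_at t"
    using side_at_iff[OF t] side_at_iff[of "1 - t"] Z by metis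
  ultimately show ?thesis by blast
qed

text \<open>The point reflection \<open>t \<mapsto> 1 - t\<close> maps the crossings of each edge to
  themselves and reverses their order.\<close>

lemma rev_word: "rev word = word"
proof -
  let ?l = "sorted_list_of_set line_crossings"
  have s: "sorted_wrt (<) ?l" "set ?l = line_crossings"
    using finite_line_crossings by (simp_all add: strict_sorted_list_of_set)
  have "sorted_wrt (<) (rev (map (\<lambda>t. 1 - t) ?l))"
    using s(1) by (simp add: sorted_wrt_rev sorted_wrt_map)
  moreover have "(\<lambda>t. 1 - t) ` line_crossings = line_crossings"
  proof (intro equalityI subsetI)
    fix t assume "t \<in> line_crossings"
    then show "t \<in> (\<lambda>t. 1 - t) ` line_crossings"
      using reflect_crossings by (intro image_eqI[of _ _ "1 - t"]) auto
  qed (use reflect_crossings in auto)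
  ultimately have "?l = rev (map (\<lambda>t. 1 - t) ?l)"
    using s(2) by (intro strict_sorted_set_unique) auto
  then have "rev ?l = map (\<lambda>t. 1 - t) ?l" by (metis rev_rev_ident)
  then have "rev word = map (\<lambda>t. side_at (1 - t)) ?l" unfolding word_def rev_map by (simp add: comp_def)
  also have "\<dots> = word" unfolding word_def using s(2) reflect_crossings by (intro map_cong) auto
  finally show ?thesis .
qed

lemma integer_between:
  assumes "x < (y::real)" "\<lfloor>x\<rfloor> \<noteq> \<lfloor>y\<rfloor>" "y \<notin> \<int>"
  obtains n :: int where "x < of_int n" "of_int n < y"
proof
  have "\<lfloor>x\<rfloor> < \<lfloor>y\<rfloor>" using assms(1,2) by (simp add: floor_mono order_less_le)
  then show "x < of_int \<lfloor>y\<rfloor>" by linarith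
  show "of_int \<lfloor>y\<rfloor> < y" using assms(3) by (metis Ints_of_int of_int_floor_le order_le_less)
qed

lemma crossing_between:
  assumes "0 < s" "s < t" "t < 1" "s * real (slope i) < of_int n" "of_int n < t * real (slope i)"
  shows "\<exists>r\<in>line_crossings. s < r \<and> r < t"
proof -
  let ?r = "of_int n / real (slope i)"
  have "s < ?r" "?r < t" using assms slope_pos[of i] by (simp_all add: field_simps)
  moreover from this have "0 < ?r" "?r < 1" using assms by linarith+
  moreover have "?r * real (slope i) \<in> \<int>" using slope_pos[of i] by simp
  ultimately show ?thesis unfolding line_crossings_iff Bex_def by blast
qed

text \<open>Between consecutive crossings no level passes an integer. If both were on
  \<open>T\<^sub>1\<close> or both on \<open>T\<^sub>3\<close>, level \<open>I2\<close> would grow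
  by more than 1 and \<open>T\<^sub>2\<close> would be met in between. If both were on
  \<open>T\<^sub>2\<close>, the other levels would keep their floors \<open>p\<close> and
  \<open>q\<close>, and their sum could only be the integer \<open>p + q + 1\<close> both
  times.\<close>

lemma distinct_adj_word: "distinct_adj word"
proof (rule ccontr)
  assume "\<not> distinct_adj word"
  then obtain us s t vs where l: "sorted_list_of_set line_crossings = us @ s # t # vs" and e: "side_at s = side_at t"
    using not_distinct_adj_split unfolding word_def by blast
  have sorted: "sorted_wrt (<) (us @ s # t # vs)" and set: "set (us @ s # t # vs) = line_crossings"
    using l finite_line_crossings by (metis strict_sorted_list_of_set, metis set_sorted_list_of_set)
  have st: "s \<in> line_crossings" "t \<in> line_crossings" "s < t" using sorted set by (auto simp: sorted_wrt_append)
  have nth: "(us @ s # t # vs) ! length us = s" "(us @ s # t # vs) ! Suc (length us) = t"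
    by (simp_all add: nth_append)
  have "r \<notin> set (us @ s # t # vs)" if "s < r" "r < t" for r
    using sorted_wrt_no_gap[OF sorted, of "length us" r] that unfolding nth by simp
  then have gap: "\<not> (\<exists>r\<in>line_crossings. s < r \<and> r < t)" using set by blast
  have r: "0 < s" "t < 1" using st by (auto simp: line_crossings_iff)
  have no: "\<not> (s * real (slope i) < of_int n \<and> of_int n < t * real (slope i))" for i n
    using crossing_between[OF r(1) st(3) r(2)] gap by blast
  have fl: "\<lfloor>s * real (slope i)\<rfloor> = \<lfloor>t * real (slope i)\<rfloor>" if "side_at t \<noteq> i" for i
  proof (rule ccontr)
    assume "\<lfloor>s * real (slope i)\<rfloor> \<noteq> \<lfloor>t * real (slope i)\<rfloor>"
    moreover have "s * real (slope i) < t * real (slope i)" using st slope_pos[of i] by simp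
    moreover have "t * real (slope i) \<notin> \<int>" using side_at_iff[OF st(2)] that by simp
    ultimately show False using integer_between no by metis
  qed
  have sum: "u * real (slope I2) = u * real (slope I1) + u * real (slope I3)" for u
    by (simp add: slope_def algebra_simps)
  define i where "i = side_at t"
  obtain m n where mn: "s * real (slope i) = of_int m" "t * real (slope i) = of_int n"
    using side_at_iff[OF st(1), of i] side_at_iff[OF st(2), of i] e by (auto simp: i_def elim!: Ints_cases)
  have "s * real (slope i) < t * real (slope i)" using st slope_pos[of i] by simp
  then have mn': "m < n" unfolding mn by simp
  have pos: "s * real (slope j) < t * real (slope j)" for j using st slope_pos[of j] by simp
  show False
  proof (cases "i = I2")
    case True
    define p q where "p = \<lfloor>s * real (slope I1)\<rfloor>" and "q = \<lfloor>s * real (slope I3)\<rfloor>"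
    have pq: "p = \<lfloor>t * real (slope I1)\<rfloor>" "q = \<lfloor>t * real (slope I3)\<rfloor>"
      using fl True i_def by (auto simp: p_def q_def)
    have "s * real (slope I1) \<notin> \<int>" "s * real (slope I3) \<notin> \<int>"
      using side_at_iff[OF st(1)] e True i_def by (metis index.distinct(1,5))+
    then have "of_int p < s * real (slope I1)" "of_int q < s * real (slope I3)"
      unfolding p_def q_def by (metis Ints_of_int of_int_floor_le order_le_less)+
    moreover have "t * real (slope I1) < of_int p + 1" "t * real (slope I3) < of_int q + 1"
      unfolding pq by linarith+
    moreover have "of_int m = s * real (slope I1) + s * real (slope I3)" "of_int n = t * real (slope I1) + t * real (slope I3)"
      using mn True sum by metis+
    ultimately have "of_int (p + q) < (of_int m :: real)" "of_int n < (of_int (p + q + 2) :: real)" by simp_all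
    then show False using mn' unfolding of_int_less_iff by linarith
  next
    case False
    then have *: "i = I1 \<or> i = I3" using index.exhaust by blast
    have "real_of_int n - of_int m \<ge> 1" using mn' by linarith
    then have "t * real (slope I2) - s * real (slope I2) > 1"
      using * sum[of s] sum[of t] mn pos[of I1] pos[of I3] by auto
    then have "\<lfloor>s * real (slope I2)\<rfloor> \<noteq> \<lfloor>t * real (slope I2)\<rfloor>" by linarith
    then show False using fl False i_def by metis
  qed
qed

text \<open>Whenever the segment meets \<open>T\<^sub>1\<close> or \<open>T\<^sub>3\<close>, level
  \<open>I2\<close> already exceeds 1, so \<open>T\<^sub>2\<close> was met before.\<close>

lemma hd_word: "hd word = I2"
proof -
  let ?l = "sorted_list_of_set line_crossings"
  have "word \<noteq> []" using odd_length_word by (metis even_zero list.size(3))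
  then have "?l \<noteq> []" unfolding word_def by blast
  then obtain s vs where l: "?l = s # vs" by (cases ?l) auto
  have s: "s \<in> line_crossings" using l finite_line_crossings by (metis list.set_intros(1) set_sorted_list_of_set)
  have min: "s \<le> t" if "t \<in> line_crossings" for t
  proof -
    have "sorted_wrt (<) (s # vs)" "t \<in> set (s # vs)"
      using l finite_line_crossings that by (metis strict_sorted_list_of_set, metis set_sorted_list_of_set)
    then show ?thesis by auto
  qed
  have s01: "0 < s" "s < 1" using s by (auto simp: line_crossings_iff)
  have "side_at s = I2"
  proof (rule ccontr)
    assume "side_at s \<noteq> I2"
    then have i: "side_at s = I1 \<or> side_at s = I3" using index.exhaust by blast
    obtain n where n: "s * real (slope (side_at s)) = of_int n"
      using side_at_iff[OF s, of "side_at s"] by (auto elim: Ints_cases)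
    have "0 < s * real (slope (side_at s))" using s01 slope_pos by simp
    then have "0 < n" unfolding n by simp
    then have "1 \<le> s * real (slope (side_at s))" unfolding n by simp
    moreover have "0 < s * real (slope I1)" "0 < s * real (slope I3)" using s01 slope_pos by simp_all
    moreover have "s * real (slope I2) = s * real (slope I1) + s * real (slope I3)"
      by (simp add: slope_def algebra_simps)
    ultimately have "1 < s * real (slope I2)" using i by auto
    then have lt: "1 / real (slope I2) < s" using slope_pos[of I2] by (simp add: field_simps)
    moreover have "0 < 1 / real (slope I2)" "1 / real (slope I2) * real (slope I2) \<in> \<int>"
      using slope_pos[of I2] by simp_all
    moreover have "1 / real (slope I2) < 1" using lt s01 by linarith
    ultimately have "1 / real (slope I2) \<in> line_crossings"
      unfolding line_crossings_iff by blast
    then show False using min lt by fastforce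
  qed
  then show ?thesis using l by (simp add: word_def)
qed

text \<open>\<open>bend t\<close> differs from \<open>t\<close> only within \<open>margin\<close> of the ends, where it makes the curve run
  along \<open>(1, 1)\<close>, as admissibility demands.\<close>

definition margin :: real where "margin = 1 / (4 * (real a + real b)\<^sup>2)"

definition bend :: "real \<Rightarrow> real" where
  "bend t = t - max 0 (min t (margin - t)) + max 0 (min (1 - t) (margin - (1 - t)))"

text \<open>The largest multiple of (1,1) that can be split off from \<open>(a, b)\<close> with
  nonnegative remainder. Only the remainder is reparametrized by \<open>bend\<close>, so both
  coordinates stay strictly increasing.\<close>

definition mu :: real where "mu = real (min a b)"

definition bent :: "real \<Rightarrow> real \<times> real" where
  "bent t = (mu * t + (real a - mu) * bend t, mu * t + (real b - mu) * bend t)"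

text \<open>The bound 1/4 controls the deviation from the straight line in
  \<open>bent_coincidence\<close>, where twice it must stay below 1; the bound 1/8 controls the
  levels near the ends in \<open>bent_edges\<close>.\<close>

lemma margin_bounds: "0 < margin" "(real a + real b)\<^sup>2 * margin = 1 / 4" "(real a + real b) * margin \<le> 1 / 8"
  "margin \<le> 1 / 16"
proof -
  let ?n = "real a + real b"
  have n: "?n \<ge> 2" using a_pos b_pos by linarith
  then show "0 < margin" by (simp add: margin_def)
  have "?n \<noteq> 0" using n by simp
  then show sq: "?n\<^sup>2 * margin = 1 / 4" by (simp add: margin_def)
  then have "?n * (?n * margin) = 1 / 4" by (simp add: power2_eq_square)
  moreover have "2 * (?n * margin) \<le> ?n * (?n * margin)"
    using n \<open>0 < margin\<close> by (intro mult_right_mono) auto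
  ultimately show 8: "?n * margin \<le> 1 / 8" by simp
  moreover have "2 * margin \<le> ?n * margin" using n \<open>0 < margin\<close> by (intro mult_right_mono) auto
  ultimately show "margin \<le> 1 / 16" by simp
qed

lemma bend_facts:
  assumes "0 \<le> t" "t \<le> 1"
  shows "bend 0 = 0" "bend 1 = 1" "t \<le> margin \<Longrightarrow> 0 \<le> bend t \<and> bend t \<le> t"
    "1 - margin \<le> t \<Longrightarrow> t \<le> bend t \<and> bend t \<le> 1"
    "margin \<le> t \<Longrightarrow> t \<le> 1 - margin \<Longrightarrow> bend t = t"
    "t \<le> margin / 2 \<Longrightarrow> bend t = 0" "1 - margin / 2 \<le> t \<Longrightarrow> bend t = 1"
    "\<bar>t - bend t\<bar> \<le> margin"
  using assms margin_bounds(1,4) by (auto simp: bend_def max_def min_def)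

lemma bend_mono: "0 \<le> s \<Longrightarrow> s \<le> t \<Longrightarrow> t \<le> 1 \<Longrightarrow> bend s \<le> bend t"
  using margin_bounds(1,4) by (auto simp: bend_def max_def min_def)

lemma mu_bounds: "0 < mu" "mu \<le> real a" "mu \<le> real b"
  using a_pos b_pos by (auto simp: mu_def)

lemma bent_strict_mono:
  assumes "0 \<le> s" "s < t" "t \<le> 1"
  shows "fst (bent s) < fst (bent t)" "snd (bent s) < snd (bent t)"
proof -
  have "mu * s < mu * t" using assms mu_bounds by simp
  moreover have "(real a - mu) * bend s \<le> (real a - mu) * bend t" "(real b - mu) * bend s \<le> (real b - mu) * bend t"
    using bend_mono[of s t] assms mu_bounds by (intro mult_left_mono; simp)+
  ultimately show "fst (bent s) < fst (bent t)" "snd (bent s) < snd (bent t)" by (simp_all add: bent_def)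
qed

lemma bent_level_mono:
  "0 \<le> s \<Longrightarrow> s < t \<Longrightarrow> t \<le> 1 \<Longrightarrow> level i (bent s) < level i (bent t)"
  using bent_strict_mono[of s t] by (cases i) (auto simp: level_simps intro: add_strict_mono)

lemma bent_ends: "bent 0 = (0, 0)" "bent 1 = (real a, real b)"
  using bend_facts(1,2)[of 0] by (simp_all add: bent_def)

lemma continuous_bent: "continuous_on S bent"
  unfolding bent_def bend_def by (intro continuous_intros)

lemma level_bent: "level i (bent t) = real (slope i) * t + (real (slope i) - (if i = I2 then 2 * mu else mu)) * (bend t - t)"
  by (cases i) (simp_all add: level_simps bent_def slope_def algebra_simps)

text \<open>Within \<open>margin\<close> of the ends every level of both curves lies strictly
  between two consecutive integers, so neither meets an edge; elsewhere the curves coincide.\<close>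

lemma bent_edges:
  assumes "0 < t" "t < 1"
  shows "torus_proj (bent t) \<in> edges \<longleftrightarrow> torus_proj (line t) \<in> edges"
    "torus_proj (bent t) \<in> edges \<Longrightarrow> bent t = line t"
proof -
  have small: "w \<notin> \<int>" if "of_int n < w" "w < of_int n + 1" for w :: real and n
    using that by (auto elim!: Ints_cases)
  have c: "0 \<le> real (slope i) - (if i = I2 then 2 * mu else mu)" "0 < (if i = I2 then 2 * mu else mu)"
    "real (slope i) * margin \<le> 1 / 8" for i
  proof -
    show "0 \<le> real (slope i) - (if i = I2 then 2 * mu else mu)" "0 < (if i = I2 then 2 * mu else mu)"
      using mu_bounds by (cases i; simp add: slope_def)+
    have "real (slope i) \<le> real a + real b" by (cases i) (simp_all add: slope_def)
    then have "real (slope i) * margin \<le> (real a + real b) * margin"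
      using margin_bounds(1) by (intro mult_right_mono) auto
    then show "real (slope i) * margin \<le> 1 / 8" using margin_bounds(3) by linarith
  qed
  have pos: "real (slope i) > 0" for i using slope_pos[of i] by simp
  have mid: "bent t = line t" if "margin \<le> t" "t \<le> 1 - margin"
    using bend_facts(5)[of t] that assms by (simp add: bent_def line_def algebra_simps)
  have early: "torus_proj (bent t) \<notin> edges \<and> torus_proj (line t) \<notin> edges" if "t < margin"
  proof -
    have b: "0 \<le> bend t" "bend t \<le> t" using bend_facts(3)[of t] that assms by auto
    have "level i (bent t) \<notin> \<int> \<and> level i (line t) \<notin> \<int>" for i
    proof -
      let ?m = "if i = I2 then 2 * mu else mu"
      have st: "real (slope i) * t < 1 / 8"
        using mult_strict_left_mono[OF that pos[of i]] c(3)[of i] by linarith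
      have "(real (slope i) - ?m) * (bend t - t) \<le> 0" using c(1)[of i] b by (intro mult_nonneg_nonpos) auto
      moreover have "(real (slope i) - ?m) * (- t) \<le> (real (slope i) - ?m) * (bend t - t)"
        using c(1)[of i] b by (intro mult_left_mono) auto
      moreover have "0 < ?m * t" by (rule mult_pos_pos[OF c(2) assms(1)])
      ultimately have "0 < level i (bent t)" "level i (bent t) < 1"
        unfolding level_bent using st by (simp_all add: algebra_simps)
      moreover have "0 < level i (line t)" "level i (line t) < 1"
        using st assms pos[of i] by (simp_all add: level_line mult.commute)
      ultimately show ?thesis using small[of 0] by simp
    qed
    then show ?thesis by (simp add: edges_def torus_proj_in_edge)
  qed
  have late: "torus_proj (bent t) \<notin> edges \<and> torus_proj (line t) \<notin> edges" if "1 - margin < t"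
  proof -
    have b: "t \<le> bend t" "bend t \<le> 1" using bend_facts(4)[of t] that assms by auto
    have "level i (bent t) \<notin> \<int> \<and> level i (line t) \<notin> \<int>" for i
    proof -
      let ?m = "if i = I2 then 2 * mu else mu"
      have "1 - t < margin" using that by simp
      then have st: "real (slope i) * (1 - t) < 1 / 8"
        using mult_strict_left_mono[OF _ pos[of i]] c(3)[of i] by (smt (verit, best))
      have "(real (slope i) - ?m) * (bend t - t) \<ge> 0" using c(1)[of i] b by (intro mult_nonneg_nonneg) auto
      moreover have "(real (slope i) - ?m) * (bend t - t) \<le> (real (slope i) - ?m) * (1 - t)"
        using c(1)[of i] b by (intro mult_left_mono) auto
      moreover have "0 < ?m * (1 - t)" using c(2)[of i] assms by (intro mult_pos_pos) auto
      ultimately have "real (slope i) - 1 < level i (bent t)" "level i (bent t) < real (slope i)"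
        unfolding level_bent using st by (simp_all add: algebra_simps)
      moreover have "real (slope i) - 1 < level i (line t)" "level i (line t) < real (slope i)"
        using st assms pos[of i] by (simp_all add: level_line algebra_simps)
      ultimately show ?thesis using small[of "int (slope i) - 1"] by simp
    qed
    then show ?thesis by (simp add: edges_def torus_proj_in_edge)
  qed
  consider "t < margin" | "1 - margin < t" | "margin \<le> t" "t \<le> 1 - margin" by linarith
  then show "torus_proj (bent t) \<in> edges \<longleftrightarrow> torus_proj (line t) \<in> edges"
    "torus_proj (bent t) \<in> edges \<Longrightarrow> bent t = line t"
    using early late mid by (cases; simp)+
qed

text \<open>Up to a quarter, \<open>b x - a y\<close> vanishes along the bent curve, so that two points of the
  curve that agree on the torus differ by a multiple of \<open>(a, b)\<close>.\<close>

lemma bent_coincidence: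
  assumes "0 \<le> s" "s < t" "t \<le> 1" "torus_proj (bent s) = torus_proj (bent t)"
  shows "s = 0 \<and> t = 1"
proof -
  obtain p q where pq: "fst (bent t) - fst (bent s) = of_int p" "snd (bent t) - snd (bent s) = of_int q"
    using assms(4) unfolding torus_proj_eq_iff
    by (metis Ints_cases Ints_minus minus_diff_eq)
  have dev: "\<bar>real b * fst (bent u) - real a * snd (bent u)\<bar> \<le> 1 / 4" if "0 \<le> u" "u \<le> 1" for u
  proof -
    have "real b * fst (bent u) - real a * snd (bent u) = mu * (real b - real a) * (u - bend u)"
      by (simp add: bent_def algebra_simps)
    moreover have "\<bar>mu * (real b - real a) * (u - bend u)\<bar> \<le> (real a + real b) * (real a + real b) * margin"
      unfolding abs_mult using mu_bounds bend_facts(8)[OF that] by (intro mult_mono) auto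
    ultimately show ?thesis using margin_bounds(2) by (simp add: power2_eq_square)
  qed
  have "real_of_int (int b * p - int a * q) = (real b * fst (bent t) - real a * snd (bent t)) - (real b * fst (bent s) - real a * snd (bent s))"
    by (simp add: pq[symmetric] algebra_simps)
  then have "\<bar>real_of_int (int b * p - int a * q)\<bar> < 1" using dev[of s] dev[of t] assms by linarith
  then have "int b * p = int a * q" by linarith
  then have "int a dvd p" using coprime
    by (metis coprime_dvd_mult_right_iff coprime_int_iff dvd_triv_left)
  moreover have "0 < p" using bent_strict_mono(1)[OF assms(1-3)] pq(1) by simp
  ultimately have "int a \<le> p" using zdvd_imp_le by blast
  then have le: "real a \<le> fst (bent t) - fst (bent s)" unfolding pq by linarith
  have "0 \<le> fst (bent s)" "0 < s \<Longrightarrow> 0 < fst (bent s)"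
    using bent_strict_mono(1)[of 0 s] bent_ends assms by (cases "s = 0"; simp)+
  moreover have "fst (bent t) \<le> real a" "t < 1 \<Longrightarrow> fst (bent t) < real a"
    using bent_strict_mono(1)[of t 1] bent_ends assms by (cases "t = 1"; simp)+
  ultimately show ?thesis using le assms by force
qed

definition arc :: "real \<Rightarrow> torus" where
  "arc t = torus_proj (bent t)"

lemma loop_free_arc: "loop_free arc"
  unfolding loop_free_def
proof (intro ballI impI)
  fix s t :: real assume st: "s \<in> {0..1}" "t \<in> {0..1}" "arc s = arc t"
  then show "s = t \<or> s = 0 \<and> t = 1 \<or> s = 1 \<and> t = 0"
    using bent_coincidence[of s t] bent_coincidence[of t s] by (force simp: arc_def)
qed

lemma arc_vertex: "t \<in> {0..1} \<Longrightarrow> arc t = vertex \<longleftrightarrow> t \<in> {0, 1}"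
proof -
  assume t: "t \<in> {0..1}"
  have "arc 0 = vertex" "arc 1 = vertex" by (simp_all add: arc_def bent_ends torus_proj_eq_vertex)
  moreover have "t = 1" if "arc t = vertex" "0 < t"
    using bent_coincidence[of 0 t] that t \<open>arc 0 = vertex\<close> by (simp add: arc_def)
  ultimately show ?thesis using t by (cases "t = 0") auto
qed

lemma admissible_arc: "admissible arc"
  unfolding admissible_def
proof (intro conjI)
  show "path arc"
    unfolding path_def arc_def
    by (rule continuous_on_compose2[OF continuous_on_torus_proj continuous_bent]) simp
  show "\<forall>x\<in>{0..1}. (arc x = vertex) = (x \<in> {0, 1})" using arc_vertex by blast
  have m: "mu * margin \<le> 1 / 8"
    using mu_bounds margin_bounds(1,3) mult_right_mono[of mu "real a + real b" margin] by linarith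
  show "\<exists>\<epsilon>>0. \<epsilon> \<le> 1 \<and> arc ` {0..\<epsilon>} \<subseteq> start_segment \<and> arc ` {1 - \<epsilon>..1} \<subseteq> end_segment"
  proof (intro exI[of _ "margin / 2"] conjI)
    show "0 < margin / 2" "margin / 2 \<le> 1" using margin_bounds by auto
    show "arc ` {0..margin / 2} \<subseteq> start_segment"
    proof (intro image_subsetI)
      fix t assume t: "t \<in> {0..margin / 2}"
      then have "bend t = 0" using margin_bounds by (intro bend_facts(6)) auto
      then have e: "bent t = (mu * t, mu * t)" by (simp add: bent_def)
      have r: "0 \<le> mu * t" "mu * t \<le> 1 / 3"
      proof -
        have "t \<le> margin" "0 \<le> t" using t margin_bounds(1) by auto
        then have "mu * t \<le> mu * margin" using mu_bounds by (intro mult_left_mono) auto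
        then show "mu * t \<le> 1 / 3" using m by linarith
        show "0 \<le> mu * t" using mu_bounds \<open>0 \<le> t\<close> by simp
      qed
      have "(mu * t, mu * t) \<in> closed_segment (1/3, 1/3) (0, 0)"
        unfolding closed_segment_def using r by (intro CollectI exI[of _ "1 - 3 * (mu * t)"]) auto
      then show "arc t \<in> start_segment" unfolding arc_def e start_segment_def by blast
    qed
    show "arc ` {1 - margin / 2..1} \<subseteq> end_segment"
    proof (intro image_subsetI)
      fix t assume t: "t \<in> {1 - margin / 2..1}"
      then have "bend t = 1" using margin_bounds by (intro bend_facts(7)) auto
      then have e: "bent t = (real a - mu * (1 - t), real b - mu * (1 - t))" by (simp add: bent_def algebra_simps)
      have r: "0 \<le> mu * (1 - t)" "mu * (1 - t) \<le> 1 / 3"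
      proof -
        have "1 - t \<le> margin" "0 \<le> 1 - t" using t margin_bounds(1) by auto
        then have "mu * (1 - t) \<le> mu * margin" using mu_bounds by (intro mult_left_mono) auto
        then show "mu * (1 - t) \<le> 1 / 3" using m by linarith
        show "0 \<le> mu * (1 - t)" using mu_bounds \<open>0 \<le> 1 - t\<close> by simp
      qed
      have "(1 - mu * (1 - t), 1 - mu * (1 - t)) \<in> closed_segment (2/3, 2/3) (1, 1)"
        unfolding closed_segment_def using r
        by (intro CollectI exI[of _ "1 - 3 * (mu * (1 - t))"]) (auto simp: algebra_simps)
      moreover have "arc t = torus_proj (1 - mu * (1 - t), 1 - mu * (1 - t))"
        unfolding arc_def e torus_proj_eq_iff by simp
      ultimately show "arc t \<in> end_segment" unfolding end_segment_def by blast
    qed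
  qed
  show "\<forall>x\<in>{0..1}. arc x \<in> edges - {vertex} \<longrightarrow> crosses_transversally arc x"
  proof (intro ballI impI)
    fix x :: real assume x: "x \<in> {0..1}" "arc x \<in> edges - {vertex}"
    then have x01: "0 < x" "x < 1" using arc_vertex[OF x(1)] by (auto simp: order_less_le)
    obtain i where "level i (bent x) \<in> \<int>" using x(2) by (auto simp: edges_def arc_def torus_proj_in_edge)
    then show "crosses_transversally arc x"
      unfolding crosses_transversally_def
      using x01 continuous_bent bent_level_mono
      by (intro exI[of _ i] exI[of _ "min x (1 - x)"] exI[of _ bent] conjI disjI1) (auto simp: arc_def)
  qed
qed

lemma curve_word_arc: "curve_word arc = word"
proof -
  have "{x \<in> {0<..<1}. arc x \<in> edges} = line_crossings"
    unfolding line_crossings_def arc_def using bent_edges(1) by auto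
  moreover have "curve_word arc = map (\<lambda>x. side_of (edge_pos (bent x))) (sorted_list_of_set {x \<in> {0<..<1}. arc x \<in> edges})"
    using arc_vertex finite_line_crossings calculation
    by (intro curve_word_eq_map) (auto simp: arc_def)
  moreover have "bent x = line x" if "x \<in> line_crossings" for x
    using bent_edges[of x] that by (auto simp: line_crossings_def)
  ultimately show ?thesis
    using finite_line_crossings by (simp add: word_def side_at_def cong: map_cong)
qed

text \<open>The bent segment is fed into \<open>curve_chord_system\<close>. Its word has no repeated
  neighbours and begins and ends with \<open>I2\<close>, so \<open>chord_system_straight\<close>
  applies, and the letter counts \<open>slope i - 1\<close> identify the parameters of the run as
  \<open>a\<close> and \<open>b\<close>.\<close>

lemma word_elt_word:
  "word_elt m word = group.slope_elt (W m) (refl_gen m I1) (refl_gen m I2) (refl_gen m I3) a b"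
  if "2 \<le> m"
proof -
  interpret coxeter_triples "W m" m using that by (rule coxeter_triples_W)
  have inv: "refl_gen m i \<in> involutions" for i
    using coxeter_triple_W[OF that] by (cases i) (auto simp: coxeter_triple_def)
  obtain xs where xs: "chord_system xs" "word = map side_of xs"
    using curve_chord_system[OF admissible_arc loop_free_arc] odd_length_word curve_word_arc by auto
  have ne: "xs \<noteq> []" using xs odd_length_word by auto
  have hd: "side_of (hd xs) = I2" using hd_word ne unfolding xs(2) by (simp add: hd_map)
  have "last word = I2" using hd_word rev_word ne xs(2) by (metis hd_rev)
  then have last: "side_of (last xs) = I2" using ne unfolding xs(2) by (simp add: last_map)
  have "card {x \<in> set xs. side_of x = i} = slope i - 1" for i
  proof -
    have "card {x \<in> set xs. side_of x = i} = length (filter (\<lambda>x. side_of x = i) xs)"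
      using xs(1) distinct_length_filter[of xs "\<lambda>x. side_of x = i"]
      by (simp add: chord_system_def Int_def conj_commute)
    also have "\<dots> = length (filter (\<lambda>j. j = i) word)" unfolding xs(2) by (simp add: filter_map comp_def)
    finally show ?thesis by (simp add: length_filter_word)
  qed
  then have c: "card {x \<in> set xs. side_of x = I3} + 1 = a" "card {x \<in> set xs. side_of x = I1} + 1 = b"
    using a_pos b_pos by (simp_all add: slope_def)
  have "run a b b (map side_of (tl xs))"
    using chord_system_straight[OF xs(1) _ hd last] distinct_adj_word xs(2) unfolding c by simp
  moreover have "word = I2 # map side_of (tl xs)" using xs(2) ne hd by (cases xs) auto
  ultimately show ?thesis
    unfolding word_elt_eq_word_prod using run_slope_elt[OF inv inv inv a_pos b_pos] by simp
qed

end

section \<open>Roots and rigid reflections\<close>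

lemma root_reflection_slope_elt:
  assumes "2 \<le> m" "0 < a" "0 < b" "coprime a b"
  shows "root_reflection m (int a, int b) =
    group.slope_elt (W m) (refl_gen m I1) (refl_gen m I2) (refl_gen m I3) a b"
proof -
  interpret coprime_slope a b using assms by unfold_locales
  show ?thesis unfolding root_reflection_def curve_elt_def curve_word_straight
    using word_elt_word[OF assms(1)] .
qed

lemma root_reflection_rigid:
  assumes "0 < a" "0 < b" "coprime a b"
  shows "root_reflection m (int a, int b) \<in> rigid_reflections m"
proof -
  interpret coprime_slope a b using assms by unfold_locales
  have "root_reflection m (int a, int b) = curve_elt m arc"
    unfolding root_reflection_def curve_elt_def curve_word_straight curve_word_arc ..
  moreover have "curve_word arc \<in> odd_palindromes"
    unfolding curve_word_arc odd_palindromes_def using odd_length_word rev_word by simp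
  ultimately show ?thesis
    unfolding rigid_reflections_def using admissible_arc loop_free_arc by blast
qed

theorem theorem1p2:
  fixes m :: nat and L :: "(2, 'g::ab_group_add) kac_moody_data"
  assumes "m \<ge> 2" and "kac_moody_algebra (cartan_matrix m) L"
  shows "root_reflection m ` reduced_positive_roots L = rigid_reflections m"
proof (intro equalityI subsetI)
  fix g assume "g \<in> root_reflection m ` reduced_positive_roots L"
  then obtain a b where ab: "g = root_reflection m (a, b)" "a \<ge> 0" "b \<ge> 0" "gcd a b = 1" "a * b \<noteq> 0"
    by (auto simp: reduced_positive_roots_def)
  then have "a = int (nat a)" "b = int (nat b)" "0 < nat a" "0 < nat b" by auto
  moreover from this have "coprime (nat a) (nat b)"
    using ab(4) by (metis coprime_iff_gcd_eq_1 coprime_int_iff)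
  ultimately show "g \<in> rigid_reflections m" using root_reflection_rigid ab(1) by metis
next
  fix g assume "g \<in> rigid_reflections m"
  then obtain \<eta> where \<eta>: "g = word_elt m (curve_word \<eta>)" "admissible \<eta>" "loop_free \<eta>"
    "odd (length (curve_word \<eta>))" "rev (curve_word \<eta>) = curve_word \<eta>"
    by (auto simp: rigid_reflections_def odd_palindromes_def curve_elt_def)
  obtain xs where xs: "chord_system xs" "curve_word \<eta> = map side_of xs"
    using curve_chord_system \<eta>(2-4) by blast
  interpret coxeter_triples "W m" m using assms(1) by (rule coxeter_triples_W)
  let ?x = "refl_gen m I1" and ?y = "refl_gen m I2" and ?z = "refl_gen m I3"
  \<comment> \<open>With \<open>R\<close> the set of values at roots, membership of \<open>g\<close>
    in \<open>R\<close> produces the required root.\<close>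
  define R where "R = {slope_elt ?x ?y ?z a b | a b. root_pair a b}"
  have t: "coxeter_triple ?x ?y ?z" using assms(1) by (rule coxeter_triple_W)
  then have "good_triple R ?x ?y ?z" by (auto simp: good_triple_def R_def)
  then have "sector_triple R ?x ?y ?z" using t by (simp add: sector_triple_def coxeter_triple_def)
  then have "g \<in> R"
    using chord_system_word[OF xs(1)] \<eta>(5) unfolding \<eta>(1) xs(2) word_elt_eq_word_prod by blast
  then obtain a b where ab: "root_pair a b" "g = slope_elt ?x ?y ?z a b" by (auto simp: R_def)
  then have r: "0 < a" "0 < b" "coprime a b" "a * a + b * b \<le> m * a * b + 1" by (auto simp: root_pair_def)
  then have "(int a, int b) \<in> reduced_positive_roots L"
    using reduced_positive_root[OF assms(2,1)] by blast
  moreover have "g = root_reflection m (int a, int b)"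
    using root_reflection_slope_elt[OF assms(1) r(1-3)] ab(2) by simp
  ultimately show "g \<in> root_reflection m ` reduced_positive_roots L" by blast
qed

end
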